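(* There exists a numerical constant $C$ such that the following holds for every $r$ with $0<r<e^{-2}$. Let $$K_t(s)=(t-s)_+^{-1/2}\,|\ln (t-s)_+|^{-1},\qquad s,t\in[0,r],$$ (understood as $0$ when $s\ge t$), let $\mathcal{V}:L_2[0,r]\to C[0,r]$ be the operator $$(\mathcal{V}f)(t)=\int_0^t f(s)K_t(s)\,ds,\qquad 0\le t\le r,$$ and let $\mathcal{V}^*:\mathbb{M}[0,r]\to L_2[0,r]$ be its adjoint $$(\mathcal{V}^*\mu)(s)=\int_0^r K_t(s)\,\mu(dt),\qquad 0\le s\le r.$$ Then for all positive integers $n$ $$\max\{e_n(\mathcal{V}),\,e_n(\mathcal{V}^* )\}\le C\,n^{-1/2}.$$
   Context: $\mathbb{M}[0,r]$ is the space of signed (real) Borel measures of finite variation on $[0,r]$, with the total variation norm $\|\cdot\|_1$. $C[0,r]$ is the space of continuous real functions on $[0,r]$ with the supremum norm, and $L_2[0,r]$ is the real Hilbert space with respect to Lebesgue measure. $x_+=\max(x,0)$. Entropy numbers: for a set $A$ in a metric space, the $n$-th dyadic entropy number $e_n(A)$ is the infimum of $\varepsilon>0$ such that $A$ admits a covering by $2^{n-1}$ balls of radius $\varepsilon$. For a linear operator $V:X\to Y$ between normed spaces, $e_n(V)$ is the $n$-th entropy number of the image under $V$ of the unit ball of $X$, as a subset of $Y$. *)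

theory Defs
  imports "HOL-Analysis.Analysis"
begin

section \<open>Entropy numbers\<close>

text \<open>
  A (pseudo-)metric space is given by a carrier \<open>X\<close> and a distance \<open>d\<close>. Centres lie in \<open>X\<close>
  and repetitions are allowed, so at most \<open>2 ^ (n - 1)\<close> balls are used. Balls are subsets
  of \<open>X\<close>; hence a set \<open>A\<close> which is not contained in \<open>X\<close> has no covering at all, and its entropy
  numbers are infinite. They are extended reals, so that the infimum of
  the empty set is \<open>\<infinity>\<close>. Only \<open>n \<ge> 1\<close> is meaningful.
\<close>

definition entropy_number :: "'a set \<Rightarrow> ('a \<Rightarrow> 'a \<Rightarrow> real) \<Rightarrow> 'a set \<Rightarrow> nat \<Rightarrow> ereal" where
  "entropy_number X d A n =
     (INF \<epsilon>\<in>{\<epsilon>::real. 0 < \<epsilon> \<and>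
        (\<exists>c :: nat \<Rightarrow> 'a. (\<forall>i<2 ^ (n - 1). c i \<in> X) \<and>
           A \<subseteq> (\<Union>i<2 ^ (n - 1). {x\<in>X. d (c i) x \<le> \<epsilon>}))}. ereal \<epsilon>)"

text \<open>
  Here a normed space is given by a carrier and a function which may be only a seminorm: functions
  equal almost everywhere are not identified, and values outside the relevant domain are
  ignored. Entropy numbers do not change on passing to the quotient by the null elements.
\<close>

definition operator_entropy_number ::
  "'a set \<Rightarrow> ('a \<Rightarrow> real) \<Rightarrow> 'b::minus set \<Rightarrow> ('b \<Rightarrow> real) \<Rightarrow> ('a \<Rightarrow> 'b) \<Rightarrow> nat \<Rightarrow> ereal" where
  "operator_entropy_number X N Y N' V n =
     entropy_number Y (\<lambda>x y. N' (x - y)) (V ` {x\<in>X. N x \<le> 1}) n"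


section \<open>Function spaces on \<open>[0, r]\<close>\<close>

definition C_space :: "real \<Rightarrow> (real \<Rightarrow> real) set" where
  "C_space r = {f. continuous_on {0..r} f}"

definition sup_norm :: "real \<Rightarrow> (real \<Rightarrow> real) \<Rightarrow> real" where
  "sup_norm r f = (SUP t\<in>{0..r}. \<bar>f t\<bar>)"

definition L2_space :: "real \<Rightarrow> (real \<Rightarrow> real) set" where
  "L2_space r = {f \<in> borel_measurable (lebesgue_on {0..r}).
                   integrable (lebesgue_on {0..r}) (\<lambda>s. (f s)\<^sup>2)}"

definition L2_norm :: "real \<Rightarrow> (real \<Rightarrow> real) \<Rightarrow> real" where
  "L2_norm r f = sqrt (LINT s|lebesgue_on {0..r}. (f s)\<^sup>2)"


section \<open>Signed measures\<close>

text \<open>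
  Signed measures are real-valued set functions. The argument \<open>M\<close> only provides the underlying
  measurable space; the values of \<open>\<nu>\<close> on sets outside \<open>sets M\<close> are irrelevant.
\<close>

definition signed_measure :: "'a measure \<Rightarrow> ('a set \<Rightarrow> real) \<Rightarrow> bool" where
  "signed_measure M \<nu> \<longleftrightarrow> \<nu> {} = 0 \<and>
     (\<forall>A :: nat \<Rightarrow> 'a set. range A \<subseteq> sets M \<longrightarrow> disjoint_family A \<longrightarrow>
        (\<lambda>i. \<nu> (A i)) sums \<nu> (\<Union>i. A i))"

definition variation :: "'a measure \<Rightarrow> ('a set \<Rightarrow> real) \<Rightarrow> 'a set \<Rightarrow> ennreal" where
  "variation M \<nu> A =
     (SUP P\<in>{P. finite P \<and> P \<subseteq> sets M \<and> partition_on A P}. \<Sum>B\<in>P. ennreal \<bar>\<nu> B\<bar>)"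

text \<open>
  The Jordan decomposition of \<open>\<nu>\<close>: the positive and negative parts are
  \<open>(\<bar>\<nu>\<bar> + \<nu>) / 2\<close> and \<open>(\<bar>\<nu>\<bar> - \<nu>) / 2\<close>, where \<open>\<bar>\<nu>\<bar>\<close> is the variation (assumed finite).
\<close>

definition positive_part :: "'a measure \<Rightarrow> ('a set \<Rightarrow> real) \<Rightarrow> 'a measure" where
  "positive_part M \<nu> =
     measure_of (space M) (sets M) (\<lambda>A. ennreal ((enn2real (variation M \<nu> A) + \<nu> A) / 2))"

definition negative_part :: "'a measure \<Rightarrow> ('a set \<Rightarrow> real) \<Rightarrow> 'a measure" where
  "negative_part M \<nu> =
     measure_of (space M) (sets M) (\<lambda>A. ennreal ((enn2real (variation M \<nu> A) - \<nu> A) / 2))"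

definition signed_integral :: "'a measure \<Rightarrow> ('a set \<Rightarrow> real) \<Rightarrow> ('a \<Rightarrow> real) \<Rightarrow> real" where
  "signed_integral M \<nu> f = (LINT t|positive_part M \<nu>. f t) - (LINT t|negative_part M \<nu>. f t)"

abbreviation borel_on :: "real \<Rightarrow> real measure" where
  "borel_on r \<equiv> restrict_space borel {0..r}"

definition M_space :: "real \<Rightarrow> (real set \<Rightarrow> real) set" where
  "M_space r = {\<nu>. signed_measure (borel_on r) \<nu> \<and> variation (borel_on r) \<nu> {0..r} < \<infinity>}"

definition variation_norm :: "real \<Rightarrow> (real set \<Rightarrow> real) \<Rightarrow> real" where
  "variation_norm r \<nu> = enn2real (variation (borel_on r) \<nu> {0..r})"


section \<open>The operators\<close>

definition kernel :: "real \<Rightarrow> real \<Rightarrow> real" where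
  "kernel t s = (if s < t then (t - s) powr (-1/2) * inverse \<bar>ln (t - s)\<bar> else 0)"

definition V_op :: "(real \<Rightarrow> real) \<Rightarrow> real \<Rightarrow> real" where
  "V_op f t = (LINT s|lebesgue_on {0..t}. f s * kernel t s)"

text \<open>
  For a given \<open>\<mu>\<close> of finite variation the integral below converges absolutely for almost every \<open>s\<close>;
  the value at the remaining points does not affect the class in \<open>L\<^sub>2[0, r]\<close>.
\<close>

definition V_adj :: "real \<Rightarrow> (real set \<Rightarrow> real) \<Rightarrow> real \<Rightarrow> real" where
  "V_adj r \<mu> s = signed_integral (borel_on r) \<mu> (\<lambda>t. kernel t s)"

end

theory Submission
  imports Defs "HOL-Real_Asymp.Real_Asymp"
begin

text \<open>
  The kernel functions \<open>K\<^sub>t\<close> are compared with a binary tree. Restrict \<open>t\<close> to a grid of mesh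
  \<open>r / 2^J\<close>, \<open>J = 3 n\<close>, and write \<open>q = \<bar>ln \<ell>\<bar>\<close> for the level of a dyadic interval of length \<open>\<ell>\<close>. Since the
  correlation function of \<open>K\<close> is convex and decreasing, it is a mixture of triangle functions,
  and this yields \<open>\<parallel>\<Sum> a\<^sub>i K\<^sub>t\<^sub>i\<parallel>\<^sup>2 \<le> C E(a)\<close>, where the energy \<open>E(a)\<close> is the sum over dyadic
  intervals \<open>I\<close> of \<open>a(I)\<^sup>2\<close> with weights of order \<open>q\<^sup>-\<^sup>2\<close> (and \<open>q\<^sup>-\<^sup>1\<close> at the finest level). The crucial
  point is that \<open>E(a) \<le> 3 \<parallel>a\<parallel>\<^sub>1\<close> whenever \<open>\<bar>a(I)\<bar> \<le> q\<close> for all \<open>I\<close>.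

  For the adjoint operator, the intervals with \<open>n \<mu>(I) > q\<close> form a tree with \<open>O(n)\<close> nodes. This tree,
  together with the rounded masses of its leaves, is a code of \<open>O(n)\<close> bits which determines
  \<open>n \<mu>(I)\<close> up to an error \<open>q\<close> for all \<open>I\<close>, hence \<open>V\<^sup>*\<mu>\<close> up to \<open>C n\<^sup>-\<^sup>1\<^sup>/\<^sup>2\<close>.

  For \<open>V\<close> itself the same estimate is used through duality: by separation, the values of \<open>V f\<close> on the
  grid are approximated up to \<open>2 n\<^sup>-\<^sup>1\<^sup>/\<^sup>2\<close> by sums of numbers \<open>y\<^sub>I\<close> along the branches with
  \<open>\<Sum> q \<bar>y\<^sub>I\<bar> \<le> C n\<^sup>1\<^sup>/\<^sup>2\<close>. Rounding these sums on a randomly shifted grid turns the \<open>y\<^sub>I\<close> into integer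
  multiples of \<open>n\<^sup>-\<^sup>1\<^sup>/\<^sup>2\<close>, which are again encoded by \<open>O(n)\<close> bits.
\<close>

section \<open>Energies on the binary tree\<close>

text \<open>K_t has only a logarithmic modulus of continuity in L_2 (squared distance at most 2 /
  |ln d| at distance d), so a uniform grid must be exponentially fine: height 3n makes |ln mesh| at
  least 2n. Recording every interval is then hopeless. What saves the count is that
  \<open>lev\<close> grows linearly towards the leaves: at depth j a node must pass a threshold, or
  pay a price, proportional to 2 + j up to constants, and this pays for its j ancestors. The same
  bookkeeping occurs three times: in the energy bound, in the code length of a measure and in the
  code length of a tree function. Each time the induction closes because a reserve
  (\<open>lev\<close> or a multiple of the depth) is subtracted from a linear bound.

  In scale-invariant form the energy bound reads E(a) <= 3 M |a|_1 with M the maximum of |a(I)| / q,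
  a product of two norms. The duality for V mirrors this: one norm is tested by a single node, the
  other by a sign pattern, and the arithmetic-geometric inequality gives the contradiction. The
  bound for V thus comes from separation on the grid, not from a general duality of entropy
  numbers.\<close>

text \<open>The node \<open>m\<close> at height \<open>d\<close> has the leaves \<open>m * 2^d, \<dots>, (m + 1) * 2^d - 1\<close>, and \<open>J\<close> is the height of the root.\<close>

definition blk :: "(nat \<Rightarrow> real) \<Rightarrow> nat \<Rightarrow> nat \<Rightarrow> real" where
  "blk a d m = sum a {m * 2^d..<(m+1) * 2^d}"

lemma blk_0 [simp]: "blk a 0 m = a m"
  by (simp add: blk_def)

lemma blk_Suc: "blk a (Suc d) m = blk a d (2*m) + blk a d (2*m+1)"
proof -
  have "{m * 2^Suc d..<(m+1) * 2^Suc d} = {2*m*2^d..<(2*m+1)*2^d} \<union> {(2*m+1)*2^d..<(2*m+1+1)*2^d}"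
    by (auto simp: algebra_simps)
  then show ?thesis
    unfolding blk_def by (subst sum.union_disjoint[symmetric]) (auto simp: algebra_simps)
qed

lemma blk_diff: "blk (\<lambda>i. a i - b i) d m = blk a d m - blk b d m"
  by (simp add: blk_def sum_subtractf)

lemma blk_cmult: "blk (\<lambda>i. c * a i) d m = c * blk a d m"
  by (simp add: blk_def sum_distrib_left)

lemma blk_nonneg: "(\<And>i. 0 \<le> a i) \<Longrightarrow> 0 \<le> blk a d m"
  by (simp add: blk_def sum_nonneg)

lemma abs_blk_le: "\<bar>blk a d m\<bar> \<le> blk (\<lambda>i. \<bar>a i\<bar>) d m"
  by (simp add: blk_def)

lemma sum_even_odd: "(\<Sum>i<2*n. f i) = (\<Sum>i<n. f (2*i) + f (2*i+1))" for f :: "nat \<Rightarrow> 'a::comm_monoid_add"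
  by (induction n) (auto simp: add.assoc)

lemma blk_mono_mem:
  assumes "\<And>i. 0 \<le> a i" "e \<le> d" "m' div 2^(d-e) = m"
  shows "blk a e m' \<le> blk a d m"
  using assms(2,3)
proof (induction "d - e" arbitrary: e m')
  case 0 then show ?case by simp
next
  case (Suc k)
  have "blk a e m' \<le> blk a (Suc e) (m' div 2)"
  proof -
    consider "m' = 2 * (m' div 2)" | "m' = 2 * (m' div 2) + 1" by linarith
    then show ?thesis
    proof cases
      case 1 then show ?thesis using assms(1) blk_Suc[of a e "m' div 2"] blk_nonneg[of a e "2*(m' div 2)+1"] by simp
    next
      case 2 then show ?thesis using assms(1) blk_Suc[of a e "m' div 2"] blk_nonneg[of a e "2*(m' div 2)"] by simp
    qed
  qed
  also have "\<dots> \<le> blk a d m"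
  proof (rule Suc.hyps(1))
    show "k = d - Suc e" "Suc e \<le> d" using Suc by auto
    have "d - e = Suc (d - Suc e)" using Suc by auto
    then show "m' div 2 div 2 ^ (d - Suc e) = m" using Suc.prems by (simp add: div_mult2_eq)
  qed
  finally show ?case .
qed

text \<open>\<open>lam\<close> stands for |ln| of the mesh, so that \<open>lev d\<close> becomes
  |ln| of the length of a node at height \<open>d\<close>. The assumption concerns the root, whose
  length is \<open>r\<close>: it says |ln r| >= 2, the condition on \<open>r\<close> in the theorem
  up to equality.\<close>

locale dyadic =
  fixes J :: nat and lam :: real
  assumes lev_J: "lam - real J * ln 2 \<ge> 2"
begin

definition lev :: "nat \<Rightarrow> real" where "lev d = lam - real d * ln 2"

lemma lev_Suc: "lev (Suc d) = lev d - ln 2"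
  by (simp add: lev_def algebra_simps)

lemma lev_mono: "d \<le> e \<Longrightarrow> lev e \<le> lev d"
  by (simp add: lev_def)

lemma lev_ge: "d \<le> J \<Longrightarrow> lev d \<ge> 2 + real (J - d) * ln 2"
  using lev_J by (simp add: lev_def of_nat_diff algebra_simps)

lemma lev_ge2: "d \<le> J \<Longrightarrow> lev d \<ge> 2"
  using lev_ge[of d] by (smt (verit) ln_ge_zero mult_nonneg_nonneg of_nat_0_le_iff)

text \<open>The weights are of order \<open>1 / (lev d)\<^sup>2\<close>; in this form they telescope to \<open>1 / lev d\<close> along a branch.\<close>

fun en :: "(nat \<Rightarrow> real) \<Rightarrow> nat \<Rightarrow> nat \<Rightarrow> real" where
  "en a 0 m = (a m)\<^sup>2 / lev 0"
| "en a (Suc d) m = (1 / lev (Suc d) - 1 / lev d) * (blk a (Suc d) m)\<^sup>2 + en a d (2*m) + en a d (2*m+1)"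

lemma wt_pos: assumes "Suc d \<le> J" shows "1 / lev (Suc d) - 1 / lev d \<ge> 0"
proof -
  have "0 < lev (Suc d)" "lev (Suc d) \<le> lev d" using lev_ge2[of "Suc d"] lev_mono[of d "Suc d"] assms by auto
  then show ?thesis by (simp add: frac_le)
qed

text \<open>On a single branch the weights telescope to 1 / \<open>lev d\<close>. Splitting the mass
  between two children only helps, because squares of nonnegative numbers are superadditive.\<close>

lemma en_le_square:
  assumes "d \<le> J"
  shows "en a d m \<le> (blk (\<lambda>i. \<bar>a i\<bar>) d m)\<^sup>2 / lev d"
  using assms
proof (induction d arbitrary: m)
  case 0 then show ?case by simp
next
  case (Suc d)
  let ?D = "blk (\<lambda>i. \<bar>a i\<bar>)"
  have L: "lev d > 0" using lev_ge2[of d] Suc by auto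
  have pos: "?D d k \<ge> 0" for k by (simp add: blk_nonneg)
  have DD: "(?D d (2*m))\<^sup>2 + (?D d (2*m+1))\<^sup>2 \<le> (?D (Suc d) m)\<^sup>2"
    unfolding blk_Suc using pos[of "2*m"] pos[of "2*m+1"] by (simp add: power2_sum)
  have "(blk a (Suc d) m)\<^sup>2 \<le> (?D (Suc d) m)\<^sup>2"
    using abs_blk_le[of a "Suc d" m] by (metis abs_ge_zero power2_abs power_mono)
  then have "en a (Suc d) m \<le> (1 / lev (Suc d) - 1 / lev d) * (?D (Suc d) m)\<^sup>2 + (?D d (2*m))\<^sup>2 / lev d + (?D d (2*m+1))\<^sup>2 / lev d"
    using Suc.IH[of "2*m"] Suc.IH[of "2*m+1"] Suc.prems wt_pos[OF Suc.prems]
    by (simp add: add_mono mult_left_mono)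
  also have "\<dots> \<le> (1 / lev (Suc d) - 1 / lev d) * (?D (Suc d) m)\<^sup>2 + (?D (Suc d) m)\<^sup>2 / lev d"
    using DD L by (simp add: add_divide_distrib[symmetric] divide_right_mono)
  also have "\<dots> = (?D (Suc d) m)\<^sup>2 / lev (Suc d)" by (simp add: algebra_simps)
  finally show ?case .
qed

text \<open>Call a node heavy if its mass of |a| exceeds \<open>lev\<close>; the subtracted
  \<open>lev d\<close> is a reserve of heavy nodes. The term of a heavy parent costs at most ln 2.
  With one heavy child this is exactly the amount by which the child's reserve exceeds the parent's;
  with two heavy children there is even more. With none, the mass D exceeds \<open>lev\<close> >= 2,
  and 2 D - \<open>lev\<close> > 2 > ln 2 covers the cost.\<close>

lemma en_bound_aux:
  assumes "\<And>d m. d \<le> J \<Longrightarrow> m < 2^(J-d) \<Longrightarrow> \<bar>blk a d m\<bar> \<le> lev d" and "d \<le> J" "m < 2^(J-d)"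
  shows "en a d m \<le> (if blk (\<lambda>i. \<bar>a i\<bar>) d m \<le> lev d then blk (\<lambda>i. \<bar>a i\<bar>) d m
            else 3 * blk (\<lambda>i. \<bar>a i\<bar>) d m - lev d)"
  using assms(2,3)
proof (induction d arbitrary: m)
  case 0
  have l2: "lev 0 \<ge> 2" using lev_ge2[of 0] by simp
  have a: "\<bar>a m\<bar> \<le> lev 0" using assms(1)[of 0 m] 0 by simp
  then have "\<bar>a m\<bar> * \<bar>a m\<bar> \<le> \<bar>a m\<bar> * lev 0" by (intro mult_left_mono) auto
  then have "(a m)\<^sup>2 \<le> \<bar>a m\<bar> * lev 0" by (simp add: power2_eq_square)
  then show ?case using a l2 by (simp add: divide_simps)
next
  case (Suc d)
  let ?D = "blk (\<lambda>i. \<bar>a i\<bar>)"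
  have D: "?D (Suc d) m = ?D d (2*m) + ?D d (2*m+1)" by (rule blk_Suc)
  have pos: "?D d k \<ge> 0" for k by (simp add: blk_nonneg)
  have l2: "lev (Suc d) \<ge> 2" using lev_ge2[of "Suc d"] Suc by simp
  have ls: "lev d = lev (Suc d) + ln 2" using lev_Suc by simp
  have ln2: "0 < ln (2::real)" "ln (2::real) < 1" using ln_2_less_1 by auto
  show ?case
  proof (cases "?D (Suc d) m \<le> lev (Suc d)")
    case True
    have "en a (Suc d) m \<le> (?D (Suc d) m)\<^sup>2 / lev (Suc d)" using en_le_square[OF Suc.prems(1)] .
    also have "\<dots> \<le> ?D (Suc d) m"
    proof -
      have "(?D (Suc d) m)\<^sup>2 \<le> ?D (Suc d) m * lev (Suc d)"
        unfolding power2_eq_square using True blk_nonneg[of "\<lambda>i. \<bar>a i\<bar>" "Suc d" m] by (intro mult_left_mono) auto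
      then show ?thesis using l2 by (simp add: divide_simps)
    qed
    finally show ?thesis using True by simp
  next
    case False
    have le: "2 ^ (J - d) = 2 * (2::nat) ^ (J - Suc d)" using Suc.prems
      by (metis Suc_diff_le diff_Suc_Suc power_Suc)
    have IH1: "en a d (2*m) \<le> (if ?D d (2*m) \<le> lev d then ?D d (2*m) else 3 * ?D d (2*m) - lev d)"
      using Suc.prems le by (intro Suc.IH) auto
    have IH2: "en a d (2*m+1) \<le> (if ?D d (2*m+1) \<le> lev d then ?D d (2*m+1) else 3 * ?D d (2*m+1) - lev d)"
      using Suc.prems le by (intro Suc.IH) auto
    have "(blk a (Suc d) m)\<^sup>2 \<le> (lev (Suc d))\<^sup>2"
      using assms(1)[of "Suc d" m] Suc.prems by (metis abs_ge_zero power2_abs power_mono)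
    then have "(1 / lev (Suc d) - 1 / lev d) * (blk a (Suc d) m)\<^sup>2 \<le> (1 / lev (Suc d) - 1 / lev d) * (lev (Suc d))\<^sup>2"
      using wt_pos[OF Suc.prems(1)] by (rule mult_left_mono)
    also have "\<dots> = ln 2 * (lev (Suc d) / lev d)"
    proof -
      have "lev (Suc d) + ln 2 \<noteq> 0" "lev (Suc d) \<noteq> 0" using l2 ln2 by linarith+
      then show ?thesis unfolding ls by (simp add: divide_simps power2_eq_square)
    qed
    also have "\<dots> \<le> ln 2"
    proof -
      have "lev (Suc d) / lev d \<le> 1" using l2 ln2(1) lev_mono[of d "Suc d"] by (intro divide_le_eq_1_pos[THEN iffD2]) (linarith, simp)
      then show ?thesis using mult_left_le[of "lev (Suc d) / lev d" "ln 2"] ln2 by linarith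
    qed
    finally have "en a (Suc d) m \<le> ln 2 + en a d (2*m) + en a d (2*m+1)" by simp
    then show ?thesis using False IH1 IH2 D ls ln2 l2 pos[of "2*m"] pos[of "2*m+1"]
      by (smt (verit, ccfv_threshold))
  qed
qed

text \<open>The nodes where the mass of \<open>\<bar>a\<bar>\<close> exceeds \<open>lev\<close> form a subtree whose size is
  controlled by the total mass; below it the crude bound \<open>en_le_square\<close> suffices.\<close>

lemma en_bound:
  assumes "\<And>d m. d \<le> J \<Longrightarrow> m < 2^(J-d) \<Longrightarrow> \<bar>blk a d m\<bar> \<le> lev d"
  shows "en a J 0 \<le> 3 * (\<Sum>i<2^J. \<bar>a i\<bar>)"
proof -
  have eq: "blk (\<lambda>i. \<bar>a i\<bar>) J 0 = (\<Sum>i<2^J. \<bar>a i\<bar>)"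
    by (simp add: blk_def lessThan_atLeast0)
  have "0 \<le> (\<Sum>i<2^J. \<bar>a i\<bar>)" by (simp add: sum_nonneg)
  moreover have "en a J 0 \<le> (if (\<Sum>i<2^J. \<bar>a i\<bar>) \<le> lev J then (\<Sum>i<2^J. \<bar>a i\<bar>) else 3 * (\<Sum>i<2^J. \<bar>a i\<bar>) - lev J)"
    using en_bound_aux[OF assms, of J 0] unfolding eq by simp
  ultimately show ?thesis using lev_ge2[OF order_refl] by (smt (verit))
qed

definition wt :: "nat \<Rightarrow> real" where
  "wt d = (if d = 0 then 1 / lev 0 else 1 / lev d - 1 / lev (d-1))"

lemma en_eq_sum:
  "en a d m = (\<Sum>e\<le>d. wt e * (\<Sum>k\<in>{m * 2^(d-e)..<(m+1) * 2^(d-e)}. (blk a e k)\<^sup>2))"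
proof (induction d arbitrary: m)
  case 0 then show ?case by (simp add: wt_def)
next
  case (Suc d)
  have split: "(\<Sum>k\<in>{m * 2^(Suc d-e)..<(m+1) * 2^(Suc d-e)}. f k)
     = (\<Sum>k\<in>{2*m * 2^(d-e)..<(2*m+1) * 2^(d-e)}. f k) + (\<Sum>k\<in>{(2*m+1) * 2^(d-e)..<(2*m+1+1) * 2^(d-e)}. f k)"
    if "e \<le> d" for e and f :: "nat \<Rightarrow> real"
    using blk_Suc[of f "d-e" m] that by (simp add: blk_def Suc_diff_le)
  have "(\<Sum>e\<le>Suc d. wt e * (\<Sum>k\<in>{m * 2^(Suc d-e)..<(m+1) * 2^(Suc d-e)}. (blk a e k)\<^sup>2))
     = wt (Suc d) * (blk a (Suc d) m)\<^sup>2 + (\<Sum>e\<le>d. wt e * (\<Sum>k\<in>{m * 2^(Suc d-e)..<(m+1) * 2^(Suc d-e)}. (blk a e k)\<^sup>2))"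
    by simp
  also have "(\<Sum>e\<le>d. wt e * (\<Sum>k\<in>{m * 2^(Suc d-e)..<(m+1) * 2^(Suc d-e)}. (blk a e k)\<^sup>2)) = en a d (2*m) + en a d (2*m+1)"
    unfolding Suc.IH sum.distrib[symmetric] by (intro sum.cong refl) (simp only: split atMost_iff distrib_left)
  finally show ?case by (simp add: wt_def)
qed

text \<open>The correlation function produces weights 1 / \<open>lev\<close>^2, the energy uses
  telescoping ones; \<open>lev\<close> >= 2 and ln 2 >= 2/3 keep the exchange within a factor
  2.\<close>

lemma inverse_lev_square_le:
  assumes "d \<le> J" shows "1 / (lev d)\<^sup>2 \<le> 2 * wt d"
proof (cases d)
  case 0
  have "lev 0 \<ge> 2" using lev_ge2[of 0] by simp
  then show ?thesis using 0 by (simp add: wt_def divide_simps power2_eq_square)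
next
  case (Suc e)
  have l: "lev d \<ge> 2" using lev_ge2 assms by simp
  have ls: "lev e = lev d + ln 2" using lev_Suc Suc by simp
  have ln2: "2/3 \<le> ln (2::real)" "ln (2::real) < 1" using ln_2_less_1 ln2_ge_two_thirds by auto
  have "lev d + ln 2 \<le> 2 * ln 2 * lev d" 
  proof -
    have "4/3 * lev d \<le> 2 * ln 2 * lev d" using l ln2 by (intro mult_right_mono) auto
    moreover have "2 * ln 2 * lev d - lev d - ln 2 = (2 * ln 2 - 1) * (lev d - 2) + 3 * ln 2 - 2" by (simp add: algebra_simps)
    moreover have "(2 * ln 2 - 1) * (lev d - 2) \<ge> 0" using l ln2 by auto
    ultimately show ?thesis using ln2 by linarith
  qed
  moreover have "wt d = ln 2 / (lev d * (lev d + ln 2))"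
    using l ln2 Suc ls by (simp add: wt_def field_simps)
  moreover have "1 / (lev d)\<^sup>2 \<le> 2 * (ln 2 / (lev d * (lev d + ln 2)))"
    using l ln2 calculation(1) by (simp add: power2_eq_square divide_simps mult.commute)
  ultimately show ?thesis by simp
qed

end

section \<open>Convex quadratic forms\<close>

text \<open>A convolution of \<open>a\<close> with the indicator of a block of length
  \<open>l\<close>, whose autocorrelation is a triangle function (see
  \<open>triangle_quadratic\<close>). Truncated subtraction cuts the window at 0.\<close>

definition win :: "nat \<Rightarrow> (nat \<Rightarrow> real) \<Rightarrow> nat \<Rightarrow> real" where
  "win l a x = sum a {x - l..<x}"

definition pair :: "(nat \<Rightarrow> real) \<Rightarrow> nat \<Rightarrow> real" where
  "pair a m = a (2*m) + a (2*m+1)"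

lemma pair_blk: "pair (blk a d) = blk a (Suc d)"
  by (rule ext) (simp add: pair_def blk_Suc)

lemma sum_pair: "u \<le> v \<Longrightarrow> sum a {2*u..<2 * v} = sum (pair a) {u..<v}"
proof (induction v rule: dec_induct)
  case (step n)
  have "sum a {2*u..<2*Suc n} = sum a {2*u..<2*n} + a (2*n) + a (2*n+1)"
    using step by simp
  then show ?case using step by (simp add: pair_def)
qed simp

lemma win_even: "win (2*l) a (2*y) = win l (pair a) y"
  unfolding win_def using sum_pair[of "y - l" y a] by (simp add: right_diff_distrib')

lemma win_odd: "win (2*l) a (2*y+1) = win l (pair a) y + a (2*y) - (if l \<le> y then a (2*y-2*l) else 0)"
proof (cases "l \<le> y")
  case True
  then have "{2*y-2*l..<2*y+1} = insert (2*y-2*l) {2*y+1-2*l..<2*y+1}" by auto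
  then have "sum a {2*y-2*l..<2*y+1} = a (2*y-2*l) + sum a {2*y+1-2*l..<2*y+1}"
    using True by (simp add: sum.insert_if)
  moreover have "sum a {2*y-2*l..<2*y+1} = win (2*l) a (2*y) + a (2*y)"
    by (simp add: win_def)
  moreover have "win (2*l) a (2*y+1) = sum a {2*y+1-2*l..<2*y+1}" by (simp only: win_def)
  ultimately show ?thesis using True unfolding win_even[symmetric] by (simp only: if_True)
next
  case False
  then show ?thesis unfolding win_even[symmetric] by (simp add: win_def)
qed

lemma win_Suc: "win (Suc l) a x = win l a x + (if Suc l \<le> x then a (x - Suc l) else 0)"
proof (cases "Suc l \<le> x")
  case True
  then have "{x - Suc l..<x} = insert (x - Suc l) {x - l..<x}" by auto
  then show ?thesis using True by (simp add: win_def sum.insert_if)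
qed (simp add: win_def)

lemma L2_shift:
  assumes "\<And>x. P x \<Longrightarrow> c \<le> x"
  shows "L2_set (\<lambda>x. if P x then a (x - c) else 0) {..<X} \<le> L2_set a {..<X::nat}"
proof -
  have "(\<Sum>x<X. (if P x then a (x - c) else 0)\<^sup>2) = (\<Sum>x\<in>{x. x < X \<and> P x}. (a (x - c))\<^sup>2)"
    by (rule sum.mono_neutral_cong_right) auto
  also have "\<dots> = (\<Sum>i\<in>(\<lambda>x. x - c) ` {x. x < X \<and> P x}. (a i)\<^sup>2)"
    by (rule sum.reindex_cong[symmetric, where l = "\<lambda>x. x - c"]) (auto intro!: inj_onI dest!: assms)
  also have "\<dots> \<le> (\<Sum>i<X. (a i)\<^sup>2)"
    by (intro sum_mono2) auto
  finally show ?thesis by (simp add: L2_set_def)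
qed

text \<open>A window of length \<open>l\<close> at \<open>x\<close> is a window of
  \<open>l div 2\<close> pairs at \<open>x div 2\<close>, up to three boundary entries. Each window
  of pairs is met for two values of \<open>x\<close>, whence sqrt 2; each boundary correction is a
  shift of part of \<open>a\<close>, whence 3.\<close>

lemma L2_win_halve:
  "L2_set (win l a) {..<2*X} \<le> sqrt 2 * L2_set (win (l div 2) (pair a)) {..<X} + 3 * L2_set a {..<2*X}"
proof -
  define h where "h = l div 2"
  define g0 where "g0 x = win h (pair a) (x div 2)" for x
  define g1 where "g1 x = (if odd x then a (x - 1) else 0)" for x
  define g2 where "g2 x = (if odd x \<and> h \<le> x div 2 then a (x - (2*h+1)) else 0)" for x
  define g3 where "g3 x = (if odd l \<and> l \<le> x then a (x - l) else 0)" for x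
  have A: "win (2*h) a x = g0 x + g1 x - g2 x" for x
  proof (cases "even x")
    case True
    then obtain y where "x = 2*y" by (elim evenE)
    then show ?thesis by (simp add: g0_def g1_def g2_def win_even)
  next
    case False
    then obtain y where "x = 2*y+1" by (elim oddE)
    then show ?thesis using win_odd[of h a y] by (auto simp add: g0_def g1_def g2_def)
  qed
  have B: "win l a x = win (2*h) a x + g3 x" for x
  proof (cases "even l")
    case False
    then have "l = Suc (2*h)" unfolding h_def by presburger
    then show ?thesis using win_Suc[of "2*h" a x] by (simp add: g3_def)
  qed (simp add: h_def g3_def)
  have "L2_set (win l a) {..<2*X} = L2_set (\<lambda>x. ((g0 x + g1 x) + (- g2 x)) + g3 x) {..<2*X}"
    by (rule L2_set_cong) (auto simp: A B)
  also have "\<dots> \<le> L2_set g0 {..<2*X} + L2_set g1 {..<2*X} + L2_set (\<lambda>x. - g2 x) {..<2*X} + L2_set g3 {..<2*X}"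
    using L2_set_triangle_ineq[of "\<lambda>x. (g0 x + g1 x) + (- g2 x)" g3 "{..<2*X}"]
      L2_set_triangle_ineq[of "\<lambda>x. g0 x + g1 x" "\<lambda>x. - g2 x" "{..<2*X}"]
      L2_set_triangle_ineq[of g0 g1 "{..<2*X}"] by simp
  also have "L2_set g0 {..<2*X} = sqrt 2 * L2_set (win h (pair a)) {..<X}"
    unfolding L2_set_def real_sqrt_mult[symmetric] sum_even_odd by (simp add: g0_def sum_distrib_left)
  also have "L2_set g1 {..<2*X} \<le> L2_set a {..<2*X}"
    unfolding g1_def by (rule L2_shift) (auto elim: oddE)
  also have "L2_set (\<lambda>x. - g2 x) {..<2*X} \<le> L2_set a {..<2*X}"
  proof -
    have "L2_set g2 {..<2*X} \<le> L2_set a {..<2*X}"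
      unfolding g2_def by (rule L2_shift) (auto elim!: oddE)
    then show ?thesis by (simp add: L2_set_def)
  qed
  also have "L2_set g3 {..<2*X} \<le> L2_set a {..<2*X}"
    unfolding g3_def by (rule L2_shift) auto
  finally show ?thesis by (simp add: h_def)
qed

text \<open>Repeated halving moves the window up the tree until its length is at most 1. Each
  coarser level costs another factor sqrt 2 and leaves behind the norm of the block sums of that
  level.\<close>

lemma L2_win_bound:
  assumes "p \<le> K - e" "l < 2^Suc p"
  shows "L2_set (win l (blk a e)) {..<2^(K-e)}
     \<le> 3 * (\<Sum>q\<le>p. sqrt 2 ^ q * L2_set (blk a (e+q)) {..<2^(K-(e+q))})"
  using assms
proof (induction p arbitrary: e l)
  case 0
  then have "l = 0 \<or> l = 1" by auto
  then have "L2_set (win l (blk a e)) {..<2^(K-e)} \<le> L2_set (blk a e) {..<2^(K-e)}"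
  proof
    assume "l = 0"
    then show ?thesis by (simp add: win_def L2_set_def sum_nonneg)
  next
    assume "l = 1"
    then have "win l (blk a e) = (\<lambda>x. if 1 \<le> x then blk a e (x - 1) else 0)"
      using win_Suc[of 0 "blk a e"] by (auto simp: win_def)
    then show ?thesis using L2_shift[of "\<lambda>x. 1 \<le> x" 1 "blk a e" "2^(K-e)"] by simp
  qed
  moreover have "0 \<le> L2_set (blk a e) {..<2^(K-e)}" by simp
  ultimately show ?case unfolding atMost_0 by (simp del: L2_set_nonneg)
next
  case (Suc p)
  let ?\<phi> = "\<lambda>q. L2_set (blk a q) {..<2^(K-q)}"
  have K: "2^(K-e) = 2 * (2::nat)^(K - Suc e)"
    using Suc.prems(1) by (metis Suc_diff_Suc Suc_le_lessD less_le_trans power_Suc zero_less_Suc zero_less_diff)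
  have "L2_set (win l (blk a e)) {..<2^(K-e)}
     \<le> sqrt 2 * L2_set (win (l div 2) (blk a (Suc e))) {..<2^(K-Suc e)} + 3 * ?\<phi> e"
    using L2_win_halve[of l "blk a e" "2^(K-Suc e)"] by (simp add: pair_blk K)
  also have "\<dots> \<le> sqrt 2 * (3 * (\<Sum>q\<le>p. sqrt 2 ^ q * ?\<phi> (Suc e + q))) + 3 * ?\<phi> e"
    using Suc.prems by (intro add_right_mono mult_left_mono Suc.IH) auto
  also have "\<dots> = 3 * (\<Sum>q\<le>Suc p. sqrt 2 ^ q * ?\<phi> (e+q))"
    unfolding sum.atMost_Suc_shift by (simp add: sum_distrib_left algebra_simps)
  finally show ?case .
qed

section \<open>Triangle kernels and convex functions\<close>

definition absdiff :: "nat \<Rightarrow> nat \<Rightarrow> nat" where "absdiff i j = max i j - min i j"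

text \<open>After expanding the squares, the coefficient of \<open>a i * a j\<close> counts the
  windows that contain both \<open>i\<close> and \<open>j\<close>. As \<open>l \<le> N\<close>, all
  of these windows have an end point below \<open>2*N\<close>.\<close>

lemma triangle_quadratic:
  assumes "\<And>i. N \<le> i \<Longrightarrow> a i = 0" "l \<le> N"
  shows "(\<Sum>i<N. \<Sum>j<N. a i * a j * real (l - absdiff i j)) = (\<Sum>x<2*N. (win l a x)\<^sup>2)"
proof -
  define I where "I x i = (if i < x \<and> x \<le> i + l then 1 else 0::real)" for x i :: nat
  have W: "win l a x = (\<Sum>i<N. a i * I x i)" for x
  proof -
    have nz: "i < N" if "a i \<noteq> 0" for i using assms(1)[of i] that by fastforce
    have "win l a x = (\<Sum>i\<in>{x - l..<x} \<inter> {..<N}. a i)"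
      unfolding win_def by (rule sum.mono_neutral_right) (use nz in auto)
    also have "\<dots> = (\<Sum>i<N. a i * I x i)"
      by (rule sum.mono_neutral_cong_left) (auto simp: I_def)
    finally show ?thesis .
  qed
  have C: "(\<Sum>x<2*N. I x i * I x j) = real (l - absdiff i j)" if "i < N" "j < N" for i j
  proof -
    have "(\<Sum>x<2*N. I x i * I x j) = (\<Sum>x\<in>{max i j<..min i j + l}. 1)"
      by (rule sum.mono_neutral_cong_right) (use that assms in \<open>auto simp: I_def\<close>)
    then show ?thesis by (simp add: absdiff_def)
  qed
  have "(\<Sum>x<2*N. (win l a x)\<^sup>2) = (\<Sum>x<2*N. \<Sum>i<N. \<Sum>j<N. a i * a j * (I x i * I x j))"
    unfolding W power2_eq_square sum_product by (simp add: algebra_simps)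
  also have "\<dots> = (\<Sum>i<N. \<Sum>j<N. \<Sum>x<2*N. a i * a j * (I x i * I x j))"
    by (subst sum.swap, rule sum.cong[OF refl], subst sum.swap) simp
  also have "\<dots> = (\<Sum>i<N. \<Sum>j<N. a i * a j * real (l - absdiff i j))"
    by (simp add: sum_distrib_left[symmetric] C)
  finally show ?thesis by simp
qed

text \<open>A discrete form of Polya's representation of convex functions as mixtures of triangles.\<close>

lemma convex_as_triangles:
  fixes g :: "nat \<Rightarrow> real"
  assumes const: "\<And>d. N \<le> d \<Longrightarrow> g d = g N" and "N < M" "d \<le> M"
  shows "g d = g N + (\<Sum>l\<in>{1..<M}. (g (l+1) - 2 * g l + g (l-1)) * real (l - d))"
  using assms(3)
proof (induction d rule: inc_induct)
  case base
  show ?case using const[of M] assms(2) by (simp add: sum.neutral)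
next
  case (step d)
  let ?b = "\<lambda>l. g (l+1) - 2 * g l + g (l-1)"
  \<comment> \<open>Raising \<open>d\<close> by one shortens exactly the triangles with
    \<open>l > d\<close>. The remaining sum of second differences telescopes to the slope at
    \<open>d\<close>, because the slope at \<open>M - 1\<close> vanishes.\<close>
  have "(\<Sum>l\<in>{1..<M}. ?b l * real (l - d)) - (\<Sum>l\<in>{1..<M}. ?b l * real (l - Suc d))
      = (\<Sum>l\<in>{1..<M}. ?b l * (if d < l then 1 else 0))"
    unfolding sum_subtractf[symmetric] by (intro sum.cong refl) (auto simp: algebra_simps of_nat_diff)
  also have "\<dots> = (\<Sum>l\<in>{Suc d..<M}. ?b l)"
    by (rule sum.mono_neutral_cong_right) auto
  also have "\<dots> = (\<Sum>l\<in>{Suc d..<M}. (g (Suc l) - g l) - (g l - g (l-1)))"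
    by (intro sum.cong refl) auto
  also have "\<dots> = (\<Sum>l\<in>{d..<M-1}. (g (Suc (Suc l)) - g (Suc l)) - (g (Suc l) - g l))"
    using sum.shift_bounds_Suc_ivl[of "\<lambda>l. (g (Suc l) - g l) - (g l - g (l-1))" d "M-1"] step(2) by simp
  also have "\<dots> = (g (Suc (M-1)) - g (M-1)) - (g (Suc d) - g d)"
    by (rule sum_Suc_diff') (use step in auto)
  also have "\<dots> = g d - g (Suc d)" using const[of M] const[of "M-1"] assms(2) by simp
  finally show ?case using step.IH by linarith
qed


section \<open>Geometric sums and absolute constants\<close>

lemma sum_sqrt2_le: "(\<Sum>q\<le>p. sqrt 2 ^ q) \<le> 4 * sqrt 2 ^ p"
proof (induction p)
  case (Suc p)
  have "4 * sqrt 2 ^ p \<le> 3 * sqrt 2 * sqrt 2 ^ p"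
  proof (rule mult_right_mono)
    show "4 \<le> 3 * sqrt (2::real)" by (rule power2_le_imp_le) (simp_all add: power_mult_distrib)
  qed simp
  then show ?case using Suc by (simp only: sum.atMost_Suc power_Suc)
qed simp

text \<open>Cauchy-Schwarz with each weight split evenly between the two factors. Since the weights
  grow geometrically, their sum costs a multiple of the last one rather than a factor
  \<open>p\<close>.\<close>

lemma weighted_square_sum_le:
  assumes "\<And>q. x q \<ge> 0"
  shows "(\<Sum>q\<le>p. sqrt 2 ^ q * x q)\<^sup>2 \<le> 4 * sqrt 2 ^ p * (\<Sum>q\<le>p. sqrt 2 ^ q * (x q)\<^sup>2)"
proof -
  let ?s = "\<lambda>q. sqrt (sqrt 2 ^ q)"
  have "(\<Sum>q\<le>p. sqrt 2 ^ q * x q) = (\<Sum>q\<le>p. \<bar>?s q\<bar> * \<bar>?s q * x q\<bar>)"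
    using assms by (intro sum.cong refl) (simp add: abs_mult)
  also have "\<dots> \<le> L2_set ?s {..p} * L2_set (\<lambda>q. ?s q * x q) {..p}"
    by (rule L2_set_mult_ineq)
  finally have "(\<Sum>q\<le>p. sqrt 2 ^ q * x q)\<^sup>2 \<le> (L2_set ?s {..p} * L2_set (\<lambda>q. ?s q * x q) {..p})\<^sup>2"
    using assms by (intro power_mono) (auto intro!: sum_nonneg)
  also have "\<dots> = (\<Sum>q\<le>p. sqrt 2 ^ q) * (\<Sum>q\<le>p. sqrt 2 ^ q * (x q)\<^sup>2)"
    by (simp add: L2_set_def power_mult_distrib sum_nonneg)
  also have "\<dots> \<le> 4 * sqrt 2 ^ p * (\<Sum>q\<le>p. sqrt 2 ^ q * (x q)\<^sup>2)"
    by (intro mult_right_mono sum_sqrt2_le sum_nonneg) auto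
  finally show ?thesis .
qed

lemma summable_geom_square: "summable (\<lambda>i. (1 + real i)\<^sup>2 * (1 / sqrt 2) ^ i)"
proof (rule summable_ratio_test)
  show "(9/10::real) < 1" by simp
  \<comment> \<open>From 20 on, 3/4 (2 + i)^2 <= 9/10 (1 + i)^2, and 3/4 exceeds 1 / sqrt 2.\<close>
  fix i :: nat assume i: "20 \<le> i"
  have r: "1 / sqrt 2 \<le> (3/4::real)"
  proof -
    have "4/3 \<le> sqrt (2::real)" by (rule real_le_rsqrt) (simp add: power2_eq_square)
    then show ?thesis by (simp add: divide_simps)
  qed
  have "(2 + real i)\<^sup>2 * (1 / sqrt 2) \<le> (2 + real i)\<^sup>2 * (3/4)"
    by (rule mult_left_mono[OF r]) simp
  also have "\<dots> \<le> 9/10 * (1 + real i)\<^sup>2"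
  proof -
    have "20 * real i \<le> real i * real i" using i by (intro mult_right_mono) auto
    moreover have "(2 + real i)\<^sup>2 = 4 + 4 * real i + real i * real i" "(1 + real i)\<^sup>2 = 1 + 2 * real i + real i * real i"
      by (simp_all add: power2_eq_square algebra_simps)
    moreover have "20 \<le> real i" using i by simp
    ultimately show ?thesis by linarith
  qed
  finally have "(2 + real i)\<^sup>2 * (1 / sqrt 2) * (1 / sqrt 2)^i \<le> 9/10 * (1 + real i)\<^sup>2 * (1 / sqrt 2)^i"
    by (rule mult_right_mono) simp
  then show "norm ((1 + real (Suc i))\<^sup>2 * (1 / sqrt 2) ^ Suc i) \<le> 9/10 * norm ((1 + real i)\<^sup>2 * (1 / sqrt 2) ^ i)"
    by (simp add: norm_mult algebra_simps)
qed

definition geom_const :: real where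
  "geom_const = (\<Sum>i. (1 + real i)\<^sup>2 * (1 / sqrt 2) ^ i)"

lemma geom_const_ge: "(\<Sum>i<n. (1 + real i)\<^sup>2 * (1 / sqrt 2) ^ i) \<le> geom_const"
  unfolding geom_const_def by (rule sum_le_suminf[OF summable_geom_square]) auto

lemma geom_const_nonneg: "0 \<le> geom_const"
  using geom_const_ge[of 0] by simp

text \<open>In \<open>quadratic_form_le_en\<close>, 36 comes from the windows of length 1, 4 from
  the constant term \<open>g N\<close>, and 288 = 2 * 144 from all longer windows.\<close>

definition energy_const :: real where "energy_const = 40 + 288 * geom_const"

lemma energy_const_pos: "0 < energy_const"
  using geom_const_nonneg by (simp add: energy_const_def)

text \<open>Bits per unit of \<open>k\<close> in the code for \<open>V_op\<close>: 19 + 48 *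
  \<open>energy_const\<close> bounds the code length, and the extra 1 pays for counting all words up
  to that length instead of words of one length.\<close>

definition code_rate :: nat where "code_rate = nat \<lceil>19 + 48 * energy_const\<rceil> + 1"

context dyadic
begin

text \<open>Climbing from \<open>q\<close> to \<open>p\<close> lowers \<open>lev\<close> by (p - q)
  ln 2 <= (p - q) \<open>lev p\<close>, so 1 / \<open>lev\<close>^2 grows at most quadratically in p
  - q and the geometric factor wins.\<close>

lemma sum_inverse_lev_le:
  assumes "q \<le> J"
  shows "(\<Sum>p\<in>{q..J}. (1 / sqrt 2)^(p-q) / (lev p)\<^sup>2) \<le> geom_const / (lev q)\<^sup>2"
proof -
  have "(1 / sqrt 2)^(p-q) / (lev p)\<^sup>2 \<le> (1 + real (p-q))\<^sup>2 * (1 / sqrt 2)^(p-q) / (lev q)\<^sup>2" if "p \<in> {q..J}" for p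
  proof -
    have l: "lev p \<ge> 2" "lev q \<ge> 2" using lev_ge2 that by auto
    have "lev q = lev p + real (p-q) * ln 2" using that by (simp add: lev_def of_nat_diff algebra_simps)
    also have "\<dots> \<le> lev p + real (p-q) * lev p"
      using l ln_2_less_1 by (intro add_left_mono mult_left_mono) auto
    finally have "lev q \<le> (1 + real (p-q)) * lev p" by (simp add: algebra_simps)
    then have "(lev q)\<^sup>2 \<le> (1 + real (p-q))\<^sup>2 * (lev p)\<^sup>2"
      unfolding power_mult_distrib[symmetric] using l by (intro power_mono) auto
    then have "1 / (lev p)\<^sup>2 \<le> (1 + real (p-q))\<^sup>2 / (lev q)\<^sup>2"
      using l by (simp add: divide_simps mult.commute)
    then have "(1 / sqrt 2)^(p-q) * (1 / (lev p)\<^sup>2) \<le> (1 / sqrt 2)^(p-q) * ((1 + real (p-q))\<^sup>2 / (lev q)\<^sup>2)"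
      by (rule mult_left_mono) simp
    then show ?thesis by (simp add: mult.commute)
  qed
  then have "(\<Sum>p\<in>{q..J}. (1 / sqrt 2)^(p-q) / (lev p)\<^sup>2)
     \<le> (\<Sum>p\<in>{q..J}. (1 + real (p-q))\<^sup>2 * (1 / sqrt 2)^(p-q) / (lev q)\<^sup>2)"
    by (rule sum_mono)
  also have "\<dots> = (\<Sum>i<Suc J-q. (1 + real i)\<^sup>2 * (1 / sqrt 2)^i) / (lev q)\<^sup>2"
    unfolding sum_divide_distrib
    by (rule sum.reindex_bij_witness[of _ "\<lambda>i. i+q" "\<lambda>p. p-q"]) (use assms in auto)
  also have "\<dots> \<le> geom_const / (lev q)\<^sup>2"
    by (rule divide_right_mono[OF geom_const_ge]) simp
  finally show ?thesis .
qed

text \<open>By \<open>convex_as_triangles\<close> the form is a nonnegative combination of square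
  sums of windows, plus the constant part. Windows of length about 2^p have total weight about
  2^(-p) / \<open>lev p\<close>^2 by convexity, while their square sums grow only like sqrt 2 ^ p
  times a sum over the levels \<open>q \<le> p\<close>. Exchanging \<open>p\<close> and
  \<open>q\<close> leaves a series that converges geometrically in p - q.\<close>

theorem quadratic_form_le_en:
  fixes g :: "nat \<Rightarrow> real"
  assumes anti: "\<And>d. g (Suc d) \<le> g d"
    and const: "\<And>d. 2^J \<le> d \<Longrightarrow> g d = g (2^J)"
    and conv: "\<And>d. g (Suc (Suc d)) + g d \<ge> 2 * g (Suc d)"
    and g01: "g 0 - g 1 \<le> 1 / lev 0"
    and dyad: "\<And>p. p < J \<Longrightarrow> g (2^p) - g (2^Suc p) \<le> 2 / (lev p)\<^sup>2"
    and gN: "g (2^J) \<le> 2 / (lev J)\<^sup>2"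
    and supp: "\<And>i. 2^J \<le> i \<Longrightarrow> a i = 0"
  shows "(\<Sum>i<2^J. \<Sum>j<2^J. a i * a j * g (absdiff i j)) \<le> energy_const * en a J 0"
proof -
  define N where "N = (2::nat)^J"
  define b where "b l = g (l+1) - 2 * g l + g (l-1)" for l
  define S where "S l = (\<Sum>x<2*N. (win l a x)\<^sup>2)" for l
  \<comment> \<open>The range is twice the number of nodes at height \<open>q\<close>, since windows
    end as late as \<open>2*N\<close>; the additional blocks are zero.\<close>
  define F where "F q = L2_set (blk a q) {..<2^(Suc J-q)}" for q
  have N: "1 \<le> N" by (simp add: N_def)
  have F0: "F q \<ge> 0" for q by (simp add: F_def)
  let ?H = "\<lambda>p. \<Sum>q\<le>p. sqrt 2 ^ q * (F q)\<^sup>2"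
  have bpos: "b l \<ge> 0" if "1 \<le> l" for l using conv[of "l-1"] that by (simp add: b_def)
  have b0: "b l = 0" if "N < l" for l
    using const[of "l+1"] const[of l] const[of "l-1"] that by (simp add: b_def N_def)
  have Spos: "S l \<ge> 0" for l by (simp add: S_def sum_nonneg)
  have en_F: "en a J 0 = (\<Sum>q\<le>J. wt q * (F q)\<^sup>2)"
  proof -
    have "(\<Sum>k\<in>{0 * 2^(J-q)..<(0+1) * 2^(J-q)}. (blk a q k)\<^sup>2) = (F q)\<^sup>2" if "q \<le> J" for q
    proof -
      have z: "blk a q k = 0" if "2^(J-q) \<le> k" for k
      proof -
        have "2^J \<le> k * 2^q"
          using mult_right_mono[OF that, of "2^q"] \<open>q \<le> J\<close> by (simp add: power_add[symmetric])
        then show ?thesis unfolding blk_def by (intro sum.neutral ballI supp) auto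
      qed
      have "(F q)\<^sup>2 = (\<Sum>k<2^(Suc J-q). (blk a q k)\<^sup>2)" by (simp add: F_def L2_set_def sum_nonneg)
      also have "\<dots> = (\<Sum>k\<in>{0..<2^(J-q)}. (blk a q k)\<^sup>2)"
        by (rule sum.mono_neutral_right) (use that z in \<open>auto simp: Suc_diff_le\<close>)
      finally show ?thesis by simp
    qed
    then show ?thesis unfolding en_eq_sum by (intro sum.cong refl arg_cong2[where f = "(*)"]) simp_all
  qed
  have quad: "(\<Sum>i<N. \<Sum>j<N. a i * a j * g (absdiff i j)) = g N * (blk a J 0)\<^sup>2 + (\<Sum>l\<in>{1..<2*N}. b l * S l)"
  proof -
    have T: "S l = (\<Sum>i<N. \<Sum>j<N. a i * a j * real (l - absdiff i j))" if "l \<le> N" for l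
      unfolding S_def by (rule triangle_quadratic[symmetric]) (use supp that in \<open>auto simp: N_def\<close>)
    have "g (absdiff i j) = g N + (\<Sum>l\<in>{1..<2*N}. b l * real (l - absdiff i j))" if "i < N" "j < N" for i j
      unfolding b_def
    proof (rule convex_as_triangles)
      show "N \<le> d \<Longrightarrow> g d = g N" for d unfolding N_def by (rule const)
      show "N < 2 * N" "absdiff i j \<le> 2 * N" using N that by (auto simp: absdiff_def)
    qed
    then have "(\<Sum>i<N. \<Sum>j<N. a i * a j * g (absdiff i j))
       = (\<Sum>i<N. \<Sum>j<N. a i * a j * (g N + (\<Sum>l\<in>{1..<2*N}. b l * real (l - absdiff i j))))"
      by (intro sum.cong refl) auto
    also have "\<dots> = (\<Sum>i<N. \<Sum>j<N. g N * (a i * a j)) + (\<Sum>i<N. \<Sum>j<N. \<Sum>l\<in>{1..<2*N}. b l * (a i * a j * real (l - absdiff i j)))"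
      by (simp only: distrib_left sum.distrib sum_distrib_left) (simp only: mult_ac)
    also have "(\<Sum>i<N. \<Sum>j<N. g N * (a i * a j)) = g N * (blk a J 0)\<^sup>2"
    proof -
      have "(blk a J 0)\<^sup>2 = (\<Sum>i<N. \<Sum>j<N. a i * a j)"
        unfolding power2_eq_square sum_product[symmetric] by (simp add: blk_def N_def lessThan_atLeast0)
      then show ?thesis by (simp only: sum_distrib_left)
    qed
    also have "(\<Sum>i<N. \<Sum>j<N. \<Sum>l\<in>{1..<2*N}. b l * (a i * a j * real (l - absdiff i j)))
        = (\<Sum>i<N. \<Sum>l\<in>{1..<2*N}. \<Sum>j<N. b l * (a i * a j * real (l - absdiff i j)))"
      by (intro sum.cong refl sum.swap)
    also have "\<dots> = (\<Sum>l\<in>{1..<2*N}. \<Sum>i<N. \<Sum>j<N. b l * (a i * a j * real (l - absdiff i j)))"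
      by (rule sum.swap)
    also have "\<dots> = (\<Sum>l\<in>{1..<2*N}. b l * S l)"
    proof (intro sum.cong refl)
      fix l show "(\<Sum>i<N. \<Sum>j<N. b l * (a i * a j * real (l - absdiff i j))) = b l * S l"
        using T[of l] b0[of l] by (cases "l \<le> N") (auto simp: sum_distrib_left)
    qed
    finally show ?thesis .
  qed
  \<comment> \<open>Here 36 = 3^2 * 4, from \<open>L2_win_bound\<close> and
    \<open>weighted_square_sum_le\<close>.\<close>
  have SF: "S l \<le> 36 * sqrt 2 ^ p * ?H p" if "l < 2^Suc p" "p \<le> J" for l p
  proof -
    have "L2_set (win l (blk a 0)) {..<2^(Suc J-0)} \<le> 3 * (\<Sum>q\<le>p. sqrt 2 ^ q * F (0+q))"
      unfolding F_def by (rule L2_win_bound) (use that in auto)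
    moreover have "blk a 0 = a" by (rule ext) simp
    ultimately have "L2_set (win l a) {..<2*N} \<le> 3 * (\<Sum>q\<le>p. sqrt 2 ^ q * F q)" by (simp add: N_def)
    then have "(L2_set (win l a) {..<2*N})\<^sup>2 \<le> (3 * (\<Sum>q\<le>p. sqrt 2 ^ q * F q))\<^sup>2"
      by (rule power_mono) simp
    also have "\<dots> = 9 * (\<Sum>q\<le>p. sqrt 2 ^ q * F q)\<^sup>2" by (simp add: power_mult_distrib)
    also have "\<dots> \<le> 9 * (4 * sqrt 2 ^ p * ?H p)"
      by (intro mult_left_mono weighted_square_sum_le F0) simp
    finally show ?thesis by (simp add: S_def L2_set_def sum_nonneg)
  qed
  \<comment> \<open>Second differences telescope to the difference of two slopes; the one at the
    upper end is nonpositive and is dropped.\<close>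
  have bsum: "(\<Sum>l\<in>{2^p..<2^Suc p}. b l) \<le> g (2^p-1) - g (2^p)" for p
  proof -
    have "(\<Sum>l\<in>{2^p..<2^Suc p}. b l) = (\<Sum>l\<in>{2^p..<2^Suc p}. (g (Suc l) - g (Suc l-1)) - (g l - g (l-1)))"
      by (intro sum.cong refl) (auto simp: b_def)
    also have "\<dots> = (g (2^Suc p) - g (2^Suc p-1)) - (g (2^p) - g (2^p-1))"
      by (rule sum_Suc_diff'[of _ _ "\<lambda>l. g l - g (l-1)"]) simp
    also have "\<dots> \<le> g (2^p-1) - g (2^p)" using anti[of "2^Suc p-1"] by simp
    finally show ?thesis .
  qed
  have slope_mono: "g e - g (Suc e) \<le> g d - g (Suc d)" if "d \<le> e" for d e
    using that
  proof (induction e rule: dec_induct)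
    case (step n) then show ?case using conv[of n] by simp
  qed simp
  \<comment> \<open>Slopes decrease in size by convexity, so the last one in a dyadic block is at
    most the average, that is, the dyadic increment divided by 2^p.\<close>
  have slope: "g (2^Suc p-1) - g (2^Suc p) \<le> 2 / 2^p / (lev (Suc p))\<^sup>2" if "p < J" for p
  proof -
    have "2^p * (g (2^Suc p-1) - g (2^Suc p)) = (\<Sum>d\<in>{2^p..<(2::nat)^Suc p}. g (2^Suc p-1) - g (2^Suc p))" by simp
    also have "\<dots> \<le> (\<Sum>d\<in>{2^p..<2^Suc p}. g d - g (Suc d))"
      by (rule sum_mono) (use slope_mono[of _ "2^Suc p-1"] in auto)
    also have "\<dots> = - (\<Sum>d\<in>{2^p..<2^Suc p}. g (Suc d) - g d)" by (simp add: sum_negf[symmetric])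
    also have "\<dots> = g (2^p) - g (2^Suc p)" by (subst sum_Suc_diff') auto
    also have "\<dots> \<le> 2 / (lev p)\<^sup>2" by (rule dyad[OF that])
    also have "\<dots> \<le> 2 / (lev (Suc p))\<^sup>2"
      using lev_ge2[of "Suc p"] lev_mono[of p "Suc p"] that by (intro divide_left_mono power_mono mult_pos_pos zero_less_power) auto
    finally have "g (2^Suc p-1) - g (2^Suc p) \<le> 2 / (lev (Suc p))\<^sup>2 / 2^p"
      by (simp only: pos_le_divide_eq zero_less_power zero_less_numeral mult.commute)
    then show ?thesis by (simp only: divide_divide_eq_left mult.commute)
  qed
  have block: "(\<Sum>l\<in>{2^p..<2^Suc p}. b l * S l) \<le> (g (2^p-1) - g (2^p)) * (36 * sqrt 2 ^ p * ?H p)"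
    if "p \<le> J" for p
  proof -
    have "(\<Sum>l\<in>{2^p..<2^Suc p}. b l * S l) \<le> (\<Sum>l\<in>{2^p..<2^Suc p}. b l * (36 * sqrt 2 ^ p * ?H p))"
    proof (intro sum_mono mult_left_mono SF that bpos)
      fix l :: nat assume l: "l \<in> {2^p..<2^Suc p}"
      then show "l < 2^Suc p" by auto
      have "(1::nat) \<le> 2^p" by simp
      then show "1 \<le> l" using l by (meson atLeastLessThan_iff le_trans)
    qed
    also have "\<dots> \<le> (g (2^p-1) - g (2^p)) * (36 * sqrt 2 ^ p * ?H p)"
      unfolding sum_distrib_right[symmetric] by (intro mult_right_mono bsum mult_nonneg_nonneg sum_nonneg) auto
    finally show ?thesis .
  qed
  have split: "(\<Sum>l\<in>{1..<2^Suc n}. b l * S l) = (\<Sum>p\<le>n. \<Sum>l\<in>{2^p..<2^Suc p}. b l * S l)" for n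
  proof (induction n)
    case 0 then show ?case by (simp add: numeral_2_eq_2)
  next
    case (Suc n)
    have "(\<Sum>l\<in>{1..<2^Suc (Suc n)}. b l * S l) = (\<Sum>l\<in>{1..<2^Suc n}. b l * S l) + (\<Sum>l\<in>{2^Suc n..<2^Suc (Suc n)}. b l * S l)"
      by (rule sum.atLeastLessThan_concat[symmetric]) auto
    then show ?case using Suc by simp
  qed
  define P where "P p = (1 / sqrt 2)^p / (lev p)\<^sup>2" for p
  have term_le: "(\<Sum>l\<in>{2^p..<2^Suc p}. b l * S l) \<le> 144 * P p * ?H p" if "p \<in> {1..J}" for p
  proof -
    from that obtain r where r: "p = Suc r" by (cases p) auto
    have sq: "(2::real)^p = sqrt 2 ^ p * sqrt 2 ^ p" by (simp add: power_mult_distrib[symmetric])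
    have "g (2^p-1) - g (2^p) \<le> 4 / 2^p / (lev p)\<^sup>2" using slope[of r] that r by (simp add: field_simps)
    then have "(\<Sum>l\<in>{2^p..<2^Suc p}. b l * S l) \<le> (4 / 2^p / (lev p)\<^sup>2) * (36 * sqrt 2 ^ p * ?H p)"
      using that by (intro order_trans[OF block] mult_right_mono mult_nonneg_nonneg sum_nonneg) auto
    also have "\<dots> = 144 * P p * ?H p"
      by (simp add: P_def sq power_divide)
    finally show ?thesis .
  qed
  have wt0: "wt q \<ge> 0" if "q \<le> J" for q
    using order_trans[OF _ inverse_lev_square_le[OF that], of 0] by simp
  \<comment> \<open>For fixed \<open>q\<close> the factors (1 / sqrt 2)^p and sqrt 2 ^ q combine to
    (1 / sqrt 2)^(p-q), which is summed over \<open>p\<close> by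
    \<open>sum_inverse_lev_le\<close>.\<close>
  have swap: "(\<Sum>p\<in>{1..J}. P p * ?H p) \<le> 2 * geom_const * en a J 0"
  proof -
    have "(\<Sum>p\<in>{1..J}. P p * ?H p) \<le> (\<Sum>p\<le>J. P p * ?H p)"
    proof (rule sum_mono2)
      show "0 \<le> P p * ?H p" for p
        unfolding P_def by (intro mult_nonneg_nonneg divide_nonneg_nonneg sum_nonneg) auto
    qed auto
    also have "\<dots> = (\<Sum>p\<le>J. \<Sum>q\<in>{q. q \<le> J \<and> q \<le> p}. P p * (sqrt 2 ^ q * (F q)\<^sup>2))"
      unfolding sum_distrib_left by (intro sum.cong refl) auto
    also have "\<dots> = (\<Sum>q\<le>J. \<Sum>p\<in>{p. p \<le> J \<and> q \<le> p}. P p * (sqrt 2 ^ q * (F q)\<^sup>2))"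
      using sum.swap_restrict[of "{..J}" "{..J}" "\<lambda>p q. P p * (sqrt 2 ^ q * (F q)\<^sup>2)" "\<lambda>p q. q \<le> p"] by simp
    also have "\<dots> = (\<Sum>q\<le>J. (F q)\<^sup>2 * (\<Sum>p\<in>{q..J}. (1 / sqrt 2)^(p-q) / (lev p)\<^sup>2))"
      unfolding sum_distrib_left
      by (intro sum.cong refl) (auto simp: P_def power_diff power_divide divide_simps)
    also have "\<dots> \<le> (\<Sum>q\<le>J. (F q)\<^sup>2 * (geom_const * (2 * wt q)))"
    proof (intro sum_mono mult_left_mono)
      fix q assume q: "q \<in> {..J}"
      have "(\<Sum>p\<in>{q..J}. (1 / sqrt 2)^(p-q) / (lev p)\<^sup>2) \<le> geom_const * (1 / (lev q)\<^sup>2)"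
        using sum_inverse_lev_le[of q] q by simp
      also have "\<dots> \<le> geom_const * (2 * wt q)"
        using q by (intro mult_left_mono inverse_lev_square_le geom_const_nonneg) auto
      finally show "(\<Sum>p\<in>{q..J}. (1 / sqrt 2)^(p-q) / (lev p)\<^sup>2) \<le> geom_const * (2 * wt q)" .
    qed simp
    also have "\<dots> = 2 * geom_const * en a J 0" unfolding en_F sum_distrib_left by (simp add: algebra_simps)
    finally show ?thesis .
  qed
  \<comment> \<open>The block p = 0 is separate because \<open>g 0 - g 1\<close> is only of order 1
    / \<open>lev 0\<close>, without the square; this is why the energy has the larger weight at the
    leaves.\<close>
  have first: "(\<Sum>l\<in>{2^0..<2^Suc 0}. b l * S l) \<le> 36 * (wt 0 * (F 0)\<^sup>2)"
  proof -
    have "(\<Sum>l\<in>{2^0..<2^Suc 0}. b l * S l) \<le> (g 0 - g 1) * (36 * (F 0)\<^sup>2)"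
      using block[of 0] by simp
    also have "\<dots> \<le> 1 / lev 0 * (36 * (F 0)\<^sup>2)" using g01 by (rule mult_right_mono) simp
    finally show ?thesis by (simp add: wt_def)
  qed
  have "{..J} = insert 0 {1..J}" by auto
  then have "(\<Sum>p\<le>J. \<Sum>l\<in>{2^p..<2^Suc p}. b l * S l) = (\<Sum>l\<in>{2^0..<2^Suc 0}. b l * S l) + (\<Sum>p\<in>{1..J}. \<Sum>l\<in>{2^p..<2^Suc p}. b l * S l)"
    by (simp only: sum.insert finite_atLeastAtMost) simp
  also have "\<dots> \<le> 36 * (wt 0 * (F 0)\<^sup>2) + (\<Sum>p\<in>{1..J}. 144 * (P p * ?H p))"
    using term_le by (intro add_mono first sum_mono) (simp add: mult.assoc)
  also have "\<dots> \<le> 36 * (wt 0 * (F 0)\<^sup>2) + 144 * (2 * geom_const * en a J 0)"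
    unfolding sum_distrib_left[symmetric] using swap by simp
  finally have A: "(\<Sum>l\<in>{1..<2*N}. b l * S l) \<le> 36 * (wt 0 * (F 0)\<^sup>2) + 288 * geom_const * en a J 0"
    using split[of J] by (simp add: N_def)
  have wtF: "wt q * (F q)\<^sup>2 \<le> en a J 0" if "q \<le> J" for q
    unfolding en_F by (rule member_le_sum) (use that wt0 in auto)
  \<comment> \<open>The constant part of \<open>g\<close> multiplies the square of the total sum,
    which is the block of the root and is absorbed by the weight at height \<open>J\<close>.\<close>
  have "(blk a J 0)\<^sup>2 \<le> (F J)\<^sup>2"
    unfolding F_def L2_set_def by (simp add: sum_nonneg) (rule member_le_sum[of 0], auto)
  then have "g N * (blk a J 0)\<^sup>2 \<le> 2 / (lev J)\<^sup>2 * (F J)\<^sup>2"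
    using gN by (intro mult_mono) (auto simp: N_def)
  also have "\<dots> \<le> 4 * wt J * (F J)\<^sup>2"
    using inverse_lev_square_le[of J] by (intro mult_right_mono) auto
  also have "\<dots> \<le> 4 * en a J 0" using wtF[of J] by simp
  finally have B: "g N * (blk a J 0)\<^sup>2 \<le> 4 * en a J 0" .
  have "g N * (blk a J 0)\<^sup>2 + (\<Sum>l\<in>{1..<2*N}. b l * S l) \<le> (40 + 288 * geom_const) * en a J 0"
    using A B wtF[of 0] by (simp add: algebra_simps)
  then show ?thesis using quad by (simp add: N_def energy_const_def)
qed

end

section \<open>The correlation function of the kernel\<close>

lemma integral_le_of_nn_integral:
  assumes "f \<in> borel_measurable M" "\<And>x. 0 \<le> f x" "0 \<le> B" "(\<integral>\<^sup>+x. ennreal (f x) \<partial>M) \<le> ennreal B"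
  shows "(LINT x|M. f x) \<le> B"
  using assms by (subst integral_eq_nn_integral) (auto intro: enn2real_leI)

lemma nn_integral_of_has_integral:
  fixes f :: "real \<Rightarrow> real"
  assumes [measurable]: "f \<in> borel_measurable borel" "S \<in> sets borel"
    and "\<And>x. x \<in> S \<Longrightarrow> 0 \<le> f x" "(f has_integral I) S"
  shows "(\<integral>\<^sup>+x. ennreal (indicator S x * f x) \<partial>lborel) = ennreal I"
proof (rule nn_integral_has_integral_lborel)
  have "(\<lambda>x. indicator S x * f x) = (\<lambda>x. if x \<in> S then f x else 0)" by auto
  then show "((\<lambda>x. indicator S x * f x) has_integral I) UNIV"
    using assms(4) by (simp add: has_integral_restrict_UNIV)
  show "0 \<le> indicator S x * f x" for x using assms(3) by (simp add: indicator_def)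
qed measurable

lemma integrable_mult_L2:
  fixes f g :: "'a \<Rightarrow> real"
  assumes [measurable]: "f \<in> borel_measurable M" "g \<in> borel_measurable M"
    and "integrable M (\<lambda>x. (f x)\<^sup>2)" "integrable M (\<lambda>x. (g x)\<^sup>2)"
  shows "integrable M (\<lambda>x. f x * g x)"
proof (rule Bochner_Integration.integrable_bound)
  show "integrable M (\<lambda>x. (f x)\<^sup>2 + (g x)\<^sup>2)" using assms by auto
  have "\<bar>a * b\<bar> \<le> a\<^sup>2 + b\<^sup>2" for a b :: real
  proof -
    have "0 \<le> (\<bar>a\<bar> - \<bar>b\<bar>)\<^sup>2" "0 \<le> \<bar>a\<bar> * \<bar>b\<bar>" by simp_all
    then show ?thesis unfolding abs_mult power2_diff power2_abs by linarith
  qed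
  then show "AE x in M. norm (f x * g x) \<le> norm ((f x)\<^sup>2 + (g x)\<^sup>2)" by auto
qed simp

section \<open>The kernel as a function of t - s\<close>

definition ker :: "real \<Rightarrow> real" where
  "ker x = x powr (-1/2) * inverse \<bar>ln x\<bar>"

lemma ker_measurable [measurable]: "ker \<in> borel_measurable borel"
  unfolding ker_def by measurable

lemma ker_nonneg: "0 \<le> ker x" by (simp add: ker_def)

lemma ker_sqrt: "0 < x \<Longrightarrow> ker x = 1 / (sqrt x * \<bar>ln x\<bar>)"
proof -
  assume "0 < x"
  then have "x powr (-1/2) = inverse (sqrt x)"
    using powr_minus[of x "1/2"] powr_half_sqrt[of x] by simp
  then show ?thesis by (simp add: ker_def inverse_eq_divide)
qed

lemma ker_sq: "0 < x \<Longrightarrow> (ker x)\<^sup>2 = 1 / (x * (ln x)\<^sup>2)"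
  by (simp add: ker_sqrt power_divide power_mult_distrib)

lemma ker_alt: "0 < x \<Longrightarrow> x < 1 \<Longrightarrow> ker x = - (x powr (-1/2) / ln x)"
  by (simp add: ker_def inverse_eq_divide)

lemma ln_less_m2: "0 < (x::real) \<Longrightarrow> x < exp (-2) \<Longrightarrow> ln x < -2"
  using ln_less_cancel_iff[of x "exp (-2)"] by simp

lemma small_less_1: "x < exp (-2) \<Longrightarrow> x < (1::real)"
proof -
  assume "x < exp (-2)"
  moreover have "exp (-2) < (1::real)" by simp
  ultimately show ?thesis by linarith
qed

lemma ker_deriv:
  assumes "0 < x" "x < 1"
  shows "(ker has_real_derivative - (1/x) * (1/2 + 1 / ln x) * ker x) (at x)"
proof -
  have "ln x \<noteq> 0" using assms by simp
  have p: "x powr (-1/2 - 1) = x powr (-1/2) / x" using assms by (simp only: powr_diff powr_one)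
  have "((\<lambda>x. - (x powr (-1/2) / ln x)) has_real_derivative
      - (((-1/2) * x powr (-1/2 - 1) * ln x - x powr (-1/2) * (1 / x)) / (ln x * ln x))) (at x)"
    using assms \<open>ln x \<noteq> 0\<close>
    by (intro DERIV_minus DERIV_divide has_real_derivative_powr DERIV_ln_divide)
  also have "- (((-1/2) * x powr (-1/2 - 1) * ln x - x powr (-1/2) * (1 / x)) / (ln x * ln x))
      = - (1/x) * (1/2 + 1 / ln x) * (- (x powr (-1/2) / ln x))"
  proof -
    have "- (((-1/2) * (u / x) * l - u * (1 / x)) / (l * l)) = - (1/x) * (1/2 + 1 / l) * (- (u / l))"
      if "l \<noteq> 0" for u l :: real
      using that \<open>0 < x\<close> by (simp add: field_simps)
    then show ?thesis unfolding p using \<open>ln x \<noteq> 0\<close> .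
  qed
  finally have "((\<lambda>x. - (x powr (-1/2) / ln x)) has_real_derivative - (1/x) * (1/2 + 1 / ln x) * (- (x powr (-1/2) / ln x))) (at x)" .
  then show ?thesis
    unfolding ker_alt[OF assms]
    by (rule has_field_derivative_transform_within_open[of _ _ _ "{0<..<1}"]) (use assms in \<open>auto simp: ker_alt\<close>)
qed

text \<open>The logarithmic derivative is -(1/2 + 1 / ln x) / x, and for 0 < x < 1 it is nonpositive
  exactly when ln x <= -2. This is where exp(-2) enters.\<close>

lemma ker_antimono:
  assumes "0 < x" "x \<le> y" "y < exp (-2)"
  shows "ker y \<le> ker x"
proof (rule DERIV_nonpos_imp_nonincreasing[OF assms(2)])
  fix z assume z: "x \<le> z" "z \<le> y"
  then have "ln z < -2" "z < 1" using ln_less_m2[of z] small_less_1[of z] assms by auto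
  then have "1/2 + 1 / ln z \<ge> 0" by (simp add: field_simps)
  then have "- (1/z) * (1/2 + 1 / ln z) * ker z \<le> 0"
    using z assms ker_nonneg[of z] by (simp add: mult_nonneg_nonneg)
  then show "\<exists>D. (ker has_real_derivative D) (at z) \<and> D \<le> 0"
    using ker_deriv[of z] z assms \<open>z < 1\<close> by fastforce
qed

text \<open>With h = 1/2 + 1 / ln x >= 0 the second derivative is (h + 1 / (ln x)^2 + h^2)
  \<open>ker x\<close> / x^2.\<close>

lemma ker_convex: "convex_on {0<..<exp (-2)} ker"
proof (rule f''_ge0_imp_convex)
  fix x :: real assume x: "x \<in> {0<..<exp (-2)}"
  then have l: "ln x < -2" and x1: "0 < x" "x < 1" using ln_less_m2[of x] small_less_1[of x] by auto
  show "(ker has_real_derivative - (1/x) * (1/2 + 1 / ln x) * ker x) (at x)"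
    by (rule ker_deriv[OF x1])
  have "((\<lambda>x. - (1/x) * (1/2 + 1 / ln x)) has_real_derivative (1/x\<^sup>2) * (1/2 + 1 / ln x) + 1/x\<^sup>2 * (1 / (ln x)\<^sup>2)) (at x)"
    using x1 l by (auto intro!: derivative_eq_intros simp: field_simps power2_eq_square)
  from DERIV_mult[OF this ker_deriv[OF x1]]
  show "((\<lambda>x. - (1/x) * (1/2 + 1 / ln x) * ker x) has_real_derivative
      ((1/x\<^sup>2) * (1/2 + 1 / ln x) + 1/x\<^sup>2 * (1 / (ln x)\<^sup>2)) * ker x + (- (1/x) * (1/2 + 1 / ln x) * ker x) * (- (1/x) * (1/2 + 1 / ln x))) (at x)" .
  define h where "h = 1/2 + 1 / ln x"
  have "h \<ge> 0" using l by (simp add: h_def field_simps)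
  have "(1/x\<^sup>2 * h + 1/x\<^sup>2 * (1 / (ln x)\<^sup>2)) * ker x + (- (1/x) * h * ker x) * (- (1/x) * h) = (1/x\<^sup>2 * h + 1/x\<^sup>2 * (1 / (ln x)\<^sup>2)) * ker x + ker x * (h / x)\<^sup>2"
    by (simp add: power2_eq_square)
  also have "\<dots> \<ge> 0"
    using ker_nonneg[of x] \<open>h \<ge> 0\<close> by (intro add_nonneg_nonneg mult_nonneg_nonneg) auto
  finally show "((1/x\<^sup>2) * (1/2 + 1 / ln x) + 1/x\<^sup>2 * (1 / (ln x)\<^sup>2)) * ker x + (- (1/x) * (1/2 + 1 / ln x) * ker x) * (- (1/x) * (1/2 + 1 / ln x)) \<ge> 0"
    unfolding h_def .
qed simp

lemma nn_integral_ker_sq: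
  assumes "0 < x" "x < exp (-2)"
  shows "(\<integral>\<^sup>+y. ennreal (indicator {0..x} y * (ker y)\<^sup>2) \<partial>lborel) = ennreal (1 / \<bar>ln x\<bar>)"
proof -
  have x1: "x < 1" using assms small_less_1 by auto
  have "((\<lambda>y. (ker y)\<^sup>2) has_integral (-1 / ln x - (-1 / ln 0))) {0..x}"
  proof (rule fundamental_theorem_of_calculus_interior)
    \<comment> \<open>At 0 the conventions \<open>ln 0 = 0\<close> and \<open>-1 / 0 = 0\<close>
      supply the right limit value.\<close>
    show "continuous_on {0..x} (\<lambda>y. -1 / ln y)"
    proof (rule continuous_on_IccI)
      have "((\<lambda>y::real. -1 / ln y) \<longlongrightarrow> 0) (at_right 0)" by real_asymp
      moreover have "-1 / ln (0::real) = 0" by simp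
      ultimately show "((\<lambda>y. -1 / ln y) \<longlongrightarrow> -1 / ln (0::real)) (at_right 0)" by (simp only:)
      show "((\<lambda>y. -1 / ln y) \<longlongrightarrow> -1 / ln x) (at_left x)"
        using assms x1 by (intro tendsto_intros) auto
      show "((\<lambda>y. -1 / ln y) \<longlongrightarrow> -1 / ln y) (at y)" if "0 < y" "y < x" for y
        using that x1 by (intro tendsto_intros) auto
    qed (use assms in auto)
    show "((\<lambda>y. -1 / ln y) has_vector_derivative (ker y)\<^sup>2) (at y)" if "y \<in> {0<..<x}" for y
    proof -
      have "(ker y)\<^sup>2 = 1 / (y * (ln y)\<^sup>2)" using that by (simp add: ker_sq)
      moreover have "((\<lambda>y. -1 / ln y) has_real_derivative 1 / (y * (ln y)\<^sup>2)) (at y)"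
        using that x1 by (auto intro!: derivative_eq_intros simp: power2_eq_square)
      ultimately show ?thesis by (simp add: has_real_derivative_iff_has_vector_derivative)
    qed
  qed (use assms in auto)
  from nn_integral_of_has_integral[OF _ _ _ this]
  show ?thesis using x1 assms by (simp add: abs_if)
qed

text \<open>An antiderivative of \<open>ker\<close> would be a logarithmic integral. The factor 1 -
  2 / ln y >= 1 turns \<open>ker\<close> into a majorant with the explicit antiderivative -2 sqrt y
  / ln y.\<close>

lemma nn_integral_ker_le:
  assumes "0 < x" "x < exp (-2)"
  shows "(\<integral>\<^sup>+y. ennreal (indicator {0..x} y * ker y) \<partial>lborel) \<le> ennreal (2 * sqrt x / \<bar>ln x\<bar>)"
proof -
  have x1: "x < 1" using assms small_less_1 by auto
  define g where "g y = ker y * (1 - 2 / ln y)" for y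
  have [measurable]: "g \<in> borel_measurable borel" unfolding g_def by measurable
  have pos: "indicator {0..x} y * ker y \<le> indicator {0..x} y * g y" "0 \<le> indicator {0..x} y * g y" for y
  proof -
    have "1 \<le> 1 - 2 / ln y" if "0 \<le> y" "y \<le> x"
      using that x1 by (cases "y = 0") (auto simp: divide_nonneg_neg)
    then have "ker y \<le> g y" if "0 \<le> y" "y \<le> x" using that ker_nonneg[of y] mult_left_mono[of 1 "1 - 2 / ln y" "ker y"] by (simp add: g_def)
    then show "indicator {0..x} y * ker y \<le> indicator {0..x} y * g y" "0 \<le> indicator {0..x} y * g y"
      using ker_nonneg[of y] by (auto simp: indicator_def intro: order_trans)
  qed
  have I: "(g has_integral (- (2 * sqrt x / ln x) - (- (2 * sqrt 0 / ln 0)))) {0..x}"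
  proof (rule fundamental_theorem_of_calculus_interior)
    show "continuous_on {0..x} (\<lambda>y. - (2 * sqrt y / ln y))"
    proof (rule continuous_on_IccI)
      have "((\<lambda>y::real. - (2 * sqrt y / ln y)) \<longlongrightarrow> 0) (at_right 0)" by real_asymp
      then show "((\<lambda>y. - (2 * sqrt y / ln y)) \<longlongrightarrow> - (2 * sqrt 0 / ln (0::real))) (at_right 0)" by simp
      show "((\<lambda>y. - (2 * sqrt y / ln y)) \<longlongrightarrow> - (2 * sqrt x / ln x)) (at_left x)"
        using assms x1 by (intro tendsto_intros) auto
      show "((\<lambda>y. - (2 * sqrt y / ln y)) \<longlongrightarrow> - (2 * sqrt y / ln y)) (at y)" if "0 < y" "y < x" for y
        using that x1 by (intro tendsto_intros) auto
    qed (use assms in auto)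
    show "((\<lambda>y. - (2 * sqrt y / ln y)) has_vector_derivative g y) (at y)" if y: "y \<in> {0<..<x}" for y
    proof -
      have "ln y < 0" using y x1 by simp
      have s: "y = sqrt y * sqrt y" using y by simp
      have "((\<lambda>y. - (2 * sqrt y / ln y)) has_real_derivative - ((inverse (sqrt y) * ln y - 2 * sqrt y * (1/y)) / (ln y)\<^sup>2)) (at y)"
        using y \<open>ln y < 0\<close> by (auto intro!: derivative_eq_intros simp: power2_eq_square)
      also have "2 * sqrt y * (1/y) = 2 * inverse (sqrt y)" using y by (subst (2) s) (simp add: field_simps del: real_sqrt_mult_self)
      also have "- ((inverse (sqrt y) * ln y - 2 * inverse (sqrt y)) / (ln y)\<^sup>2) = g y"
        using y x1 \<open>ln y < 0\<close> by (simp add: g_def ker_alt powr_minus powr_half_sqrt field_simps power2_eq_square)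
      finally show ?thesis unfolding has_real_derivative_iff_has_vector_derivative .
    qed
  qed (use assms in auto)
  have "(\<integral>\<^sup>+y. ennreal (indicator {0..x} y * ker y) \<partial>lborel) \<le> (\<integral>\<^sup>+y. ennreal (indicator {0..x} y * g y) \<partial>lborel)"
    using pos by (intro nn_integral_mono ennreal_leI) auto
  also have "\<dots> = ennreal (- (2 * sqrt x / ln x) - (- (2 * sqrt 0 / ln 0)))"
  proof (rule nn_integral_of_has_integral[OF _ _ _ I])
    show "0 \<le> g y" if "y \<in> {0..x}" for y using pos(2)[of y] that by simp
  qed measurable
  also have "\<dots> = ennreal (2 * sqrt x / \<bar>ln x\<bar>)" using x1 assms by (simp add: abs_if)
  finally show ?thesis .
qed


section \<open>The continued kernel and its correlation function\<close>

locale short =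
  fixes r :: real
  assumes r_pos: "0 < r" and r_small: "r < exp (-2)"
begin

text \<open>Only \<open>kt\<close> on \<open>{0<..r}\<close> matters for the operators. Continuing it by a constant up to \<open>2 * r\<close>
  makes its correlation function \<open>Gam\<close> convex and small at \<open>r\<close>, uniformly in \<open>r\<close>.\<close>

definition kt :: "real \<Rightarrow> real" where
  "kt x = (if 0 < x \<and> x \<le> 2 * r then ker (min x r) else 0)"

lemma kt_measurable [measurable]: "kt \<in> borel_measurable borel"
  unfolding kt_def by measurable

lemma kt_nonneg: "0 \<le> kt x" by (simp add: kt_def ker_nonneg)

lemma kt_neg: "x \<le> 0 \<Longrightarrow> kt x = 0" by (simp add: kt_def)

lemma ln_r: "ln r < -2" using ln_less_m2 r_pos r_small by auto

lemma kt_anti: "0 < x \<Longrightarrow> x \<le> y \<Longrightarrow> kt y \<le> kt x"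
  using r_pos r_small by (auto simp: kt_def ker_nonneg intro!: ker_antimono)

text \<open>The minimum with \<open>r\<close> is concave, and a decreasing convex function of a
  concave one is convex. The cutoff at \<open>2 * r\<close> would destroy this, hence
  \<open>y \<le> 2 * r\<close>.\<close>

lemma kt_mid:
  assumes "0 < x" "x \<le> y" "y \<le> 2 * r"
  shows "2 * kt ((x + y) / 2) \<le> kt x + kt y"
proof -
  let ?m = "\<lambda>x. min x r"
  have "ker (?m ((x + y) / 2)) \<le> ker ((1 - 1/2) * ?m x + 1/2 * ?m y)"
    using assms r_pos r_small by (intro ker_antimono) (auto simp: min_def field_simps)
  also have "\<dots> \<le> (1 - 1/2) * ker (?m x) + 1/2 * ker (?m y)"
    using convex_onD[OF ker_convex, of "1/2" "?m x" "?m y"] assms r_pos r_small by auto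
  finally show ?thesis using assms by (simp add: kt_def)
qed

lemma nn_kt_sq: "0 < x \<Longrightarrow> x \<le> r \<Longrightarrow> (\<integral>\<^sup>+y. ennreal (indicator {..x} y * (kt y)\<^sup>2) \<partial>lborel) \<le> ennreal (1 / \<bar>ln x\<bar>)"
  using r_small by (subst nn_integral_ker_sq[symmetric])
    (auto intro!: nn_integral_mono ennreal_leI simp: indicator_def kt_def)

lemma nn_kt_le: "0 < x \<Longrightarrow> x \<le> r \<Longrightarrow> (\<integral>\<^sup>+y. ennreal (indicator {..x} y * kt y) \<partial>lborel) \<le> ennreal (2 * sqrt x / \<bar>ln x\<bar>)"
  using r_small by (intro order_trans[OF _ nn_integral_ker_le])
    (auto intro!: nn_integral_mono ennreal_leI simp: indicator_def kt_def ker_nonneg)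

lemma nn_kt_sq_UNIV: "(\<integral>\<^sup>+y. ennreal ((kt y)\<^sup>2) \<partial>lborel) \<le> 1"
proof -
  have "(\<integral>\<^sup>+y. ennreal ((kt y)\<^sup>2) \<partial>lborel)
      \<le> (\<integral>\<^sup>+y. ennreal (indicator {..r} y * (kt y)\<^sup>2) + ennreal ((ker r)\<^sup>2) * indicator {r<..2*r} y \<partial>lborel)"
    by (intro nn_integral_mono) (auto simp: indicator_def kt_def)
  also have "\<dots> = (\<integral>\<^sup>+y. ennreal (indicator {..r} y * (kt y)\<^sup>2) \<partial>lborel) + ennreal ((ker r)\<^sup>2) * emeasure lborel {r<..2*r}"
    by (subst nn_integral_add) (auto simp: nn_integral_cmult_indicator)
  also have "\<dots> \<le> ennreal (1 / \<bar>ln r\<bar>) + ennreal ((ker r)\<^sup>2) * ennreal r"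
    using r_pos by (intro add_mono nn_kt_sq) auto
  also have "\<dots> = ennreal (1 / \<bar>ln r\<bar> + 1 / (ln r)\<^sup>2)"
    using r_pos by (simp add: ennreal_mult[symmetric] ker_sq)
  also have "\<dots> \<le> ennreal 1"
  proof (rule ennreal_leI)
    have "1 / \<bar>ln r\<bar> \<le> 1/2" using ln_r by (simp add: divide_simps)
    moreover have "1 / (ln r)\<^sup>2 \<le> 1/2" 
    proof -
      have "2 * 2 \<le> \<bar>ln r\<bar> * \<bar>ln r\<bar>" using ln_r by (intro mult_mono) auto
      then show ?thesis using ln_r by (simp add: power2_eq_square divide_simps)
    qed
    ultimately show "1 / \<bar>ln r\<bar> + 1 / (ln r)\<^sup>2 \<le> 1" by simp
  qed
  finally show ?thesis by simp
qed

lemma kt_sq_integrable: "integrable lborel (\<lambda>y. (kt y)\<^sup>2)"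
  by (rule integrableI_bounded) (use le_less_trans[OF nn_kt_sq_UNIV] in auto)

lemma kt_sq_integrable': "c \<noteq> 0 \<Longrightarrow> integrable lborel (\<lambda>y. (kt (t + c * y))\<^sup>2)"
  using lborel_integrable_real_affine[OF kt_sq_integrable] .

lemma kt_mult_integrable: "c \<noteq> 0 \<Longrightarrow> d \<noteq> 0 \<Longrightarrow> integrable lborel (\<lambda>y. kt (t + c * y) * kt (u + d * y))"
  by (rule integrable_mult_L2) (auto intro: kt_sq_integrable')

lemma kt_mult_integrable1: "integrable lborel (\<lambda>y. kt (y + t) * kt (y + u))"
  using kt_mult_integrable[of 1 1 t u] by (simp add: add.commute)

lemma kt_mult_integrable2: "integrable lborel (\<lambda>y. kt y * kt (y + u))"
  using kt_mult_integrable1[of 0 u] by simp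

lemma kt_mult_integrable3: "integrable lborel (\<lambda>s. kt (t - s) * kt (u - s))"
  using kt_mult_integrable[of "-1" "-1" t u] by simp

definition Gam :: "real \<Rightarrow> real" where
  "Gam x = (LINT y|lborel. kt y * kt (y + x))"

lemma Gam_antimono: "0 \<le> x \<Longrightarrow> x \<le> y \<Longrightarrow> Gam y \<le> Gam x"
  unfolding Gam_def
proof (rule integral_mono)
  fix z assume "0 \<le> x" "x \<le> y"
  then show "kt z * kt (z + y) \<le> kt z * kt (z + x)"
    by (cases "z \<le> 0") (auto simp: kt_neg kt_nonneg intro!: mult_left_mono kt_anti)
qed (rule kt_mult_integrable2)+

text \<open>Comparing the integrand of \<open>Gam (h + x)\<close> with the translate by \<open>x\<close> of that of \<open>Gam h\<close>
  makes the difference telescope.\<close>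

lemma Gam_diff_le:
  assumes "0 \<le> x" "0 \<le> h"
  shows "Gam h - Gam (h + x) \<le> (LINT y|lborel. indicator {..x} y * (kt y * kt (y + h)))"
proof -
  define \<phi> where "\<phi> y = kt y * kt (y + h)" for y
  have [simp]: "integrable lborel \<phi>" unfolding \<phi>_def by (rule kt_mult_integrable2)
  have ind: "integrable lborel (\<lambda>y. indicator S y * \<phi> y)" if "S \<in> sets borel" for S
    using integrable_mult_indicator[of S lborel \<phi>] that by simp
  have eq: "(LINT y|lborel. indicator {x<..} y * \<phi> y) = (LINT y|lborel. indicator {x<..} (x + 1 * y) * \<phi> (x + 1 * y))"
    using lborel_integral_real_affine[of 1 "\<lambda>y. indicator {x<..} y * \<phi> y" x] by simp
  have "(LINT y|lborel. indicator {x<..} (x + 1 * y) * \<phi> (x + 1 * y)) \<le> (LINT y|lborel. kt y * kt (y + (h + x)))"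
  proof (rule integral_mono)
    show "integrable lborel (\<lambda>y. indicator {x<..} (x + 1 * y) * \<phi> (x + 1 * y))"
      using lborel_integrable_real_affine[OF ind[of "{x<..}"], of 1 x] by simp
    show "integrable lborel (\<lambda>y. kt y * kt (y + (h + x)))" by (rule kt_mult_integrable2)
    show "indicator {x<..} (x + 1 * y) * \<phi> (x + 1 * y) \<le> kt y * kt (y + (h + x))" for y
      using assms by (cases "0 < y") (auto simp: \<phi>_def kt_neg ac_simps kt_nonneg intro!: mult_right_mono kt_anti)
  qed
  then have "(LINT y|lborel. indicator {x<..} y * \<phi> y) \<le> Gam (h + x)" unfolding eq Gam_def .
  moreover have "Gam h = (LINT y|lborel. indicator {..x} y * \<phi> y) + (LINT y|lborel. indicator {x<..} y * \<phi> y)"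
  proof -
    have "Gam h = (LINT y|lborel. indicator {..x} y * \<phi> y + indicator {x<..} y * \<phi> y)"
      unfolding Gam_def \<phi>_def[symmetric] by (intro Bochner_Integration.integral_cong) (auto simp: indicator_def)
    also have "\<dots> = (LINT y|lborel. indicator {..x} y * \<phi> y) + (LINT y|lborel. indicator {x<..} y * \<phi> y)"
      by (intro Bochner_Integration.integral_add ind) auto
    finally show ?thesis .
  qed
  ultimately show ?thesis by (simp add: \<phi>_def)
qed

lemma Gam_0_diff: "0 < x \<Longrightarrow> x \<le> r \<Longrightarrow> Gam 0 - Gam x \<le> 1 / \<bar>ln x\<bar>"
proof -
  assume x: "0 < x" "x \<le> r"
  have "Gam 0 - Gam x \<le> (LINT y|lborel. indicator {..x} y * (kt y)\<^sup>2)"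
    using Gam_diff_le[of x 0] x by (simp add: power2_eq_square)
  also have "\<dots> \<le> 1 / \<bar>ln x\<bar>"
    by (rule integral_le_of_nn_integral) (use nn_kt_sq[OF x] in auto)
  finally show ?thesis .
qed

text \<open>On the range of integration \<open>kt (y + x)\<close> is at most \<open>kt x\<close> = 1
  / (sqrt x |ln x|), and the integral of \<open>kt\<close> over (0, x] is at most 2 sqrt x / |ln x|:
  the square roots cancel.\<close>

lemma int_kt_bound:
  assumes "0 < x" "x \<le> r"
  shows "(LINT y|lborel. indicator {..x} y * (kt y * kt (y + x))) \<le> 2 / (ln x)\<^sup>2"
proof (rule integral_le_of_nn_integral)
  have kx: "kt x = 1 / (sqrt x * \<bar>ln x\<bar>)" using assms by (simp add: kt_def ker_sqrt)
  have "(\<integral>\<^sup>+y. ennreal (indicator {..x} y * (kt y * kt (y + x))) \<partial>lborel) \<le> (\<integral>\<^sup>+y. ennreal (kt x) * ennreal (indicator {..x} y * kt y) \<partial>lborel)"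
  proof (rule nn_integral_mono)
    fix y
    have "indicator {..x} y * (kt y * kt (y + x)) \<le> kt x * (indicator {..x} y * kt y)"
    proof (cases "0 < y \<and> y \<le> x")
      case True
      then have "kt y * kt (y + x) \<le> kt y * kt x" using assms by (intro mult_left_mono kt_anti kt_nonneg) auto
      then show ?thesis using True by (simp add: mult.commute)
    next
      case False
      then show ?thesis by (auto simp: kt_neg)
    qed
    then show "ennreal (indicator {..x} y * (kt y * kt (y + x))) \<le> ennreal (kt x) * ennreal (indicator {..x} y * kt y)"
      by (simp add: ennreal_mult[symmetric] kt_nonneg ennreal_leI)
  qed
  also have "\<dots> = ennreal (kt x) * (\<integral>\<^sup>+y. ennreal (indicator {..x} y * kt y) \<partial>lborel)"
    by (rule nn_integral_cmult) measurable
  also have "\<dots> \<le> ennreal (kt x) * ennreal (2 * sqrt x / \<bar>ln x\<bar>)"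
    by (intro mult_left_mono nn_kt_le assms) auto
  also have "\<dots> = ennreal (2 / (ln x)\<^sup>2)"
    using assms by (simp add: ennreal_mult[symmetric] kt_nonneg) (simp add: kx power2_eq_square)
  finally show "(\<integral>\<^sup>+y. ennreal (indicator {..x} y * (kt y * kt (y + x))) \<partial>lborel) \<le> ennreal (2 / (ln x)\<^sup>2)" .
qed (auto simp: kt_nonneg)

lemma Gam_double: "0 < x \<Longrightarrow> x \<le> r \<Longrightarrow> Gam x - Gam (2 * x) \<le> 2 / (ln x)\<^sup>2"
  using Gam_diff_le[of x x] int_kt_bound[of x] by simp

lemma Gam_r: "Gam r \<le> 2 / (ln r)\<^sup>2"
proof -
  \<comment> \<open>For \<open>y > r\<close> the second factor vanishes because of the cutoff at
    \<open>2 * r\<close>.\<close>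
  have "Gam r = (LINT y|lborel. indicator {..r} y * (kt y * kt (y + r)))"
    unfolding Gam_def using r_pos by (intro Bochner_Integration.integral_cong) (auto simp: indicator_def kt_def)
  then show ?thesis using int_kt_bound[of r] r_pos by simp
qed

text \<open>For \<open>y > r\<close> both factors equal \<open>ker r\<close> until the cutoff, so
  this part is affine in \<open>x\<close> and disappears from second differences. The remaining part
  only sees \<open>kt\<close> on (0, 2 r], where \<open>kt_mid\<close> applies; this is how
  \<open>Gam_convex\<close> avoids the jump at the cutoff.\<close>

lemma Gam_eq:
  assumes "0 \<le> x" "x \<le> r"
  shows "Gam x = (LINT y|lborel. indicator {..r} y * (kt y * kt (y + x))) + (ker r)\<^sup>2 * (r - x)"
proof -
  have "Gam x = (LINT y|lborel. indicator {..r} y * (kt y * kt (y + x)) + (ker r)\<^sup>2 * indicator {r<..2*r-x} y)"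
    unfolding Gam_def using assms r_pos
    by (intro Bochner_Integration.integral_cong) (auto simp: indicator_def kt_def power2_eq_square)
  also have "\<dots> = (LINT y|lborel. indicator {..r} y * (kt y * kt (y + x))) + (LINT y|lborel. (ker r)\<^sup>2 * indicator {r<..2*r-x} y)"
    using integrable_mult_indicator[of "{..r}" lborel "\<lambda>y. kt y * kt (y + x)"] kt_mult_integrable2[of x] assms
    by (intro Bochner_Integration.integral_add) auto
  also have "(LINT y|lborel. (ker r)\<^sup>2 * indicator {r<..2*r-x} y) = (ker r)\<^sup>2 * (r - x)"
    using assms by simp
  finally show ?thesis .
qed

lemma Gam_convex:
  assumes "0 \<le> x - d" "0 \<le> d" "x + d \<le> r"
  shows "2 * Gam x \<le> Gam (x - d) + Gam (x + d)"
proof -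
  have int: "integrable lborel (\<lambda>y. indicator {..r} y * (kt y * kt (y + u)))" for u
    using integrable_mult_indicator[of "{..r}" lborel "\<lambda>y. kt y * kt (y + u)"] kt_mult_integrable2[of u] by simp
  have "(LINT y|lborel. 2 * (indicator {..r} y * (kt y * kt (y + x))))
    \<le> (LINT y|lborel. indicator {..r} y * (kt y * kt (y + (x - d))) + indicator {..r} y * (kt y * kt (y + (x + d))))"
  proof (intro integral_mono Bochner_Integration.integrable_add int integrable_mult_right)
    fix y
    have "kt y * (2 * kt (y + x)) \<le> kt y * (kt (y + (x - d)) + kt (y + (x + d)))" if "0 < y" "y \<le> r"
    proof (rule mult_left_mono[OF _ kt_nonneg])
      have m: "(y + (x - d) + (y + (x + d))) / 2 = y + x" by simp
      show "2 * kt (y + x) \<le> kt (y + (x - d)) + kt (y + (x + d))"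
        using kt_mid[of "y + (x - d)" "y + (x + d)"] that assms unfolding m by simp
    qed
    then show "2 * (indicator {..r} y * (kt y * kt (y + x))) \<le> indicator {..r} y * (kt y * kt (y + (x - d))) + indicator {..r} y * (kt y * kt (y + (x + d)))"
      by (cases "0 < y") (auto simp: indicator_def kt_neg algebra_simps)
  qed
  then have "2 * (LINT y|lborel. indicator {..r} y * (kt y * kt (y + x)))
    \<le> (LINT y|lborel. indicator {..r} y * (kt y * kt (y + (x - d)))) + (LINT y|lborel. indicator {..r} y * (kt y * kt (y + (x + d))))"
    by (simp add: Bochner_Integration.integral_add int)
  then show ?thesis using assms by (simp add: Gam_eq algebra_simps)
qed

lemma int_kt_kt: "(LINT s|lborel. kt (t - s) * kt (u - s)) = Gam \<bar>t - u\<bar>"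
proof -
  have *: "(LINT s|lborel. kt (t - s) * kt (u - s)) = Gam (u - t)" if "t \<le> u" for t u
    unfolding Gam_def using lborel_integral_real_affine[of "-1" "\<lambda>s. kt (t - s) * kt (u - s)" t] by (simp add: algebra_simps)
  show ?thesis using *[of t u] *[of u t] by (cases "t \<le> u") (auto simp: mult.commute)
qed

lemma sum_kt_expand:
  "integrable lborel (\<lambda>s. (\<Sum>i\<in>I. a i * kt (t i - s))\<^sup>2)" (is ?i)
  "(LINT s|lborel. (\<Sum>i\<in>I. a i * kt (t i - s))\<^sup>2) = (\<Sum>i\<in>I. \<Sum>j\<in>I. a i * a j * Gam \<bar>t i - t j\<bar>)" (is ?e)
proof -
  have eq: "(\<Sum>i\<in>I. a i * kt (t i - s))\<^sup>2 = (\<Sum>i\<in>I. \<Sum>j\<in>I. (a i * a j) * (kt (t i - s) * kt (t j - s)))" for s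
    unfolding power2_eq_square sum_product by (intro sum.cong refl) simp
  show ?i unfolding eq by (intro Bochner_Integration.integrable_sum integrable_mult_right kt_mult_integrable3)
  show ?e unfolding eq
    by (simp add: Bochner_Integration.integral_sum Bochner_Integration.integrable_sum integrable_mult_right kt_mult_integrable3 int_kt_kt)
qed

lemma Gam_0_le: "Gam 0 \<le> 1"
  unfolding Gam_def by (rule integral_le_of_nn_integral) (use nn_kt_sq_UNIV in \<open>auto simp: power2_eq_square\<close>)

text \<open>The squared distance of two translates is 2 (\<open>Gam 0\<close> - \<open>Gam\<close>
  |t - u|).\<close>

lemma kt_shift_diff:
  assumes "\<bar>t - u\<bar> \<le> d" "0 < d" "d \<le> r"
  shows "(LINT s|lborel. (kt (t - s) - kt (u - s))\<^sup>2) \<le> 2 / \<bar>ln d\<bar>"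
proof -
  have "(LINT s|lborel. (kt (t - s) - kt (u - s))\<^sup>2) = (LINT s|lborel. (\<Sum>i\<in>{True,False}. (if i then 1 else -1) * kt ((if i then t else u) - s))\<^sup>2)"
    by simp
  also have "\<dots> = 2 * (Gam 0 - Gam \<bar>t - u\<bar>)"
    unfolding sum_kt_expand(2) by (simp add: abs_minus_commute)
  also have "\<dots> \<le> 2 * (Gam 0 - Gam d)" using Gam_antimono[of "\<bar>t-u\<bar>" d] assms by simp
  also have "\<dots> \<le> 2 / \<bar>ln d\<bar>" using Gam_0_diff[of d] assms by simp
  finally show ?thesis .
qed

lemma kt_shift_integrable: "integrable lborel (\<lambda>s. (kt (t - s) - kt (u - s))\<^sup>2)"
  using sum_kt_expand(1)[of "\<lambda>i. if i then 1 else -1" "\<lambda>i. if i then t else u" "{True,False}"] by simp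

lemma dyadic_mesh: "dyadic J (- ln (r / 2^J))"
proof
  have "ln (r / 2^J) = ln r - real J * ln 2" using r_pos by (simp add: ln_div ln_realpow)
  then show "2 \<le> - ln (r / 2^J) - real J * ln 2" using ln_r by linarith
qed

lemma energy_bound:
  assumes "\<And>i. 2^J \<le> i \<Longrightarrow> a i = 0"
  shows "(LINT s|lborel. (\<Sum>i<2^J. a i * kt (r * real i / 2^J - s))\<^sup>2) \<le> energy_const * dyadic.en (- ln (r / 2^J)) a J 0"
proof -
  define \<delta> where "\<delta> = r / 2^J"
  \<comment> \<open>Beyond the grid \<open>g\<close> is frozen at \<open>Gam r\<close>, since
    convexity of \<open>Gam\<close> is available on [0, r] only; at the junction convexity of
    \<open>g\<close> follows from monotonicity.\<close>
  define g where "g d = Gam (\<delta> * real (min d (2^J)))" for d :: nat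
  interpret dyadic J "- ln \<delta>" unfolding \<delta>_def by (rule dyadic_mesh)
  have \<delta>: "0 < \<delta>" "\<delta> * 2^J = r" "\<delta> \<le> r" using r_pos by (auto simp: \<delta>_def divide_simps)
  have lev: "lev p = - ln (\<delta> * 2^p)" for p
    unfolding lev_def using \<delta> by (simp add: ln_mult ln_realpow)
  have "(\<Sum>i<2^J. \<Sum>j<2^J. a i * a j * g (absdiff i j)) \<le> energy_const * en a J 0"
  proof (rule quadratic_form_le_en[OF _ _ _ _ _ _ assms])
    show "g (Suc d) \<le> g d" for d
      unfolding g_def using \<delta> by (intro Gam_antimono mult_left_mono) auto
    show "g d = g (2^J)" if "2^J \<le> d" for d using that by (simp add: g_def)
    show "2 * g (Suc d) \<le> g (Suc (Suc d)) + g d" for d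
    proof (cases "Suc (Suc d) \<le> 2^J")
      case True
      then have "real (Suc (Suc d)) \<le> 2^J" by (metis of_nat_le_iff of_nat_numeral of_nat_power)
      then have "\<delta> * real (Suc (Suc d)) \<le> r" using \<delta> mult_left_mono[of "real (Suc (Suc d))" "2^J" \<delta>] by simp
      then have "2 * Gam (\<delta> * real (Suc d)) \<le> Gam (\<delta> * real (Suc d) - \<delta>) + Gam (\<delta> * real (Suc d) + \<delta>)"
        using \<delta> by (intro Gam_convex) (auto simp: algebra_simps)
      then show ?thesis using True by (simp add: g_def algebra_simps min_def)
    next
      case False
      then have "min (Suc (Suc d)) (2^J) = 2^J" "min (Suc d) (2^J) = 2^J" by auto
      then have "g (Suc (Suc d)) = g (Suc d)" by (simp only: g_def)
      moreover have "g (Suc d) \<le> g d" unfolding g_def using \<delta> by (intro Gam_antimono mult_left_mono) auto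
      ultimately show ?thesis by simp
    qed
    show "g 0 - g 1 \<le> 1 / lev 0"
    proof -
      have "g 0 = Gam 0" "g 1 = Gam \<delta>" by (auto simp: g_def min_def)
      moreover have "lev 0 = \<bar>ln \<delta>\<bar>" using lev_ge2[of 0] by (simp add: lev_def)
      ultimately show ?thesis using Gam_0_diff[of \<delta>] \<delta> by simp
    qed
    show "g (2^p) - g (2^Suc p) \<le> 2 / (lev p)\<^sup>2" if p: "p < J" for p
    proof -
      have "(2::nat)^Suc p \<le> 2^J" using p by (intro power_increasing) auto
      moreover have "(2::nat)^p \<le> 2^J" using p by (intro power_increasing) auto
      ultimately have e: "g (2^p) = Gam (\<delta> * 2^p)" "g (2^Suc p) = Gam (2 * (\<delta> * 2^p))"
        by (simp_all add: g_def min_def mult.left_commute)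
      have "(2::real)^p \<le> 2^J" using p by (intro power_increasing) auto
      then have "\<delta> * 2^p \<le> r" using \<delta> mult_left_mono[of "2^p" "2^J" \<delta>] by simp
      then show ?thesis unfolding e lev using Gam_double[of "\<delta> * 2^p"] \<delta> by simp
    qed
    show "g (2^J) \<le> 2 / (lev J)\<^sup>2" using Gam_r \<delta> by (simp add: g_def lev)
  qed
  moreover have "(LINT s|lborel. (\<Sum>i<2^J. a i * kt (r * real i / 2^J - s))\<^sup>2) = (\<Sum>i<2^J. \<Sum>j<2^J. a i * a j * g (absdiff i j))"
    unfolding sum_kt_expand(2)
  proof (intro sum.cong refl arg_cong2[where f = "(*)"])
    fix i j :: nat assume "i \<in> {..<2^J}" "j \<in> {..<2^J}"
    then have "min (absdiff i j) (2^J) = absdiff i j" by (auto simp: absdiff_def)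
    moreover have "\<bar>r * real i / 2^J - r * real j / 2^J\<bar> = \<delta> * real (absdiff i j)"
    proof -
      have "r * real i / 2^J - r * real j / 2^J = \<delta> * (real i - real j)" by (simp add: \<delta>_def right_diff_distrib diff_divide_distrib)
      moreover have "real (absdiff i j) = \<bar>real i - real j\<bar>" by (auto simp: absdiff_def max_def min_def)
      ultimately show ?thesis using \<delta>(1) by (simp add: abs_mult)
    qed
    ultimately show "Gam \<bar>r * real i / 2^J - r * real j / 2^J\<bar> = g (absdiff i j)" by (simp add: g_def)
  qed
  ultimately show ?thesis by (simp add: \<delta>_def)
qed

end

section \<open>Codes and entropy numbers\<close>

datatype ctree = Leaf int | Node int ctree ctree

text \<open>Unary coding suffices, because the absolute values of the labels in one tree add up to
  O(k); the final \<open>False\<close> makes the word self-delimiting.\<close>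

definition encint :: "int \<Rightarrow> bool list" where
  "encint k = (k < 0) # replicate (nat \<bar>k\<bar>) True @ [False]"

fun enc :: "ctree \<Rightarrow> bool list" where
  "enc (Leaf k) = False # encint k"
| "enc (Node k l r) = True # encint k @ enc l @ enc r"

lemma length_encint: "length (encint k) = nat \<bar>k\<bar> + 2"
  by (simp add: encint_def)

lemma replicate_prefix:
  "replicate m True @ False # xs = replicate n True @ False # ys \<Longrightarrow> m = n \<and> xs = ys"
proof (induction m arbitrary: n)
  case 0 then show ?case by (cases n) simp_all
next
  case (Suc m)
  then obtain n' where "n = Suc n'" by (cases n) simp_all
  then show ?case using Suc.IH[of n'] Suc.prems by simp
qed

lemma encint_prefix: "encint k @ xs = encint l @ ys \<Longrightarrow> k = l \<and> xs = ys"
proof -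
  assume "encint k @ xs = encint l @ ys"
  then have sgn: "(k < 0) = (l < 0)"
    and "replicate (nat \<bar>k\<bar>) True @ False # xs = replicate (nat \<bar>l\<bar>) True @ False # ys"
    by (simp_all add: encint_def)
  from replicate_prefix[OF this(2)] have "nat \<bar>k\<bar> = nat \<bar>l\<bar>" "xs = ys" by blast+
  then show ?thesis using sgn by linarith
qed

text \<open>Prefix-freeness, stated with arbitrary tails so that the induction passes through the
  concatenated codes of the two subtrees.\<close>

lemma enc_prefix: "enc t @ xs = enc u @ ys \<Longrightarrow> t = u \<and> xs = ys"
proof (induction t arbitrary: u xs ys)
  case (Leaf k)
  then obtain k' where u: "u = Leaf k'" by (cases u) simp_all
  then have "encint k @ xs = encint k' @ ys" using Leaf.prems by simp
  from encint_prefix[OF this] show ?case using u by simp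
next
  case (Node k l r)
  from Node.prems obtain k' l' r' where u: "u = Node k' l' r'" by (cases u) simp_all
  then have "encint k @ (enc l @ enc r @ xs) = encint k' @ (enc l' @ enc r' @ ys)"
    using Node.prems by simp
  from encint_prefix[OF this] have *: "k = k'" "enc l @ enc r @ xs = enc l' @ enc r' @ ys" by blast+
  have **: "l = l'" "enc r @ xs = enc r' @ ys" using Node.IH(1)[OF *(2)] by blast+
  show ?case using Node.IH(2)[OF **(2)] * ** u by simp
qed

lemma card_ctree_le:
  "finite {t. length (enc t) \<le> L}" "card {t. length (enc t) \<le> L} \<le> 2^(L+1)"
proof -
  have inj: "inj_on enc {t. length (enc t) \<le> L}"
  proof (rule inj_onI)
    fix t u assume "enc t = enc u"
    then have "enc t @ [] = enc u @ []" by simp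
    then show "t = u" using enc_prefix by blast
  qed
  have sub: "enc ` {t. length (enc t) \<le> L} \<subseteq> {xs. set xs \<subseteq> UNIV \<and> length xs \<le> L}" by auto
  have fin: "finite {xs::bool list. set xs \<subseteq> UNIV \<and> length xs \<le> L}"
    by (rule finite_lists_length_le) simp
  show "finite {t. length (enc t) \<le> L}" using inj sub fin by (meson finite_imageD finite_subset)
  have "card {t. length (enc t) \<le> L} \<le> card {xs::bool list. set xs \<subseteq> UNIV \<and> length xs \<le> L}"
    by (rule card_inj_on_le[OF inj sub fin])
  also have "\<dots> = (\<Sum>i\<le>L. 2^i)" by (subst card_lists_length_le) auto
  also have "\<dots> \<le> 2^(L+1)" by (induction L) auto
  finally show "card {t. length (enc t) \<le> L} \<le> 2^(L+1)" .
qed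

text \<open>The image of one representative per code word serves as a centre; surplus indices repeat
  the image of a fixed point \<open>b0\<close>.\<close>

lemma entropy_number_le_code:
  fixes code :: "'b \<Rightarrow> 'c"
  assumes "B \<noteq> {}" "\<And>b. b \<in> B \<Longrightarrow> T b \<in> X"
    and fin: "finite (code ` B)" "card (code ` B) \<le> 2^(n-1)"
    and close: "\<And>b b'. b \<in> B \<Longrightarrow> b' \<in> B \<Longrightarrow> code b = code b' \<Longrightarrow> d (T b) (T b') \<le> \<epsilon>"
    and "0 < \<epsilon>"
  shows "entropy_number X d (T ` B) n \<le> ereal \<epsilon>"
proof -
  obtain b0 where b0: "b0 \<in> B" using assms(1) by auto
  obtain h where h: "bij_betw h {0..<card (code ` B)} (code ` B)"
    using ex_bij_betw_nat_finite[OF fin(1)] by auto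
  define g where "g i = (if i < card (code ` B) then (SOME b. b \<in> B \<and> code b = h i) else b0)" for i
  have g: "g i \<in> B" "i < card (code ` B) \<Longrightarrow> code (g i) = h i" for i
  proof -
    have "\<exists>b. b \<in> B \<and> code b = h i" if "i < card (code ` B)"
    proof -
      have "h i \<in> code ` B" using bij_betwE[OF h] that by simp
      then show ?thesis by (metis imageE)
    qed
    from someI_ex[OF this] show "g i \<in> B" "i < card (code ` B) \<Longrightarrow> code (g i) = h i"
      using b0 by (auto simp: g_def)
  qed
  have "T ` B \<subseteq> (\<Union>i<2^(n-1). {x \<in> X. d (T (g i)) x \<le> \<epsilon>})"
  proof
    fix x assume "x \<in> T ` B"
    then obtain b where b: "b \<in> B" "x = T b" by auto
    then have "code b \<in> h ` {0..<card (code ` B)}" using bij_betw_imp_surj_on[OF h] by blast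
    then obtain i where i: "i < card (code ` B)" "code b = h i" by auto
    then have "d (T (g i)) (T b) \<le> \<epsilon>" using close g b by simp
    then show "x \<in> (\<Union>i<2^(n-1). {x \<in> X. d (T (g i)) x \<le> \<epsilon>})" using i fin(2) b assms(2) by auto
  qed
  then show ?thesis unfolding entropy_number_def
    using \<open>0 < \<epsilon>\<close> g(1) assms(2)
    by (intro INF_lower2[of \<epsilon>]) (auto intro!: exI[of _ "\<lambda>i. T (g i)"])
qed

text \<open>The code with k = (n - 1) div D fits into n - 1 bits, and n <= D (k + 1) <= 2 D k
  explains the factor sqrt(2 D). For n <= D no such k >= 1 exists, and a single ball of radius
  \<open>C\<close> does.\<close>

lemma entropy_rate:
  fixes d :: "'a \<Rightarrow> 'a \<Rightarrow> real"
  assumes B: "B \<noteq> {}" "\<And>b. b \<in> B \<Longrightarrow> T b \<in> X" and "0 < C" "1 \<le> D"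
    and codes: "\<And>k. 1 \<le> k \<Longrightarrow> \<exists>code :: 'b \<Rightarrow> 'c. finite (code ` B) \<and> card (code ` B) \<le> 2^(D*k) \<and>
      (\<forall>b\<in>B. \<forall>b'\<in>B. code b = code b' \<longrightarrow> d (T b) (T b') \<le> C / sqrt (real k))"
    and diam: "\<And>b b'. b \<in> B \<Longrightarrow> b' \<in> B \<Longrightarrow> d (T b) (T b') \<le> C"
    and "0 < n"
  shows "entropy_number X d (T ` B) n \<le> ereal (C * sqrt (2 * real D) * real n powr (-1/2))"
proof -
  have n: "real n powr (-1/2) = 1 / sqrt (real n)"
    using powr_minus[of "real n" "1/2"] powr_half_sqrt[of "real n"] by (simp add: inverse_eq_divide)
  show ?thesis
  proof (cases "n \<le> D")
    case True
    have "real n \<le> 2 * real D" using True by simp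
    then have "sqrt (real n) \<le> sqrt (2 * real D)" by (rule real_sqrt_le_mono)
    then have "1 \<le> sqrt (2 * real D) * (1 / sqrt (real n))" using \<open>0 < n\<close> by (simp add: divide_simps)
    then have le: "C \<le> C * sqrt (2 * real D) * real n powr (-1/2)"
      unfolding n using \<open>0 < C\<close> mult_left_mono[of 1 "sqrt (2 * real D) * (1 / sqrt (real n))" C] by (simp add: mult.assoc)
    have "entropy_number X d (T ` B) n \<le> ereal C"
    proof (rule entropy_number_le_code[OF B, where code = "\<lambda>_. 0::nat"])
      show "finite ((\<lambda>_. 0::nat) ` B)" by (simp add: image_constant_conv)
      show "card ((\<lambda>_. 0::nat) ` B) \<le> 2^(n-1)" by (simp add: image_constant_conv)
    qed (rule diam \<open>0 < C\<close> | assumption)+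
    also have "ereal C \<le> ereal (C * sqrt (2 * real D) * real n powr (-1/2))" using le by simp
    finally show ?thesis .
  next
    case False
    define k where "k = (n - 1) div D"
    have "D div D \<le> k" unfolding k_def by (rule div_le_mono) (use False in simp)
    then have "1 \<le> k" using \<open>1 \<le> D\<close> by simp
    obtain code :: "'b \<Rightarrow> 'c" where code: "finite (code ` B)" "card (code ` B) \<le> 2^(D*k)"
      "\<forall>b\<in>B. \<forall>b'\<in>B. code b = code b' \<longrightarrow> d (T b) (T b') \<le> C / sqrt (real k)"
      using codes[OF \<open>1 \<le> k\<close>] by blast
    have "D * k \<le> n - 1" by (simp add: k_def)
    then have "(2::nat)^(D*k) \<le> 2^(n-1)" by (rule power_increasing) simp
    with code(2) have card: "card (code ` B) \<le> 2^(n-1)" by (rule order_trans)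
    have e: "entropy_number X d (T ` B) n \<le> ereal (C / sqrt (real k))"
    proof (intro entropy_number_le_code[OF B, where code = code])
      show "0 < C / sqrt (real k)" using \<open>0 < C\<close> \<open>1 \<le> k\<close> by simp
    qed (use code(1,3) card in blast)+
    have "n - 1 < D * (k + 1)"
      unfolding k_def using \<open>1 \<le> D\<close> dividend_less_times_div[of D "n - 1"] by simp
    then have "n \<le> D * (k + 1)" by linarith
    also have "\<dots> \<le> D * (2 * k)" using \<open>1 \<le> k\<close> by (intro mult_left_mono) auto
    finally have "real n \<le> real (D * (2 * k))" by (rule of_nat_mono)
    then have "sqrt (real n) \<le> sqrt (2 * real D) * sqrt (real k)"
      unfolding real_sqrt_mult[symmetric] by (intro real_sqrt_le_mono) (simp add: mult_ac)
    then have "1 / sqrt (real k) \<le> sqrt (2 * real D) * (1 / sqrt (real n))"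
      using \<open>1 \<le> k\<close> \<open>0 < n\<close> by (simp add: divide_simps)
    then have "C / sqrt (real k) \<le> C * sqrt (2 * real D) * real n powr (-1/2)"
      unfolding n using \<open>0 < C\<close> mult_left_mono[of "1 / sqrt (real k)" "sqrt (2 * real D) * (1 / sqrt (real n))" C] by (simp add: mult.assoc)
    then have "ereal (C / sqrt (real k)) \<le> ereal (C * sqrt (2 * real D) * real n powr (-1/2))" by simp
    with e show ?thesis by (rule order_trans)
  qed
qed

text \<open>As \<open>P\<close> need not be closed, a nearest point to \<open>F\<close> may fail to
  exist, so an almost nearest \<open>p\<close> is taken, with a = F - p. Moving from
  \<open>p\<close> a fraction \<open>t\<close> towards \<open>q\<close> cannot reduce the squared
  distance by more than t e; this gives <a, q - p> <= e <= |a|^2, hence <a, q> <= <a, F>.\<close>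

lemma separation_finite:
  fixes P :: "('i \<Rightarrow> real) set"
  assumes fin: "finite I" and ne: "P \<noteq> {}"
    and conv: "\<And>p q t. p \<in> P \<Longrightarrow> q \<in> P \<Longrightarrow> 0 \<le> t \<Longrightarrow> t \<le> 1 \<Longrightarrow> (\<lambda>i. p i + t * (q i - p i)) \<in> P"
    and bdd: "\<And>p i. p \<in> P \<Longrightarrow> i \<in> I \<Longrightarrow> \<bar>p i\<bar> \<le> M"
    and far: "\<And>p. p \<in> P \<Longrightarrow> e \<le> (\<Sum>i\<in>I. (F i - p i)\<^sup>2)" and "0 < e"
  shows "\<exists>a. (\<exists>i\<in>I. a i \<noteq> 0) \<and> (\<forall>q\<in>P. (\<Sum>i\<in>I. a i * q i) \<le> (\<Sum>i\<in>I. a i * F i))"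
proof -
  define S where "S p = (\<Sum>i\<in>I. (F i - p i)\<^sup>2)" for p
  define D where "D = real (card I) * (2 * M)\<^sup>2 + 1"
  define t where "t = min 1 (e / D)"
  have D: "0 < D" by (simp add: D_def add_nonneg_pos)
  have t: "0 < t" "t \<le> 1" "t * D \<le> e" using D \<open>0 < e\<close> by (auto simp: t_def min_def field_simps)
  have bb: "bdd_below (S ` P)" by (rule bdd_belowI[of _ 0]) (auto simp: S_def sum_nonneg)
  define s where "s = Inf (S ` P)"
  have "s < s + t * e" using t \<open>0 < e\<close> by simp
  then obtain p where p: "p \<in> P" "S p < s + t * e"
    using cInf_lessD[of "S ` P" "s + t * e"] ne unfolding s_def by auto
  define a where "a i = F i - p i" for i
  have Sp: "e \<le> S p" using far p(1) by (simp add: S_def)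
  have "(\<Sum>i\<in>I. a i * q i) \<le> (\<Sum>i\<in>I. a i * F i)" if q: "q \<in> P" for q
  proof -
    let ?X = "\<Sum>i\<in>I. a i * (q i - p i)" and ?Y = "\<Sum>i\<in>I. (q i - p i)\<^sup>2"
    have "s \<le> S (\<lambda>i. p i + t * (q i - p i))"
      unfolding s_def using conv[OF p(1) q] t by (intro cInf_lower bb) auto
    also have "\<dots> = (\<Sum>i\<in>I. (a i)\<^sup>2 - 2 * t * (a i * (q i - p i)) + t\<^sup>2 * (q i - p i)\<^sup>2)"
      unfolding S_def a_def by (intro sum.cong refl) (simp add: power2_eq_square algebra_simps)
    also have "\<dots> = S p - 2 * t * ?X + t\<^sup>2 * ?Y"
      by (simp add: S_def a_def sum.distrib sum_subtractf sum_distrib_left)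
    finally have 1: "2 * t * ?X \<le> t * e + t\<^sup>2 * ?Y" using p(2) by linarith
    have "?Y \<le> (\<Sum>i\<in>I. (2 * M)\<^sup>2)"
    proof (rule sum_mono)
      fix i assume "i \<in> I"
      then have "\<bar>q i - p i\<bar> \<le> 2 * M" using bdd[OF p(1), of i] bdd[OF q, of i] by linarith
      then show "(q i - p i)\<^sup>2 \<le> (2 * M)\<^sup>2" by (metis abs_ge_zero power2_abs power_mono)
    qed
    then have "?Y \<le> D" by (simp add: D_def)
    then have "t\<^sup>2 * ?Y \<le> t * (t * D)" using t by (simp add: power2_eq_square)
    also have "\<dots> \<le> t * e" using t by (intro mult_left_mono) auto
    finally have "2 * t * ?X \<le> 2 * t * e" using 1 by linarith
    then have "?X \<le> e" using t by simp
    moreover have "(\<Sum>i\<in>I. a i * F i) - (\<Sum>i\<in>I. a i * q i) = S p - ?X"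
      unfolding S_def sum_subtractf[symmetric] by (intro sum.cong refl) (simp add: a_def power2_eq_square algebra_simps)
    ultimately show ?thesis using Sp by linarith
  qed
  moreover have "\<exists>i\<in>I. a i \<noteq> 0"
  proof (rule ccontr)
    assume "\<not> ?thesis"
    then have "S p = 0" unfolding S_def by (intro sum.neutral) (auto simp: a_def)
    then show False using Sp \<open>0 < e\<close> by simp
  qed
  ultimately show ?thesis by blast
qed

section \<open>Codes for functions on the binary tree\<close>

lemma div_power_Suc: "(n::nat) div 2^Suc k = n div 2^k div 2"
  by (simp only: power_Suc2 div_mult2_eq)

lemma div_2_cases: "n div 2 = m \<Longrightarrow> n = 2*m \<or> n = 2*m+1" for n m :: nat
  by presburger

lemma div_power_child:
  fixes m' :: nat
  assumes "e \<le> d" "m' div 2^(Suc d - e) = m"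
  shows "m' div 2^(d-e) = 2*m \<or> m' div 2^(d-e) = 2*m+1"
proof -
  have "m' div 2^(Suc d - e) = m' div 2^(d-e) div 2"
    using assms(1) by (simp only: Suc_diff_le div_power_Suc)
  then show ?thesis using assms(2) by (intro div_2_cases) simp
qed

section \<open>Sums over all nodes of a subtree\<close>

fun tsum :: "(nat \<Rightarrow> nat \<Rightarrow> real) \<Rightarrow> nat \<Rightarrow> nat \<Rightarrow> real" where
  "tsum f 0 m = f 0 m"
| "tsum f (Suc d) m = f (Suc d) m + tsum f d (2*m) + tsum f d (2*m+1)"

lemma tsum_mono: "(\<And>e k. e \<le> d \<Longrightarrow> f e k \<le> g e k) \<Longrightarrow> tsum f d m \<le> tsum g d m"
proof (induction d arbitrary: m)
  case (Suc d)
  have "f (Suc d) m \<le> g (Suc d) m" using Suc.prems by simp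
  moreover have "tsum f d k \<le> tsum g d k" for k by (rule Suc.IH) (simp add: Suc.prems)
  ultimately show ?case by (simp add: add_mono)
qed simp

lemma tsum_cong: "(\<And>e k. e \<le> d \<Longrightarrow> f e k = g e k) \<Longrightarrow> tsum f d m = tsum g d m"
  by (intro antisym tsum_mono) auto

lemma tsum_add: "tsum (\<lambda>e k. f e k + g e k) d m = tsum f d m + tsum g d m"
  by (induction d arbitrary: m) auto

lemma tsum_cmult: "tsum (\<lambda>e k. c * f e k) d m = c * tsum f d m"
  by (induction d arbitrary: m) (auto simp: distrib_left)

lemma tsum_0 [simp]: "tsum (\<lambda>e k. 0) d m = 0"
  by (induction d arbitrary: m) auto

lemma tsum_nonneg: "(\<And>e k. e \<le> d \<Longrightarrow> 0 \<le> f e k) \<Longrightarrow> 0 \<le> tsum f d m"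
  using tsum_mono[of d "\<lambda>_ _. 0" f m] by simp

lemma tsum_eq_0D:
  assumes "tsum f d m = 0" "\<And>e k. e \<le> d \<Longrightarrow> 0 \<le> f e k" "e \<le> d" "k div 2^(d-e) = m"
  shows "f e k = 0"
  using assms
proof (induction d arbitrary: m)
  case (Suc d)
  have n: "0 \<le> tsum f d (2*m)" "0 \<le> tsum f d (2*m+1)" "0 \<le> f (Suc d) m"
    using Suc.prems(2) by (auto intro!: tsum_nonneg)
  have z: "f (Suc d) m = 0" "tsum f d (2*m) = 0" "tsum f d (2*m+1) = 0"
    using Suc.prems(1) n unfolding tsum.simps by linarith+
  show ?case
  proof (cases "e = Suc d")
    case True then show ?thesis using Suc.prems z by simp
  next
    case False
    then have "e \<le> d" using Suc.prems by simp
    then show ?thesis using div_power_child[OF _ Suc.prems(4)] Suc.IH[of "2*m"] Suc.IH[of "2*m+1"] z Suc.prems(2)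
      by (metis le_SucI)
  qed
qed simp

lemma tsum_single_le:
  assumes "0 \<le> c" shows "tsum (\<lambda>e k. if e = d0 \<and> k = m0 then c else 0) d m \<le> c"
proof -
  have "tsum (\<lambda>e k. if e = d0 \<and> k = m0 then c else 0) d m = (if d0 \<le> d \<and> m0 div 2^(d-d0) = m then c else 0)"
  proof (induction d arbitrary: m)
    case 0 then show ?case by auto
  next
    case (Suc d)
    consider "d0 = Suc d" | "Suc d < d0" | "d0 \<le> d" by linarith
    then show ?case
    proof cases
      case 3
      have eq: "m0 div 2^(Suc d - d0) = m0 div 2^(d-d0) div 2"
        using 3 by (simp only: Suc_diff_le div_power_Suc)
      show ?thesis unfolding tsum.simps Suc.IH eq using 3 by auto
    next
      case 1 then show ?thesis unfolding tsum.simps Suc.IH by auto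
    next
      case 2 then show ?thesis unfolding tsum.simps Suc.IH by auto
    qed
  qed
  then show ?thesis using assms by simp
qed

lemma path_le_tsum:
  assumes "\<And>e k. 0 \<le> f e k"
  shows "(\<Sum>e\<le>d. f e (i div 2^e)) \<le> tsum f d (i div 2^d)"
proof (induction d)
  case (Suc d)
  have "i div 2^d div 2 = i div 2^Suc d" by (simp only: div_power_Suc)
  then have "i div 2^d = 2 * (i div 2^Suc d) \<or> i div 2^d = 2 * (i div 2^Suc d) + 1" by (rule div_2_cases)
  moreover have "0 \<le> tsum f d k" for k using assms by (rule tsum_nonneg)
  ultimately have "tsum f d (i div 2^d) \<le> tsum f d (2 * (i div 2^Suc d)) + tsum f d (2 * (i div 2^Suc d) + 1)"
    by (metis add_increasing add_increasing2 order_refl)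
  then show ?case using Suc by simp
qed simp

lemma has_bochner_integral_tsum:
  assumes "\<And>e k. e \<le> d \<Longrightarrow> has_bochner_integral M (\<lambda>x. f x e k) (g e k)"
  shows "has_bochner_integral M (\<lambda>x. tsum (f x) d m) (tsum g d m)"
  using assms
proof (induction d arbitrary: m)
  case (Suc d)
  then show ?case unfolding tsum.simps
    by (intro has_bochner_integral_add) auto
qed simp

text \<open>The floor of a + x jumps from that of a to the next integer at x = 1 -
  \<open>frac a\<close>, so over [0, 1) its mean is the floor of a plus
  \<open>frac a\<close>.\<close>

lemma has_bochner_integral_floor_shift:
  "has_bochner_integral lborel (\<lambda>x. indicator {0..<1} x * real_of_int \<lfloor>a + x\<rfloor>) a"
proof -
  have fl: "real_of_int \<lfloor>a + x\<rfloor> = real_of_int \<lfloor>a\<rfloor> + indicator {1 - frac a..<1} x" if "0 \<le> x" "x < 1" for x :: real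
  proof (cases "1 - frac a \<le> x")
    case True
    then have "\<lfloor>a + x\<rfloor> = \<lfloor>a\<rfloor> + 1"
      using that frac_lt_1[of a] unfolding frac_def by (intro floor_unique) auto
    then show ?thesis using True that by simp
  next
    case False
    then have "\<lfloor>a + x\<rfloor> = \<lfloor>a\<rfloor>"
      using that unfolding frac_def by (intro floor_unique) (auto intro: order_trans[OF of_int_floor_le])
    then show ?thesis using False that by simp
  qed
  have m: "measure lborel {0..<1::real} = 1" "measure lborel {1 - frac a..<1} = frac a"
    using frac_ge_0[of a] by auto
  have i: "has_bochner_integral lborel (indicator S :: real \<Rightarrow> real) (measure lborel S)"
    if "S = {u..<v}" for S and u v :: real
    unfolding that by (rule has_bochner_integral_real_indicator) (use emeasure_bounded_finite[of "{u..<v}"] in auto)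
  have "has_bochner_integral lborel (\<lambda>x. real_of_int \<lfloor>a\<rfloor> * indicator {0..<1} x + indicator {1 - frac a..<1} x) (real_of_int \<lfloor>a\<rfloor> * 1 + frac a)"
    using i[OF refl, of 0 1] i[OF refl, of "1 - frac a" 1] m
    by (intro has_bochner_integral_add has_bochner_integral_mult_right) auto
  also have "(\<lambda>x. real_of_int \<lfloor>a\<rfloor> * indicator {0..<1} x + indicator {1 - frac a..<1} x) = (\<lambda>x. indicator {0..<1} x * real_of_int \<lfloor>a + x\<rfloor>)"
    using frac_lt_1[of a] by (auto simp: fun_eq_iff indicator_def fl)
  finally show ?thesis by (simp add: frac_def)
qed

text \<open>Since the floor is monotone, the difference has the same sign for all shifts, so the
  absolute value commutes with the mean.\<close>

lemma has_bochner_integral_floor_diff: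
  "has_bochner_integral lborel (\<lambda>x. indicator {0..<1} x * \<bar>real_of_int \<lfloor>a + x\<rfloor> - real_of_int \<lfloor>b + x\<rfloor>\<bar>) \<bar>a - b\<bar>"
proof -
  have *: "has_bochner_integral lborel (\<lambda>x. indicator {0..<1} x * \<bar>real_of_int \<lfloor>a + x\<rfloor> - real_of_int \<lfloor>b + x\<rfloor>\<bar>) \<bar>a - b\<bar>"
    if "b \<le> a" for a b
  proof -
    have "has_bochner_integral lborel (\<lambda>x. indicator {0..<1} x * real_of_int \<lfloor>a + x\<rfloor> - indicator {0..<1} x * real_of_int \<lfloor>b + x\<rfloor>) (a - b)"
      by (intro has_bochner_integral_diff has_bochner_integral_floor_shift)
    moreover have "indicator {0..<1} x * real_of_int \<lfloor>a + x\<rfloor> - indicator {0..<1} x * real_of_int \<lfloor>b + x\<rfloor> = indicator {0..<1} x * \<bar>real_of_int \<lfloor>a + x\<rfloor> - real_of_int \<lfloor>b + x\<rfloor>\<bar>" for x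
      using floor_mono[of "b + x" "a + x"] that by (simp add: algebra_simps)
    ultimately show ?thesis using that by simp
  qed
  show ?thesis using *[of a b] *[of b a] by (cases "b \<le> a") (simp_all add: abs_minus_commute)
qed

context dyadic
begin

section \<open>Codes for nonnegative mass distributions\<close>

definition incr :: "nat \<Rightarrow> (nat \<Rightarrow> real) \<Rightarrow> nat \<Rightarrow> nat \<Rightarrow> int" where
  "incr k a d m = \<lfloor>real k * sum a {..<(m+1) * 2^d}\<rfloor> - \<lfloor>real k * sum a {..<m * 2^d}\<rfloor>"

lemma incr_Suc: "incr k a (Suc d) m = incr k a d (2*m) + incr k a d (2*m+1)"
proof -
  have "(m+1) * 2^Suc d = (2*m+1+1) * 2^d" "m * 2^Suc d = 2*m*2^d" by simp_all
  then show ?thesis unfolding incr_def by (simp only:)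
qed

lemma blk_prefix: "sum a {..<(m+1) * 2^d} - sum a {..<m * 2^d} = blk a d m"
proof -
  have "sum a {0..<m * 2^d} + sum a {m * 2^d..<(m+1) * 2^d} = sum a {0..<(m+1) * 2^d}"
    by (rule sum.atLeastLessThan_concat) auto
  then show ?thesis by (simp add: blk_def lessThan_atLeast0)
qed

lemma incr_close:
  assumes "incr k a d m = incr k a' d m"
  shows "\<bar>real k * blk a d m - real k * blk a' d m\<bar> \<le> 2"
proof -
  have *: "\<bar>real k * blk b d m - real_of_int (incr k b d m)\<bar> \<le> 1" for b
  proof -
    have "real k * blk b d m = real k * sum b {..<(m+1) * 2^d} - real k * sum b {..<m * 2^d}"
      unfolding blk_prefix[symmetric] by (simp add: right_diff_distrib)
    then show ?thesis unfolding incr_def of_int_diff by linarith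
  qed
  show ?thesis using *[of a] *[of a'] unfolding assms by linarith
qed

lemma incr_nonneg:
  assumes "\<And>i. 0 \<le> a i" shows "0 \<le> incr k a d m"
proof -
  have "sum a {..<m * 2^d} \<le> sum a {..<(m+1) * 2^d}" using assms by (intro sum_mono2) auto
  then have "real k * sum a {..<m * 2^d} \<le> real k * sum a {..<(m+1) * 2^d}" by (rule mult_left_mono) simp
  then show ?thesis unfolding incr_def using floor_mono by (simp add: floor_mono)
qed

text \<open>Increments of a rounded prefix sum serve as labels, so that rounding errors do not accumulate
  over the leaves below a node.\<close>

fun mcode :: "nat \<Rightarrow> (nat \<Rightarrow> real) \<Rightarrow> nat \<Rightarrow> nat \<Rightarrow> ctree" where
  "mcode k a 0 m = Leaf (incr k a 0 m)"
| "mcode k a (Suc d) m = (if real k * blk a (Suc d) m > lev (Suc d)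
     then Node 0 (mcode k a d (2*m)) (mcode k a d (2*m+1)) else Leaf (incr k a (Suc d) m))"

lemma mcode_incr: "mcode k a d m = mcode k a' d m \<Longrightarrow> incr k a d m = incr k a' d m"
proof (induction d arbitrary: m)
  case (Suc d)
  show ?case
  proof (cases "real k * blk a (Suc d) m > lev (Suc d)")
    case True
    with Suc.prems have "real k * blk a' (Suc d) m > lev (Suc d)" by (auto split: if_splits)
    with True Suc.prems have "mcode k a d (2*m) = mcode k a' d (2*m)" "mcode k a d (2*m+1) = mcode k a' d (2*m+1)" by simp_all
    then show ?thesis unfolding incr_Suc using Suc.IH by metis
  next
    case False
    with Suc.prems show ?thesis by (auto split: if_splits)
  qed
qed simp

text \<open>At a node reached by the code the rounded increments agree, also at inner nodes by
  additivity, so the error is at most 2 <= \<open>lev\<close>. Below a cut both masses lie between 0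
  and the threshold of the cut node, and \<open>lev\<close> only increases downwards.\<close>

lemma mcode_close:
  assumes "mcode k a d m = mcode k a' d m" "\<And>i. 0 \<le> a i" "\<And>i. 0 \<le> a' i" "d \<le> J"
    and "e \<le> d" "m' div 2^(d-e) = m"
  shows "\<bar>real k * blk a e m' - real k * blk a' e m'\<bar> \<le> lev e"
  using assms(1,4-)
proof (induction d arbitrary: m)
  case 0
  then show ?case using incr_close[OF mcode_incr[OF 0(1)]] lev_ge2[of 0] by simp
next
  case (Suc d)
  have l: "lev e \<ge> 2" using lev_ge2[of e] Suc.prems by simp
  show ?case
  proof (cases "e = Suc d")
    case True
    then show ?thesis using incr_close[OF mcode_incr[OF Suc.prems(1)]] Suc.prems l by simp
  next
    case False
    then have ed: "e \<le> d" using Suc.prems by simp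
    show ?thesis
    proof (cases "real k * blk a (Suc d) m > lev (Suc d)")
      case True
      with Suc.prems have "real k * blk a' (Suc d) m > lev (Suc d)" by (auto split: if_splits)
      with True Suc.prems have "mcode k a d (2*m) = mcode k a' d (2*m)" "mcode k a d (2*m+1) = mcode k a' d (2*m+1)" by simp_all
      then show ?thesis
        using div_power_child[OF ed Suc.prems(4)] Suc.IH[of "2*m"] Suc.IH[of "2*m+1"] ed Suc.prems(2) by auto
    next
      case F: False
      with Suc.prems have F': "\<not> real k * blk a' (Suc d) m > lev (Suc d)" by (auto split: if_splits)
      have "real k * blk a e m' \<le> lev (Suc d)" "real k * blk a' e m' \<le> lev (Suc d)"
        using F F' blk_mono_mem[of a, OF assms(2) Suc.prems(3,4)] blk_mono_mem[of a', OF assms(3) Suc.prems(3,4)]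
          mult_left_mono[of "blk a e m'" "blk a (Suc d) m" "real k"] mult_left_mono[of "blk a' e m'" "blk a' (Suc d) m" "real k"]
        by linarith+
      moreover have "0 \<le> real k * blk a e m'" "0 \<le> real k * blk a' e m'"
        using blk_nonneg[of a, OF assms(2)] blk_nonneg[of a', OF assms(3)] by simp_all
      ultimately show ?thesis using lev_mono[of e "Suc d"] Suc.prems(3) by linarith
    qed
  qed
qed

lemma lev_ge': "d \<le> J \<Longrightarrow> lev d \<ge> 2 + 2/3 * real (J - d)"
proof -
  assume "d \<le> J"
  moreover have "real (J - d) * (2/3) \<le> real (J - d) * ln 2"
    using ln2_ge_two_thirds by (intro mult_left_mono) auto
  ultimately show ?thesis using lev_ge[of d] by linarith
qed

text \<open>A \<open>Node\<close> with one additional \<open>Leaf\<close> costs 6 bits apart from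
  the label, and a heavy child, being one step deeper, has 6 more in its reserve 6 (J - d). If no
  child is heavy, the threshold gives 9 k mass > 9 \<open>lev\<close> >= 18 + 6 depth, which is why
  9 = 6 / (2/3) is the right factor.\<close>

lemma length_mcode:
  assumes "\<And>i. 0 \<le> a i" "d \<le> J"
  shows "real (length (enc (mcode k a d m))) \<le> 3 + real_of_int (incr k a d m) +
    (if 0 < d \<and> real k * blk a d m > lev d then 9 * (real k * blk a d m) - 6 * real (J - d) else 0)"
  using assms(2)
proof (induction d arbitrary: m)
  case 0
  then show ?case using incr_nonneg[of a, OF assms(1), of k 0 m] by (simp add: length_encint)
next
  case (Suc d)
  let ?A = "real k * blk a (Suc d) m"
  show ?case
  proof (cases "?A > lev (Suc d)")
    case False
    then show ?thesis using incr_nonneg[of a, OF assms(1), of k "Suc d" m] by (simp add: length_encint)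
  next
    case True
    define x where "x c = (if 0 < d \<and> real k * blk a d c > lev d then 9 * (real k * blk a d c) - 6 * real (J - d) else 0)" for c
    have IH: "real (length (enc (mcode k a d c))) \<le> 3 + real_of_int (incr k a d c) + x c" for c
      unfolding x_def using Suc.IH[of c] Suc.prems by simp
    have A: "?A = real k * blk a d (2*m) + real k * blk a d (2*m+1)" by (simp add: blk_Suc distrib_left)
    have pos: "0 \<le> real k * blk a d c" for c using blk_nonneg[of a, OF assms(1)] by simp
    have Jd: "real (J - d) = real (J - Suc d) + 1" using Suc.prems by (simp add: of_nat_diff)
    have "9 * lev (Suc d) \<ge> 18 + 6 * real (J - Suc d)" using lev_ge'[OF Suc.prems] by simp
    then have "6 + x (2*m) + x (2*m+1) \<le> 9 * ?A - 6 * real (J - Suc d)"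
    proof -
      have x: "x c = 0 \<or> x c = 9 * (real k * blk a d c) - 6 * real (J - Suc d) - 6" for c
        by (simp add: x_def Jd)
      have "0 \<le> real (J - Suc d)" by simp
      then show ?thesis
          using x[of "2*m"] x[of "2*m+1"] True A pos[of "2*m"] pos[of "2*m+1"] \<open>9 * lev (Suc d) \<ge> 18 + 6 * real (J - Suc d)\<close>
        by (elim disjE) linarith+
    qed
    moreover have "real (length (enc (mcode k a (Suc d) m))) = 3 + real (length (enc (mcode k a d (2*m)))) + real (length (enc (mcode k a d (2*m+1))))"
      using True by (simp add: length_encint)
    moreover have "real_of_int (incr k a (Suc d) m) = real_of_int (incr k a d (2*m)) + real_of_int (incr k a d (2*m+1))"
      by (simp add: incr_Suc)
    ultimately have "real (length (enc (mcode k a (Suc d) m))) \<le> 3 + real_of_int (incr k a (Suc d) m) + (9 * ?A - 6 * real (J - Suc d))"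
      using IH[of "2*m"] IH[of "2*m+1"] by linarith
    then show ?thesis using True by simp
  qed
qed

lemma length_mcode_root:
  assumes "\<And>i. 0 \<le> a i" "(\<Sum>i<2^J. a i) \<le> 1"
  shows "length (enc (mcode k a J 0)) \<le> 3 + 10 * k"
proof -
  have b: "blk a J 0 = (\<Sum>i<2^J. a i)" by (simp add: blk_def lessThan_atLeast0)
  have k: "real k * blk a J 0 \<le> real k" "0 \<le> real k * blk a J 0"
    using assms mult_left_mono[of "blk a J 0" 1 "real k"] mult_nonneg_nonneg[OF _ blk_nonneg[of a, OF assms(1)], of "real k" J 0] unfolding b by simp_all
  have "real_of_int (incr k a J 0) \<le> real k * blk a J 0" by (simp add: incr_def b)
  then have "real (length (enc (mcode k a J 0))) \<le> 3 + 10 * real k"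
    using length_mcode[of a, OF assms(1) order_refl, of k 0] k by (auto split: if_splits)
  then show ?thesis by linarith
qed

section \<open>Path sums, their rounding and their codes\<close>

definition path :: "(nat \<Rightarrow> nat \<Rightarrow> real) \<Rightarrow> nat \<Rightarrow> nat \<Rightarrow> real" where
  "path y d m = (\<Sum>e\<in>{d..J}. y e (m div 2^(e-d)))"

lemma path_J: "path y J m = y J m" by (simp add: path_def)

lemma path_Suc: assumes "d < J" shows "path y d m = y d m + path y (Suc d) (m div 2)"
proof -
  have "{d..J} = insert d {Suc d..J}" using assms by auto
  moreover have "y e (m div 2^(e-d)) = y e (m div 2 div 2^(e - Suc d))" if "e \<in> {Suc d..J}" for e
  proof -
    have "e - d = Suc (e - Suc d)" using that by auto
    then show ?thesis by (simp only: power_Suc div_mult2_eq)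
  qed
  then have "(\<Sum>e\<in>{Suc d..J}. y e (m div 2^(e-d))) = (\<Sum>e\<in>{Suc d..J}. y e (m div 2 div 2^(e - Suc d)))"
    by (rule sum.cong[OF refl])
  ultimately show ?thesis by (simp add: path_def)
qed

lemma path_0: "path y 0 i = (\<Sum>e\<le>J. y e (i div 2^e))"
  by (simp add: path_def atLeast0AtMost)

text \<open>Rounding all path sums down on a randomly shifted integer grid changes each increment
  \<open>y d m\<close> to an integer whose absolute value has expectation \<open>\<bar>y d m\<bar>\<close>.\<close>

lemma rounding:
  assumes "tsum (\<lambda>d m. lev d * \<bar>y d m\<bar>) J 0 \<le> R"
  shows "\<exists>\<kappa> :: nat \<Rightarrow> nat \<Rightarrow> int. tsum (\<lambda>d m. lev d * \<bar>real_of_int (\<kappa> d m)\<bar>) J 0 \<le> R + 1 \<and>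
    (\<forall>i. \<bar>path y 0 i - path (\<lambda>d m. real_of_int (\<kappa> d m)) 0 i\<bar> \<le> 1)"
proof -
  \<comment> \<open>The path sum of the parent, with 0 above the root, so that every
    \<open>y d m\<close> is a difference of two path sums.\<close>
  define par where "par d m = (if d < J then path y (Suc d) (m div 2) else 0)" for d m
  define \<kappa> where "\<kappa> x d m = \<lfloor>path y d m + x\<rfloor> - \<lfloor>par d m + x\<rfloor>" for x d m
  define G where "G x = tsum (\<lambda>d m. lev d * \<bar>real_of_int (\<kappa> x d m)\<bar>) J 0" for x
  have y: "y d m = path y d m - par d m" if "d \<le> J" for d m
    using that path_Suc[of d y m] path_J[of y m] by (cases "d = J") (auto simp: par_def)
  have "has_bochner_integral lborel (\<lambda>x. tsum (\<lambda>d m. lev d * (indicator {0..<1} x * \<bar>real_of_int \<lfloor>path y d m + x\<rfloor> - real_of_int \<lfloor>par d m + x\<rfloor>\<bar>)) J 0)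
      (tsum (\<lambda>d m. lev d * \<bar>path y d m - par d m\<bar>) J 0)"
    by (intro has_bochner_integral_tsum has_bochner_integral_mult_right has_bochner_integral_floor_diff)
  moreover have "tsum (\<lambda>d m. lev d * (indicator {0..<1} x * \<bar>real_of_int \<lfloor>path y d m + x\<rfloor> - real_of_int \<lfloor>par d m + x\<rfloor>\<bar>)) J 0 = indicator {0..<1} x * G x" for x
    unfolding G_def tsum_cmult[symmetric] by (rule tsum_cong) (simp add: \<kappa>_def)
  moreover have "tsum (\<lambda>d m. lev d * \<bar>path y d m - par d m\<bar>) J 0 = tsum (\<lambda>d m. lev d * \<bar>y d m\<bar>) J 0"
    by (rule tsum_cong) (simp add: y)
  ultimately have int: "has_bochner_integral lborel (\<lambda>x. indicator {0..<1} x * G x) (tsum (\<lambda>d m. lev d * \<bar>y d m\<bar>) J 0)"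
    by simp
  \<comment> \<open>The mean of \<open>G\<close> over [0, 1) is at most R. The slack 1 lets a
    non-strict comparison of integrals finish the argument.\<close>
  have "\<exists>x. 0 \<le> x \<and> x < 1 \<and> G x \<le> R + 1"
  proof (rule ccontr)
    assume "\<not> ?thesis"
    then have big: "R + 1 \<le> G x" if "0 \<le> x" "x < 1" for x using that by force
    have c: "has_bochner_integral lborel (\<lambda>x::real. indicator {0..<1} x * (R + 1)) (1 * (R + 1))"
    proof -
      have "has_bochner_integral lborel (indicator {0..<1} :: real \<Rightarrow> real) (measure lborel {0..<1::real})"
        by (rule has_bochner_integral_real_indicator) (use emeasure_bounded_finite[of "{0..<1::real}"] in auto)
      then show ?thesis by (intro has_bochner_integral_mult_left) auto
    qed
    have "1 * (R + 1) \<le> tsum (\<lambda>d m. lev d * \<bar>y d m\<bar>) J 0"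
    proof -
      have "(LINT x::real|lborel. indicator {0..<1} x * (R + 1)) \<le> (LINT x|lborel. indicator {0..<1} x * G x)"
        by (rule integral_mono) (use c int big in \<open>auto simp: has_bochner_integral_iff indicator_def\<close>)
      then show ?thesis using c int by (simp add: has_bochner_integral_iff)
    qed
    then show False using assms by simp
  qed
  then obtain x where x: "0 \<le> x" "x < 1" "G x \<le> R + 1" by auto
  \<comment> \<open>The integer increments telescope down from the root, where the floor of 0 + x is
    0.\<close>
  have fl: "path (\<lambda>d m. real_of_int (\<kappa> x d m)) d m = real_of_int \<lfloor>path y d m + x\<rfloor>" if "d \<le> J" for d m
    using that
  proof (induction d arbitrary: m rule: inc_induct)
    case base
    have "\<lfloor>x\<rfloor> = 0" using x by (simp add: floor_eq_iff)
    then show ?case by (simp add: path_J \<kappa>_def par_def)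
  next
    case (step d)
    then show ?case using path_Suc[of d "\<lambda>d m. real_of_int (\<kappa> x d m)" m] by (simp add: \<kappa>_def par_def)
  qed
  have "\<bar>path y 0 i - path (\<lambda>d m. real_of_int (\<kappa> x d m)) 0 i\<bar> \<le> 1" for i
    unfolding fl[OF le0] using x by linarith
  then show ?thesis using x(3) unfolding G_def by blast
qed

definition cost :: "(nat \<Rightarrow> nat \<Rightarrow> int) \<Rightarrow> nat \<Rightarrow> nat \<Rightarrow> real" where
  "cost \<kappa> = tsum (\<lambda>d m. lev d * \<bar>real_of_int (\<kappa> d m)\<bar>)"

lemma cost_nonneg: "d \<le> J \<Longrightarrow> 0 \<le> cost \<kappa> d m"
  unfolding cost_def using lev_ge2 by (intro tsum_nonneg mult_nonneg_nonneg) (auto intro: order_trans[of 0 2])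

lemma cost_0D:
  assumes "cost \<kappa> d m = 0" "d \<le> J" "e \<le> d" "k div 2^(d-e) = m" shows "\<kappa> e k = 0"
proof -
  have l: "lev e \<ge> 2" if "e \<le> d" for e using lev_ge2[of e] that assms(2) by simp
  have "lev e * \<bar>real_of_int (\<kappa> e k)\<bar> = 0"
    by (rule tsum_eq_0D[where f = "\<lambda>d m. lev d * \<bar>real_of_int (\<kappa> d m)\<bar>", OF assms(1)[unfolded cost_def] _ assms(3,4)])
      (use l in \<open>auto intro!: mult_nonneg_nonneg intro: order_trans[of 0 2]\<close>)
  then show ?thesis using l[OF assms(3)] by simp
qed

text \<open>As \<open>lev\<close> is positive, zero cost means that all values in the subtree
  vanish; cutting there loses nothing, so unlike \<open>mcode\<close> this code is exact.\<close>

fun ycode :: "(nat \<Rightarrow> nat \<Rightarrow> int) \<Rightarrow> nat \<Rightarrow> nat \<Rightarrow> ctree" where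
  "ycode \<kappa> 0 m = Leaf (\<kappa> 0 m)"
| "ycode \<kappa> (Suc d) m = (if cost \<kappa> d (2*m) = 0 \<and> cost \<kappa> d (2*m+1) = 0 then Leaf (\<kappa> (Suc d) m)
     else Node (\<kappa> (Suc d) m) (ycode \<kappa> d (2*m)) (ycode \<kappa> d (2*m+1)))"

lemma ycode_eq:
  assumes "ycode \<kappa> d m = ycode \<kappa>' d m" "d \<le> J" "e \<le> d" "k div 2^(d-e) = m"
  shows "\<kappa> e k = \<kappa>' e k"
  using assms
proof (induction d arbitrary: m)
  case 0 then show ?case by simp
next
  case (Suc d)
  show ?case
  proof (cases "e = Suc d")
    case True
    then show ?thesis using Suc.prems by (auto split: if_splits)
  next
    case False
    then have e: "e \<le> d" using Suc.prems by simp
    note k = div_power_child[OF e Suc.prems(4)]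
    have dJ: "d \<le> J" using Suc.prems by simp
    show ?thesis
    proof (cases "cost \<kappa> d (2*m) = 0 \<and> cost \<kappa> d (2*m+1) = 0")
      case True
      with Suc.prems(1) have "cost \<kappa>' d (2*m) = 0 \<and> cost \<kappa>' d (2*m+1) = 0" by (simp split: if_splits)
      then show ?thesis using True k cost_0D[OF _ dJ e] by metis
    next
      case F: False
      with Suc.prems(1) have "\<not> (cost \<kappa>' d (2*m) = 0 \<and> cost \<kappa>' d (2*m+1) = 0)" by (auto split: if_splits)
      with F Suc.prems(1) have "ycode \<kappa> d (2*m) = ycode \<kappa>' d (2*m)" "ycode \<kappa> d (2*m+1) = ycode \<kappa>' d (2*m+1)"
        by (simp_all only: ycode.simps if_False ctree.inject)
      then show ?thesis using k Suc.IH[OF _ dJ e] by metis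
    qed
  qed
qed

lemma ycode_path:
  assumes "ycode \<kappa> J 0 = ycode \<kappa>' J 0" "i < 2^J"
  shows "path (\<lambda>d m. real_of_int (\<kappa> d m)) 0 i = path (\<lambda>d m. real_of_int (\<kappa>' d m)) 0 i"
  unfolding path_0
proof (intro sum.cong refl arg_cong[where f = real_of_int])
  fix e assume e: "e \<in> {..J}"
  have "i div 2^e div 2^(J-e) = 0"
    using assms(2) e by (simp add: div_mult2_eq[symmetric] power_add[symmetric])
  then show "\<kappa> e (i div 2^e) = \<kappa>' e (i div 2^e)"
    using ycode_eq[OF assms(1) order_refl] e by simp
qed

text \<open>As in \<open>length_mcode\<close>, 6 bits per level of a branch are paid by the reserve
  6 (J - d). A nonzero label of size s costs at least s \<open>lev\<close>, and 16
  \<open>lev\<close> >= 32 + 6 depth covers both its unary code and the branch leading to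
  it.\<close>

lemma length_ycode:
  assumes "d \<le> J"
  shows "real (length (enc (ycode \<kappa> d m))) \<le> 3 + (if cost \<kappa> d m = 0 then 0 else 16 * cost \<kappa> d m - 6 * real (J - d))"
  using assms
proof (induction d arbitrary: m)
  case 0
  have l: "16 * lev 0 \<ge> 32 + 6 * real J" using lev_ge'[of 0] by simp
  show ?case
  proof (cases "\<kappa> 0 m = 0")
    case False
    then have "1 \<le> \<bar>real_of_int (\<kappa> 0 m)\<bar>" by linarith
    then have "1 * (16 * lev 0 - 1) \<le> \<bar>real_of_int (\<kappa> 0 m)\<bar> * (16 * lev 0 - 1)" using l by (intro mult_right_mono) auto
    then have "\<bar>real_of_int (\<kappa> 0 m)\<bar> \<le> 16 * (lev 0 * \<bar>real_of_int (\<kappa> 0 m)\<bar>) - 6 * real J"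
      using l by (simp add: algebra_simps)
    moreover have "cost \<kappa> 0 m = lev 0 * \<bar>real_of_int (\<kappa> 0 m)\<bar>" "lev 0 \<noteq> 0" using l by (auto simp: cost_def)
    ultimately show ?thesis using False by (simp add: length_encint)
  qed (simp add: length_encint cost_def)
next
  case (Suc d)
  let ?k = "\<bar>real_of_int (\<kappa> (Suc d) m)\<bar>"
  have dJ: "d \<le> J" using Suc.prems by simp
  have l: "16 * lev (Suc d) \<ge> 32 + 6 * real (J - Suc d)" using lev_ge'[OF Suc.prems] by simp
  have Jd: "real (J - d) = real (J - Suc d) + 1" using Suc.prems by (simp add: of_nat_diff)
  have c: "cost \<kappa> (Suc d) m = lev (Suc d) * ?k + cost \<kappa> d (2*m) + cost \<kappa> d (2*m+1)"
    by (simp add: cost_def)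
  have n: "0 \<le> cost \<kappa> d (2*m)" "0 \<le> cost \<kappa> d (2*m+1)" using cost_nonneg[OF dJ] by auto
  show ?case
  proof (cases "cost \<kappa> d (2*m) = 0 \<and> cost \<kappa> d (2*m+1) = 0")
    case z: True
    then have len: "real (length (enc (ycode \<kappa> (Suc d) m))) = 3 + ?k" by (simp add: length_encint)
    show ?thesis
    proof (cases "\<kappa> (Suc d) m = 0")
      case False
      then have "1 \<le> ?k" by linarith
      then have "1 * (16 * lev (Suc d) - 1) \<le> ?k * (16 * lev (Suc d) - 1)" using l by (intro mult_right_mono) auto
      then have "?k \<le> 16 * (lev (Suc d) * ?k) - 6 * real (J - Suc d)"
        using l by (simp add: algebra_simps)
      moreover have "cost \<kappa> (Suc d) m = lev (Suc d) * ?k" "lev (Suc d) \<noteq> 0" using l z c by auto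
      ultimately show ?thesis unfolding len using False by simp
    next
      case True
      then have "cost \<kappa> (Suc d) m = 0" using c z by simp
      then show ?thesis unfolding len using True by simp
    qed
  next
    case False
    define x where "x u = (if cost \<kappa> d u = 0 then 0 else 16 * cost \<kappa> d u - 6 * real (J - d))" for u
    have x0: "cost \<kappa> d u = 0 \<Longrightarrow> x u = 0"
      and x1: "cost \<kappa> d u \<noteq> 0 \<Longrightarrow> x u = 16 * cost \<kappa> d u - 6 * real (J - Suc d) - 6" for u
      by (simp_all add: x_def Jd)
    have x2: "x u \<le> 16 * cost \<kappa> d u" for u
      using x0[of u] x1[of u] of_nat_0_le_iff[of "J - Suc d", where 'a = real] by fastforce
    have IH: "real (length (enc (ycode \<kappa> d u))) \<le> 3 + x u" for u
      unfolding x_def by (rule Suc.IH[OF dJ])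
    have "real (length (enc (ycode \<kappa> (Suc d) m))) = 3 + ?k + real (length (enc (ycode \<kappa> d (2*m)))) + real (length (enc (ycode \<kappa> d (2*m+1))))"
      unfolding ycode.simps if_not_P[OF False] by (simp add: length_encint)
    then have 1: "real (length (enc (ycode \<kappa> (Suc d) m))) \<le> 9 + ?k + x (2*m) + x (2*m+1)"
      using IH[of "2*m"] IH[of "2*m+1"] by linarith
    have 2: "6 + x (2*m) + x (2*m+1) \<le> 16 * (cost \<kappa> d (2*m) + cost \<kappa> d (2*m+1)) - 6 * real (J - Suc d)"
    proof (cases "cost \<kappa> d (2*m) = 0")
      case True
      then have "cost \<kappa> d (2*m+1) \<noteq> 0" using False by blast
      from x1[OF this] show ?thesis unfolding x0[OF True] True by simp
    next
      case False
      then show ?thesis unfolding x1[OF False] using x2[of "2*m+1"] by simp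
    qed
    have "?k * 1 \<le> ?k * (16 * lev (Suc d))" using l by (intro mult_left_mono) auto
    then have "?k \<le> 16 * (lev (Suc d) * ?k)" by (simp add: mult.commute mult.left_commute)
    then have "real (length (enc (ycode \<kappa> (Suc d) m))) \<le> 3 + (16 * cost \<kappa> (Suc d) m - 6 * real (J - Suc d))"
    proof -
      have gen: "L \<le> 9 + q + u + v \<Longrightarrow> 6 + u + v \<le> 16 * (s + t) - 6 * j \<Longrightarrow> q \<le> 16 * p \<Longrightarrow> L \<le> 3 + (16 * (p + s + t) - 6 * j)"
        for L q u v s t j p :: real by (simp add: algebra_simps)
      show ?thesis unfolding c by (rule gen[OF 1 2 \<open>?k \<le> 16 * (lev (Suc d) * ?k)\<close>])
    qed
    moreover have "cost \<kappa> (Suc d) m \<noteq> 0"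
    proof -
      have "0 \<le> lev (Suc d) * ?k" using l by (intro mult_nonneg_nonneg) auto
      then show ?thesis using False n unfolding c by linarith
    qed
    ultimately show ?thesis by simp
  qed
qed

end

section \<open>Approximation by sums along branches\<close>

lemma Cauchy_Schwarz_LINT:
  fixes u v :: "'a \<Rightarrow> real"
  assumes [measurable]: "u \<in> borel_measurable M" "v \<in> borel_measurable M"
    and iu: "integrable M (\<lambda>x. (u x)\<^sup>2)" and iv: "integrable M (\<lambda>x. (v x)\<^sup>2)"
  shows "(LINT x|M. u x * v x)\<^sup>2 \<le> (LINT x|M. (u x)\<^sup>2) * (LINT x|M. (v x)\<^sup>2)"
proof -
  let ?A = "LINT x|M. (u x)\<^sup>2" and ?B = "LINT x|M. (v x)\<^sup>2" and ?C = "LINT x|M. u x * v x"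
  have iuv: "integrable M (\<lambda>x. u x * v x)" by (rule integrable_mult_L2) (use iu iv in auto)
  have q: "0 \<le> ?A - 2 * l * ?C + l\<^sup>2 * ?B" for l
  proof -
    have "0 \<le> (LINT x|M. (u x - l * v x)\<^sup>2)" by simp
    also have "\<dots> = (LINT x|M. (u x)\<^sup>2 - 2 * l * (u x * v x) + l\<^sup>2 * (v x)\<^sup>2)"
      by (intro Bochner_Integration.integral_cong refl) (simp add: power2_eq_square algebra_simps)
    also have "\<dots> = ?A - 2 * l * ?C + l\<^sup>2 * ?B" using iu iv iuv by simp
    finally show ?thesis .
  qed
  show ?thesis
  proof (cases "?B = 0")
    case True
    have "?C = 0"
    proof (rule ccontr)
      assume "?C \<noteq> 0"
      then show False using q[of "(?A + 1) / (2 * ?C)"] True by (simp add: field_simps)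
    qed
    then show ?thesis using True by simp
  next
    case False
    moreover have "0 \<le> ?B" by simp
    ultimately have B: "0 < ?B" by linarith
    have "0 \<le> ?B * (?A - 2 * (?C / ?B) * ?C + (?C / ?B)\<^sup>2 * ?B)"
      using q[of "?C / ?B"] B by (intro mult_nonneg_nonneg) auto
    also have "\<dots> = ?A * ?B - ?C\<^sup>2" using B by (simp add: power2_eq_square field_simps)
    finally show ?thesis by simp
  qed
qed

context dyadic
begin

lemma en_cmult: "en (\<lambda>i. c * a i) d m = c\<^sup>2 * en a d m"
proof (induction d arbitrary: m)
  case (Suc d)
  show ?case unfolding en.simps Suc.IH blk_cmult by (simp add: power_mult_distrib algebra_simps)
qed (simp add: power_mult_distrib)

lemma en_bound_scaled:
  assumes "0 < M" "\<And>d m. d \<le> J \<Longrightarrow> m < 2^(J-d) \<Longrightarrow> \<bar>blk a d m\<bar> \<le> M * lev d"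
  shows "en a J 0 \<le> 3 * M * (\<Sum>i<2^J. \<bar>a i\<bar>)"
proof -
  have "en (\<lambda>i. inverse M * a i) J 0 \<le> 3 * (\<Sum>i<2^J. \<bar>inverse M * a i\<bar>)"
  proof (rule en_bound)
    fix d m assume "d \<le> J" "m < (2::nat)^(J-d)"
    from assms(2)[OF this] show "\<bar>blk (\<lambda>i. inverse M * a i) d m\<bar> \<le> lev d"
      unfolding blk_cmult using \<open>0 < M\<close> by (simp add: abs_mult field_simps)
  qed
  also have "(\<Sum>i<2^J. \<bar>inverse M * a i\<bar>) = inverse M * (\<Sum>i<2^J. \<bar>a i\<bar>)"
    using \<open>0 < M\<close> by (simp add: abs_mult sum_distrib_left)
  finally have "M\<^sup>2 * ((inverse M)\<^sup>2 * en a J 0) \<le> M\<^sup>2 * (3 * (inverse M * (\<Sum>i<2^J. \<bar>a i\<bar>)))"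
    unfolding en_cmult by (rule mult_left_mono) simp
  moreover have "M\<^sup>2 * ((inverse M)\<^sup>2 * en a J 0) = en a J 0"
    using \<open>0 < M\<close> by (simp add: power_inverse)
  moreover have "M\<^sup>2 * (3 * (inverse M * (\<Sum>i<2^J. \<bar>a i\<bar>))) = 3 * M * (\<Sum>i<2^J. \<bar>a i\<bar>)"
    using \<open>0 < M\<close> by (simp add: power2_eq_square)
  ultimately show ?thesis by simp
qed

lemma path_add_diff: "path (\<lambda>d m. y d m + t * (z d m - y d m)) 0 i = path y 0 i + t * (path z 0 i - path y 0 i)"
  by (simp add: path_0 sum.distrib sum_subtractf[symmetric] sum_distrib_left)

lemma path_single:
  assumes "d0 \<le> J"
  shows "path (\<lambda>d m. if d = d0 \<and> m = m0 then v else 0) 0 i = (if i div 2^d0 = m0 then v else 0)"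
proof -
  have "path (\<lambda>d m. if d = d0 \<and> m = m0 then v else 0) 0 i
      = (\<Sum>e\<le>J. if e = d0 then (if i div 2^d0 = m0 then v else 0) else 0)"
    unfolding path_0 by (intro sum.cong refl) auto
  then show ?thesis using assms by simp
qed

lemma sum_block:
  assumes "d0 \<le> J" "m0 < 2^(J-d0)"
  shows "(\<Sum>i<2^J. a i * (if i div 2^d0 = m0 then v else 0)) = v * blk a d0 m0"
proof -
  have sub: "{m0 * 2^d0..<(m0+1) * 2^d0} \<subseteq> {..<2^J}"
  proof -
    have "(m0+1) * 2^d0 \<le> 2^(J-d0) * 2^d0" using assms(2) by (intro mult_right_mono) auto
    also have "\<dots> = 2^J" using assms(1) by (simp add: power_add[symmetric])
    finally show ?thesis by auto
  qed
  have iff: "i div 2^d0 = m0 \<longleftrightarrow> i \<in> {m0 * 2^d0..<(m0+1) * 2^d0}" for i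
  proof -
    have "i div 2^d0 = m0 \<longleftrightarrow> m0 \<le> i div 2^d0 \<and> i div 2^d0 < m0 + 1" by linarith
    also have "\<dots> \<longleftrightarrow> i \<in> {m0 * 2^d0..<(m0+1) * 2^d0}"
      unfolding less_eq_div_iff_mult_less_eq[of "2^d0" m0 i, OF zero_less_power[OF pos2]]
        div_less_iff_less_mult[of "2^d0" i "m0 + 1", OF zero_less_power[OF pos2]] by simp
    finally show ?thesis .
  qed
  have "(\<Sum>i<2^J. a i * (if i div 2^d0 = m0 then v else 0)) = (\<Sum>i\<in>{m0 * 2^d0..<(m0+1) * 2^d0}. a i * v)"
    unfolding iff by (rule sum.mono_neutral_cong_right) (use sub in auto)
  then show ?thesis by (simp add: blk_def sum_distrib_left mult.commute)
qed

text \<open>Duality: if no admissible tree function approximates \<open>F\<close>, a separating functional \<open>a\<close>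
  normalised by its largest block sum contradicts the energy estimate.\<close>

lemma approx_paths:
  assumes "0 < B" "0 < \<epsilon>"
    and FB: "\<And>a. (\<And>i. 2^J \<le> i \<Longrightarrow> a i = 0) \<Longrightarrow> (\<Sum>i<2^J. a i * F i)\<^sup>2 \<le> B * en a J 0"
  shows "\<exists>y. tsum (\<lambda>d m. lev d * \<bar>y d m\<bar>) J 0 \<le> 3 * B / \<epsilon> \<and> (\<forall>i<2^J. \<bar>F i - path y 0 i\<bar> \<le> 2 * \<epsilon>)"
proof -
  \<comment> \<open>Chosen so that (R M)(\<epsilon> A) = 3 B M A, the upper bound that the energy
    estimate gives for the squared functional.\<close>
  define R where "R = 3 * B / \<epsilon>"
  have R: "0 < R" using assms by (simp add: R_def)
  define W where "W y = tsum (\<lambda>d m. lev d * \<bar>y d m\<bar>) J 0" for y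
  \<comment> \<open>Path sums are enlarged by a sup-norm ball of radius \<epsilon>. It makes the
    separating functional pay \<epsilon> times its l_1 norm, the second norm in
    \<open>en_bound_scaled\<close>.\<close>
  define P where "P = {p. \<exists>y. W y \<le> R \<and> (\<forall>i<2^J. \<bar>p i - path y 0 i\<bar> \<le> \<epsilon>)}"
  have lev0: "0 \<le> lev d" "1 \<le> lev d" if "d \<le> J" for d using lev_ge2[OF that] by auto
  have W_conv: "W (\<lambda>d m. y d m + t * (z d m - y d m)) \<le> R" if "W y \<le> R" "W z \<le> R" "0 \<le> t" "t \<le> 1" for y z t
  proof -
    have "W (\<lambda>d m. y d m + t * (z d m - y d m)) \<le> tsum (\<lambda>d m. (1 - t) * (lev d * \<bar>y d m\<bar>) + t * (lev d * \<bar>z d m\<bar>)) J 0"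
      unfolding W_def
    proof (rule tsum_mono)
      fix e k assume "e \<le> J"
      have "y e k + t * (z e k - y e k) = (1 - t) * y e k + t * z e k" by (simp add: algebra_simps)
      also have "\<bar>\<dots>\<bar> \<le> (1 - t) * \<bar>y e k\<bar> + t * \<bar>z e k\<bar>"
        using abs_triangle_ineq[of "(1 - t) * y e k" "t * z e k"] that by (simp add: abs_mult)
      finally have "lev e * \<bar>y e k + t * (z e k - y e k)\<bar> \<le> lev e * ((1 - t) * \<bar>y e k\<bar> + t * \<bar>z e k\<bar>)"
        using lev0(1)[OF \<open>e \<le> J\<close>] by (rule mult_left_mono)
      then show "lev e * \<bar>y e k + t * (z e k - y e k)\<bar> \<le> (1 - t) * (lev e * \<bar>y e k\<bar>) + t * (lev e * \<bar>z e k\<bar>)"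
        by (simp add: algebra_simps)
    qed
    also have "\<dots> = (1 - t) * W y + t * W z" unfolding tsum_add tsum_cmult W_def ..
    also have "\<dots> \<le> (1 - t) * R + t * R" using that by (intro add_mono mult_left_mono) auto
    finally show ?thesis by (simp add: algebra_simps)
  qed
  have path_bd: "\<bar>path y 0 i\<bar> \<le> R" if "W y \<le> R" "i < 2^J" for y i
  proof -
    have "\<bar>path y 0 i\<bar> \<le> (\<Sum>e\<le>J. \<bar>y e (i div 2^e)\<bar>)" unfolding path_0 by (rule sum_abs)
    also have "\<dots> \<le> tsum (\<lambda>e k. \<bar>y e k\<bar>) J (i div 2^J)" by (rule path_le_tsum) simp
    also have "\<dots> = tsum (\<lambda>e k. \<bar>y e k\<bar>) J 0" using that(2) by simp
    also have "\<dots> \<le> W y" unfolding W_def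
    proof (rule tsum_mono)
      fix e k assume "e \<le> J"
      show "\<bar>y e k\<bar> \<le> lev e * \<bar>y e k\<bar>" using mult_right_mono[OF lev0(2)[OF \<open>e \<le> J\<close>], of "\<bar>y e k\<bar>"] by simp
    qed
    finally show ?thesis using that(1) by simp
  qed
  show ?thesis
  proof (rule ccontr)
    assume neg: "\<not> ?thesis"
    \<comment> \<open>A Euclidean distance below \<epsilon> would put every coordinate within
      \<epsilon>, hence within 2 \<epsilon> of a path sum.\<close>
    have far: "\<epsilon>\<^sup>2 \<le> (\<Sum>i<2^J. (F i - p i)\<^sup>2)" if p: "p \<in> P" for p
    proof (rule ccontr)
      assume small: "\<not> \<epsilon>\<^sup>2 \<le> (\<Sum>i<2^J. (F i - p i)\<^sup>2)"
      obtain y where y: "W y \<le> R" "\<forall>i<2^J. \<bar>p i - path y 0 i\<bar> \<le> \<epsilon>" using p unfolding P_def by blast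
      have "\<bar>F i - path y 0 i\<bar> \<le> 2 * \<epsilon>" if "i < 2^J" for i
      proof -
        have "(F i - p i)\<^sup>2 \<le> (\<Sum>i<2^J. (F i - p i)\<^sup>2)" by (rule member_le_sum) (use that in auto)
        then have "\<bar>F i - p i\<bar>\<^sup>2 \<le> \<epsilon>\<^sup>2" using small by simp
        then have "\<bar>F i - p i\<bar> \<le> \<epsilon>" using \<open>0 < \<epsilon>\<close> by (intro power2_le_imp_le[of "\<bar>F i - p i\<bar>" \<epsilon>]) auto
        moreover have "\<bar>p i - path y 0 i\<bar> \<le> \<epsilon>" using y(2) that by blast
        ultimately show ?thesis by linarith
      qed
      then show False using neg y(1) unfolding W_def R_def by blast
    qed
    have "\<exists>a. (\<exists>i\<in>{..<2^J}. a i \<noteq> 0) \<and> (\<forall>q\<in>P. (\<Sum>i<2^J. a i * q i) \<le> (\<Sum>i<2^J. a i * F i))"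
    proof (rule separation_finite)
      show "finite {..<(2::nat)^J}" by simp
      have "(\<lambda>_. 0) \<in> P" unfolding P_def using R \<open>0 < \<epsilon>\<close>
        by (auto simp: W_def path_0 intro!: exI[of _ "\<lambda>_ _. 0"])
      then show "P \<noteq> {}" by blast
      show "(\<lambda>i. p i + t * (q i - p i)) \<in> P" if pq: "p \<in> P" "q \<in> P" and t: "0 \<le> t" "t \<le> 1" for p q t
      proof -
        obtain y z where y: "W y \<le> R" "\<forall>i<2^J. \<bar>p i - path y 0 i\<bar> \<le> \<epsilon>"
          and z: "W z \<le> R" "\<forall>i<2^J. \<bar>q i - path z 0 i\<bar> \<le> \<epsilon>" using pq unfolding P_def by blast
        have "\<bar>p i + t * (q i - p i) - path (\<lambda>d m. y d m + t * (z d m - y d m)) 0 i\<bar> \<le> \<epsilon>" if i: "i < 2^J" for i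
        proof -
          have "p i + t * (q i - p i) - path (\<lambda>d m. y d m + t * (z d m - y d m)) 0 i
            = (1 - t) * (p i - path y 0 i) + t * (q i - path z 0 i)"
            unfolding path_add_diff by (simp add: algebra_simps)
          also have "\<bar>\<dots>\<bar> \<le> (1 - t) * \<bar>p i - path y 0 i\<bar> + t * \<bar>q i - path z 0 i\<bar>"
            using abs_triangle_ineq[of "(1 - t) * (p i - path y 0 i)" "t * (q i - path z 0 i)"] t by (simp add: abs_mult)
          also have "\<dots> \<le> (1 - t) * \<epsilon> + t * \<epsilon>" using y z i t by (intro add_mono mult_left_mono) auto
          finally show ?thesis by (simp add: algebra_simps)
        qed
        then show ?thesis unfolding P_def using W_conv[OF y(1) z(1) t] by blast
      qed
      show "\<bar>p i\<bar> \<le> R + \<epsilon>" if "p \<in> P" "i \<in> {..<2^J}" for p i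
      proof -
        from that(1) obtain y where y: "W y \<le> R" "\<forall>i<2^J. \<bar>p i - path y 0 i\<bar> \<le> \<epsilon>" unfolding P_def by blast
        have "\<bar>p i - path y 0 i\<bar> \<le> \<epsilon>" using y(2) that(2) by blast
        then show ?thesis using path_bd[OF y(1), of i] that(2) by simp
      qed
      show "0 < \<epsilon>\<^sup>2" using \<open>0 < \<epsilon>\<close> by simp
    qed (rule far)
    then obtain a0 i0 where a0: "i0 < 2^J" "a0 i0 \<noteq> 0" "\<And>q. q \<in> P \<Longrightarrow> (\<Sum>i<2^J. a0 i * q i) \<le> (\<Sum>i<2^J. a0 i * F i)"
      by blast
    define a where "a i = (if i < 2^J then a0 i else 0)" for i
    have sep: "(\<Sum>i<2^J. a i * q i) \<le> (\<Sum>i<2^J. a i * F i)" if "q \<in> P" for q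
      using a0(3)[OF that] by (simp add: a_def)
    define Nd where "Nd = (SIGMA d:{..J}. {..<(2::nat)^(J-d)})"
    define ratio where "ratio = (\<lambda>(d, m). \<bar>blk a d m\<bar> / lev d)"
    define M where "M = Max (ratio ` Nd)"
    have Nd: "finite Nd" "(0, i0) \<in> Nd" using a0(1) by (auto simp: Nd_def)
    have Mge: "\<bar>blk a d m\<bar> \<le> M * lev d" if "d \<le> J" "m < 2^(J-d)" for d m
    proof -
      have "(d, m) \<in> Nd" using that by (auto simp: Nd_def)
      then have "ratio (d, m) \<le> M" unfolding M_def using Nd(1) by (intro Max_ge) auto
      then show ?thesis using lev_ge2[OF that(1)] by (simp add: ratio_def divide_le_eq)
    qed
    have "M \<in> ratio ` Nd" unfolding M_def using Nd by (intro Max_in) auto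
    then obtain d0 m0 where dm: "d0 \<le> J" "m0 < 2^(J-d0)" "M = \<bar>blk a d0 m0\<bar> / lev d0"
      by (auto simp: Nd_def ratio_def)
    have ai0: "0 < \<bar>a i0\<bar>" using a0 by (simp add: a_def)
    have "\<bar>a i0\<bar> \<le> M * lev 0" using Mge[of 0 i0] a0(1) by simp
    then have "0 < M * lev 0" using ai0 by linarith
    then have M: "0 < M" using lev0(1)[of 0] by (simp add: zero_less_mult_iff)
    define A where "A = (\<Sum>i<2^J. \<bar>a i\<bar>)"
    have "\<bar>a i0\<bar> \<le> A" unfolding A_def by (rule member_le_sum) (use a0 in auto)
    then have A: "0 < A" using ai0 by linarith
    \<comment> \<open>The whole budget \<open>R\<close> is spent at one node where the ratio |a(I)|
      / \<open>lev\<close> attains its maximum \<open>M\<close>; this makes the functional equal to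
      R M.\<close>
    define v where "v = sgn (blk a d0 m0) * (R / lev d0)"
    define y where "y = (\<lambda>d m. if d = d0 \<and> m = m0 then v else 0)"
    have l0: "0 < lev d0" using lev_ge2[OF dm(1)] by linarith
    have "W y \<le> lev d0 * \<bar>v\<bar>"
    proof -
      have "W y = tsum (\<lambda>e k. if e = d0 \<and> k = m0 then lev d0 * \<bar>v\<bar> else 0) J 0"
        unfolding W_def y_def by (rule tsum_cong) auto
      also have "\<dots> \<le> lev d0 * \<bar>v\<bar>" using l0 by (intro tsum_single_le) auto
      finally show ?thesis .
    qed
    also have "\<dots> \<le> R" using l0 R by (simp add: v_def abs_mult abs_sgn_eq)
    finally have Wy: "W y \<le> R" .
    \<comment> \<open>Adding the sign pattern of \<open>a\<close> gains the further amount
      \<epsilon> A.\<close>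
    have "(\<lambda>i. path y 0 i + \<epsilon> * sgn (a i)) \<in> P"
      unfolding P_def using Wy \<open>0 < \<epsilon>\<close> by (auto simp: abs_mult abs_sgn_eq intro!: exI[of _ y])
    from sep[OF this] have "(\<Sum>i<2^J. a i * path y 0 i) + (\<Sum>i<2^J. a i * (\<epsilon> * sgn (a i))) \<le> (\<Sum>i<2^J. a i * F i)"
      by (simp add: distrib_left sum.distrib)
    moreover have "(\<Sum>i<2^J. a i * path y 0 i) = R * M"
    proof -
      have "(\<Sum>i<2^J. a i * path y 0 i) = v * blk a d0 m0"
        unfolding y_def path_single[OF dm(1)] by (rule sum_block[OF dm(1,2)])
      also have "\<dots> = R * M" unfolding v_def dm(3) by (simp add: sgn_if abs_if)
      finally show ?thesis .
    qed
    moreover have "(\<Sum>i<2^J. a i * (\<epsilon> * sgn (a i))) = \<epsilon> * A"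
      unfolding A_def sum_distrib_left by (intro sum.cong refl) (simp add: sgn_if abs_if)
    ultimately have low: "R * M + \<epsilon> * A \<le> (\<Sum>i<2^J. a i * F i)" by simp
    have "(R * M + \<epsilon> * A)\<^sup>2 \<le> (\<Sum>i<2^J. a i * F i)\<^sup>2"
      using low R M A \<open>0 < \<epsilon>\<close> by (intro power_mono) auto
    also have "\<dots> \<le> B * en a J 0" by (rule FB) (simp add: a_def)
    also have "\<dots> \<le> B * (3 * M * A)"
      unfolding A_def using \<open>0 < B\<close> by (intro mult_left_mono en_bound_scaled M Mge) auto
    finally have up: "(R * M + \<epsilon> * A)\<^sup>2 \<le> 3 * (B * M * A)" by (simp add: mult_ac)
    \<comment> \<open>Arithmetic-geometric mean: the lower bound for the square becomes 12 B M A,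
      the upper one is 3 B M A.\<close>
    have "4 * ((R * M) * (\<epsilon> * A)) \<le> (R * M + \<epsilon> * A)\<^sup>2"
      using zero_le_power2[of "R * M - \<epsilon> * A"] by (simp add: power2_eq_square algebra_simps)
    moreover have "(R * M) * (\<epsilon> * A) = 3 * (B * M * A)" using \<open>0 < \<epsilon>\<close> by (simp add: R_def)
    ultimately have "4 * (3 * (B * M * A)) \<le> 3 * (B * M * A)" using up by linarith
    moreover have "0 < B * M * A" using \<open>0 < B\<close> M A by simp
    ultimately show False by linarith
  qed
qed

text \<open>With \<epsilon> = 1 / sqrt k, scaling by sqrt k turns the error 2 \<epsilon> into 2 and
  the budget 3 B / \<epsilon> into 3 B k; rounding adds 1 to each.\<close>

lemma approx_int_paths:
  assumes "0 < B" "1 \<le> k"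
    and FB: "\<And>a. (\<And>i. 2^J \<le> i \<Longrightarrow> a i = 0) \<Longrightarrow> (\<Sum>i<2^J. a i * F i)\<^sup>2 \<le> B * en a J 0"
  shows "\<exists>\<kappa>. cost \<kappa> J 0 \<le> 3 * B * real k + 1 \<and>
    (\<forall>i<2^J. \<bar>sqrt (real k) * F i - path (\<lambda>d m. real_of_int (\<kappa> d m)) 0 i\<bar> \<le> 3)"
proof -
  let ?s = "sqrt (real k)"
  have s: "0 < ?s" using assms(2) by simp
  obtain y where y: "tsum (\<lambda>d m. lev d * \<bar>y d m\<bar>) J 0 \<le> 3 * B / (1 / ?s)"
    "\<forall>i<2^J. \<bar>F i - path y 0 i\<bar> \<le> 2 * (1 / ?s)"
    using approx_paths[OF assms(1) _ FB, of "1 / ?s"] s by auto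
  define z where "z = (\<lambda>d m. ?s * y d m)"
  have "tsum (\<lambda>d m. lev d * \<bar>z d m\<bar>) J 0 = tsum (\<lambda>d m. ?s * (lev d * \<bar>y d m\<bar>)) J 0"
    unfolding z_def using s by (intro tsum_cong) (simp add: abs_mult)
  also have "\<dots> \<le> ?s * (3 * B / (1 / ?s))"
    unfolding tsum_cmult using y(1) s by (intro mult_left_mono) auto
  also have "\<dots> = 3 * B * (?s * ?s)" by simp
  also have "\<dots> = 3 * B * real k" by simp
  finally obtain \<kappa> where \<kappa>: "tsum (\<lambda>d m. lev d * \<bar>real_of_int (\<kappa> d m)\<bar>) J 0 \<le> 3 * B * real k + 1"
    "\<forall>i. \<bar>path z 0 i - path (\<lambda>d m. real_of_int (\<kappa> d m)) 0 i\<bar> \<le> 1"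
    using rounding by blast
  have "\<bar>?s * F i - path (\<lambda>d m. real_of_int (\<kappa> d m)) 0 i\<bar> \<le> 3" if "i < 2^J" for i
  proof -
    have "path z 0 i = ?s * path y 0 i" by (simp add: z_def path_0 sum_distrib_left)
    then have "\<bar>?s * F i - path z 0 i\<bar> = ?s * \<bar>F i - path y 0 i\<bar>"
      using s by (simp add: abs_mult right_diff_distrib[symmetric])
    also have "\<dots> \<le> ?s * (2 * (1 / ?s))" using y(2) that s by (intro mult_left_mono) auto
    also have "\<dots> = 2" using s by simp
    finally have "\<bar>?s * F i - path z 0 i\<bar> \<le> 2" .
    moreover have "\<bar>path z 0 i - path (\<lambda>d m. real_of_int (\<kappa> d m)) 0 i\<bar> \<le> 1" using \<kappa>(2) by blast
    ultimately show ?thesis by linarith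
  qed
  then show ?thesis using \<kappa>(1) unfolding cost_def by blast
qed

end

section \<open>The Volterra operator\<close>

lemma borel_measurable_lebesgue_on:
  fixes g :: "real \<Rightarrow> real"
  assumes "g \<in> borel_measurable borel" shows "g \<in> borel_measurable (lebesgue_on S)"
proof -
  have "g \<in> borel_measurable lebesgue" using assms by (intro measurable_completion) simp
  then show ?thesis by (rule measurable_restrict_space1)
qed

lemma lebesgue_on_integral_le:
  fixes g :: "real \<Rightarrow> real"
  assumes "integrable lborel g" "\<And>x. 0 \<le> g x" "S \<in> sets lebesgue"
  shows "integrable (lebesgue_on S) g" "(LINT x|lebesgue_on S. g x) \<le> (LINT x|lborel. g x)"
proof -
  have g: "g \<in> borel_measurable lborel" using assms(1) by simp
  have i: "integrable lebesgue g" using assms(1) by (subst integrable_completion[OF g])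
  have S: "S \<inter> space lebesgue \<in> sets lebesgue" using assms(3) by simp
  have ii: "integrable lebesgue (\<lambda>x. indicator S x *\<^sub>R g x)"
    by (rule integrable_mult_indicator[OF assms(3) i])
  then show "integrable (lebesgue_on S) g" by (subst integrable_restrict_space[OF S])
  have "(LINT x|lebesgue_on S. g x) = (LINT x|lebesgue. indicator S x *\<^sub>R g x)"
    by (rule integral_restrict_space[OF S])
  also have "\<dots> \<le> (LINT x|lebesgue. g x)"
    by (rule integral_mono[OF ii i]) (use assms(2) in \<open>auto simp: indicator_def\<close>)
  also have "\<dots> = (LINT x|lborel. g x)" by (rule integral_completion[OF g])
  finally show "(LINT x|lebesgue_on S. g x) \<le> (LINT x|lborel. g x)" .
qed

context short
begin

section \<open>Restriction of t to the grid\<close>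

definition grid :: "nat \<Rightarrow> nat \<Rightarrow> real" where "grid J i = r * real i / 2^J"

text \<open>The minimum assigns the end point t = r to the last grid point, at distance exactly one
  mesh, since the grid consists of the 2^J left end points only.\<close>

definition idx :: "nat \<Rightarrow> real \<Rightarrow> nat" where
  "idx J t = min (nat \<lfloor>t * 2^J / r\<rfloor>) (2^J - 1)"

lemma idx_less: "idx J t < 2^J"
proof -
  have "idx J t \<le> 2^J - 1" by (simp add: idx_def)
  moreover have "(0::nat) < 2^J" by simp
  ultimately show ?thesis by linarith
qed

lemma grid_idx:
  assumes "t \<in> {0..r}" shows "\<bar>t - grid J (idx J t)\<bar> \<le> r / 2^J"
proof -
  define x where "x = t * 2^J / r"
  have x: "0 \<le> x" "x \<le> 2^J" using assms r_pos by (auto simp: x_def divide_simps)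
  have "\<bar>x - real (idx J t)\<bar> \<le> 1"
  proof (cases "nat \<lfloor>x\<rfloor> \<le> 2^J - 1")
    case True
    then have "idx J t = nat \<lfloor>x\<rfloor>" by (simp add: idx_def x_def)
    then have "real (idx J t) = real_of_int \<lfloor>x\<rfloor>" using x(1) by simp
    then show ?thesis by linarith
  next
    case False
    then have "2^J - 1 < nat \<lfloor>x\<rfloor>" by simp
    then have "(2::nat)^J \<le> nat \<lfloor>x\<rfloor>" by linarith
    then have "(2::real)^J \<le> real (nat \<lfloor>x\<rfloor>)" by (metis of_nat_le_iff of_nat_numeral of_nat_power)
    then have "(2::real)^J \<le> x" using x(1) by linarith
    then have xx: "x = 2^J" using x(2) by simp
    have "idx J t = 2^J - 1" using False by (simp add: idx_def x_def)
    then have "real (idx J t) = 2^J - 1" by (simp add: of_nat_diff)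
    then show ?thesis using xx by simp
  qed
  moreover have "t - grid J (idx J t) = r / 2^J * (x - real (idx J t))"
    using r_pos by (simp add: grid_def x_def field_simps)
  ultimately have "\<bar>t - grid J (idx J t)\<bar> \<le> r / 2^J * 1"
    using r_pos by (simp only: abs_mult) (intro mult_mono, auto)
  then show ?thesis by simp
qed

lemma grid_mem: "i < 2^J \<Longrightarrow> grid J i \<in> {0..r}"
proof -
  assume "i < 2^J"
  then have "real i \<le> 2^J" by (metis less_imp_le of_nat_le_iff of_nat_numeral of_nat_power)
  then have "r * real i \<le> r * 2^J" using r_pos by (intro mult_left_mono) auto
  then show ?thesis using r_pos by (simp add: grid_def divide_le_eq)
qed

lemma mesh: "0 < r / 2^J" "r / 2^J \<le> r" "ln (r / 2^J) \<le> - 2 - real J * (2/3)"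
proof -
  show "0 < r / 2^J" using r_pos by simp
  have "(1::real) \<le> 2^J" by simp
  then show "r / 2^J \<le> r" using r_pos by (simp add: divide_le_eq)
  have "ln (r / 2^J) = ln r - real J * ln 2" using r_pos by (simp add: ln_div ln_realpow)
  moreover have "real J * (2/3) \<le> real J * ln 2" using ln2_ge_two_thirds by (intro mult_left_mono) auto
  ultimately show "ln (r / 2^J) \<le> - 2 - real J * (2/3)" using ln_r by linarith
qed

text \<open>This fixes the height 3 k: with ln 2 >= 2/3 the logarithm of the mesh is at most -2 k,
  so 2 / |ln mesh| <= 1 / k.\<close>

lemma kt_shift_mesh:
  assumes "1 \<le> k" "t \<in> {0..r}"
  shows "(LINT s|lborel. (kt (t - s) - kt (grid (3*k) (idx (3*k) t) - s))\<^sup>2) \<le> 1 / real k"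
proof -
  define d where "d = r / 2^(3*k)"
  have d: "0 < d" "d \<le> r" "ln d \<le> - (2 * real k)" using mesh[of "3*k"] unfolding d_def by simp_all
  have "(LINT s|lborel. (kt (t - s) - kt (grid (3*k) (idx (3*k) t) - s))\<^sup>2) \<le> 2 / \<bar>ln d\<bar>"
    by (rule kt_shift_diff) (use grid_idx[OF assms(2), of "3*k"] d in \<open>auto simp: d_def\<close>)
  also have "\<dots> \<le> 2 / (2 * real k)"
    using d(3) assms(1) by (intro divide_left_mono mult_pos_pos) auto
  finally show ?thesis by simp
qed

definition ball :: "(real \<Rightarrow> real) set" where
  "ball = {f \<in> L2_space r. L2_norm r f \<le> 1}"

lemma ballD:
  assumes "f \<in> ball"
  shows "f \<in> borel_measurable (lebesgue_on {0..r})" "integrable (lebesgue_on {0..r}) (\<lambda>s. (f s)\<^sup>2)"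
    "(LINT s|lebesgue_on {0..r}. (f s)\<^sup>2) \<le> 1"
  using assms by (auto simp: ball_def L2_space_def L2_norm_def)

lemma V_op_eq:
  assumes "t \<in> {0..r}"
  shows "V_op f t = (LINT s|lebesgue_on {0..r}. f s * kt (t - s))"
proof -
  have "V_op f t = (LINT s|lebesgue. indicator {0..t} s *\<^sub>R (f s * kernel t s))"
    unfolding V_op_def by (rule integral_restrict_space) auto
  also have "\<dots> = (LINT s|lebesgue. indicator {0..r} s *\<^sub>R (f s * kt (t - s)))"
  proof (rule Bochner_Integration.integral_cong[OF refl])
    fix s :: real
    show "indicator {0..t} s *\<^sub>R (f s * kernel t s) = indicator {0..r} s *\<^sub>R (f s * kt (t - s))"
      using assms r_pos by (auto simp: indicator_def kernel_def kt_def ker_def min_def)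
  qed
  also have "\<dots> = (LINT s|lebesgue_on {0..r}. f s * kt (t - s))"
    by (rule integral_restrict_space[symmetric]) auto
  finally show ?thesis .
qed

lemma kt_comb_lebesgue:
  "(\<lambda>s. \<Sum>i\<in>I. a i * kt (t i - s)) \<in> borel_measurable (lebesgue_on {0..r})"
  "integrable (lebesgue_on {0..r}) (\<lambda>s. (\<Sum>i\<in>I. a i * kt (t i - s))\<^sup>2)"
  "(LINT s|lebesgue_on {0..r}. (\<Sum>i\<in>I. a i * kt (t i - s))\<^sup>2) \<le> (LINT s|lborel. (\<Sum>i\<in>I. a i * kt (t i - s))\<^sup>2)"
proof -
  show "(\<lambda>s. \<Sum>i\<in>I. a i * kt (t i - s)) \<in> borel_measurable (lebesgue_on {0..r})"
    by (rule borel_measurable_lebesgue_on) measurable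
  show "integrable (lebesgue_on {0..r}) (\<lambda>s. (\<Sum>i\<in>I. a i * kt (t i - s))\<^sup>2)"
    "(LINT s|lebesgue_on {0..r}. (\<Sum>i\<in>I. a i * kt (t i - s))\<^sup>2) \<le> (LINT s|lborel. (\<Sum>i\<in>I. a i * kt (t i - s))\<^sup>2)"
    by (rule lebesgue_on_integral_le[OF sum_kt_expand(1)], auto)+
qed

text \<open>A combination of values of V f is the inner product of f with the same combination of
  kernels. Together with \<open>energy_bound\<close> this is the hypothesis on \<open>F\<close> in
  \<open>approx_int_paths\<close>.\<close>

lemma V_op_comb:
  assumes "f \<in> ball" "\<And>i. i \<in> I \<Longrightarrow> t i \<in> {0..r}"
  shows "(\<Sum>i\<in>I. a i * V_op f (t i))\<^sup>2 \<le> (LINT s|lborel. (\<Sum>i\<in>I. a i * kt (t i - s))\<^sup>2)"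
proof -
  let ?L = "lebesgue_on {0..r}" and ?h = "\<lambda>s. \<Sum>i\<in>I. a i * kt (t i - s)"
  note f = ballD[OF assms(1)]
  have int: "integrable ?L (\<lambda>s. f s * kt (u - s))" for u
    using integrable_mult_L2[OF f(1) kt_comb_lebesgue(1)[of "\<lambda>_. 1" "\<lambda>_. u" "{()}"] f(2) kt_comb_lebesgue(2)] by simp
  have "(\<Sum>i\<in>I. a i * V_op f (t i)) = (\<Sum>i\<in>I. LINT s|?L. a i * (f s * kt (t i - s)))"
    using assms(2) by (intro sum.cong refl) (simp add: V_op_eq)
  also have "\<dots> = (LINT s|?L. (\<Sum>i\<in>I. a i * (f s * kt (t i - s))))"
    by (rule Bochner_Integration.integral_sum[symmetric], rule integrable_mult_right, rule int)
  also have "\<dots> = (LINT s|?L. f s * ?h s)"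
    by (intro Bochner_Integration.integral_cong refl) (simp add: sum_distrib_left mult_ac)
  finally have eq: "(\<Sum>i\<in>I. a i * V_op f (t i)) = (LINT s|?L. f s * ?h s)" .
  have "(LINT s|?L. f s * ?h s)\<^sup>2 \<le> (LINT s|?L. (f s)\<^sup>2) * (LINT s|?L. (?h s)\<^sup>2)"
    by (rule Cauchy_Schwarz_LINT[OF f(1) kt_comb_lebesgue(1) f(2) kt_comb_lebesgue(2)])
  also have "\<dots> \<le> 1 * (LINT s|?L. (?h s)\<^sup>2)" by (intro mult_right_mono f(3)) simp
  finally show ?thesis unfolding eq using kt_comb_lebesgue(3)[of a t I] by simp
qed

lemma V_op_diff:
  assumes "f \<in> ball" "t \<in> {0..r}" "u \<in> {0..r}"
  shows "(V_op f t - V_op f u)\<^sup>2 \<le> (LINT s|lborel. (kt (t - s) - kt (u - s))\<^sup>2)"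
  using V_op_comb[OF assms(1), of "{True, False}" "\<lambda>i. if i then t else u" "\<lambda>i. if i then 1 else -1"] assms by simp

lemma V_op_le_1:
  assumes "f \<in> ball" "t \<in> {0..r}" shows "\<bar>V_op f t\<bar> \<le> 1"
proof -
  have "(V_op f t)\<^sup>2 \<le> (LINT s|lborel. (kt (t - s))\<^sup>2)"
    using V_op_comb[OF assms(1), of "{()}" "\<lambda>_. t" "\<lambda>_. 1"] assms(2) by simp
  also have "\<dots> = Gam 0" using int_kt_kt[of t t] by (simp add: power2_eq_square)
  also have "\<dots> \<le> 1" by (rule Gam_0_le)
  finally show ?thesis by (simp add: abs_square_le_1)
qed

lemma V_op_continuous:
  assumes "f \<in> ball" shows "V_op f \<in> C_space r"
  unfolding C_space_def mem_Collect_eq continuous_on_iff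
proof (intro ballI allI impI)
  fix t e :: real assume t: "t \<in> {0..r}" and e: "0 < e"
  \<comment> \<open>The exponent makes 2 / |ln d| smaller than e^2.\<close>
  define d where "d = min r (exp (- (2 / e\<^sup>2) - 1))"
  have d: "0 < d" "d \<le> r" using r_pos by (auto simp: d_def)
  have "ln d \<le> - (2 / e\<^sup>2) - 1"
  proof -
    have "ln d \<le> ln (exp (- (2 / e\<^sup>2) - 1))" using d by (subst ln_le_cancel_iff) (auto simp: d_def)
    then show ?thesis by simp
  qed
  moreover have "0 < 2 / e\<^sup>2" using e by simp
  ultimately have ld: "2 / e\<^sup>2 < \<bar>ln d\<bar>" by linarith
  have "dist (V_op f u) (V_op f t) < e" if u: "u \<in> {0..r}" "dist u t < d" for u
  proof -
    have "(V_op f u - V_op f t)\<^sup>2 \<le> 2 / \<bar>ln d\<bar>"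
      using V_op_diff[OF assms u(1) t] kt_shift_diff[of u t d] u(2) d by (simp add: dist_real_def)
    also have "\<dots> < e\<^sup>2"
    proof -
      have "0 < \<bar>ln d\<bar>" using ld \<open>0 < 2 / e\<^sup>2\<close> by linarith
      moreover have "2 < \<bar>ln d\<bar> * e\<^sup>2" using ld e by (simp only: pos_divide_less_eq zero_less_power)
      ultimately show ?thesis by (simp add: pos_divide_less_eq mult.commute)
    qed
    finally have "\<bar>V_op f u - V_op f t\<bar>\<^sup>2 < e\<^sup>2" by simp
    then have "\<bar>V_op f u - V_op f t\<bar> < e" by (rule power_less_imp_less_base) (use e in simp)
    then show ?thesis by (simp add: dist_real_def)
  qed
  then show "\<exists>d>0. \<forall>u\<in>{0..r}. dist u t < d \<longrightarrow> dist (V_op f u) (V_op f t) < e" using d(1) by blast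
qed

lemma sup_norm_le:
  assumes "\<And>t. t \<in> {0..r} \<Longrightarrow> \<bar>g t\<bar> \<le> c" shows "sup_norm r g \<le> c"
  unfolding sup_norm_def using r_pos assms by (intro cSUP_least) auto

text \<open>Here 8 = 1 + 3 + 3 + 1 in units of 1 / sqrt k: each function is moved once to the grid
  and once to its integer path sums, and these agree when the codes do.\<close>

lemma V_code:
  assumes "1 \<le> k"
  shows "\<exists>code :: (real \<Rightarrow> real) \<Rightarrow> ctree.
    (\<forall>f\<in>ball. real (length (enc (code f))) \<le> 19 + 48 * energy_const * real k) \<and>
    (\<forall>f\<in>ball. \<forall>g\<in>ball. code f = code g \<longrightarrow> sup_norm r (V_op f - V_op g) \<le> 8 / sqrt (real k))"
proof -
  define J where "J = 3 * k"
  interpret dyadic J "- ln (r / 2^J)" by (rule dyadic_mesh)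
  let ?s = "sqrt (real k)"
  have s: "0 < ?s" using assms by simp
  define good where "good f \<kappa> \<longleftrightarrow> cost \<kappa> J 0 \<le> 3 * energy_const * real k + 1 \<and>
    (\<forall>i<2^J. \<bar>?s * V_op f (grid J i) - path (\<lambda>d m. real_of_int (\<kappa> d m)) 0 i\<bar> \<le> 3)" for f \<kappa>
  have ex: "\<exists>\<kappa>. good f \<kappa>" if "f \<in> ball" for f
    unfolding good_def
  proof (rule approx_int_paths[OF energy_const_pos assms])
    fix a :: "nat \<Rightarrow> real" assume a: "\<And>i. 2^J \<le> i \<Longrightarrow> a i = 0"
    have "(\<Sum>i<2^J. a i * V_op f (grid J i))\<^sup>2 \<le> (LINT s|lborel. (\<Sum>i<2^J. a i * kt (grid J i - s))\<^sup>2)"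
      by (rule V_op_comb[OF that]) (simp add: grid_mem[unfolded atLeastAtMost_iff])
    also have "\<dots> \<le> energy_const * en a J 0"
      unfolding grid_def by (rule energy_bound[OF a])
    finally show "(\<Sum>i<2^J. a i * V_op f (grid J i))\<^sup>2 \<le> energy_const * en a J 0" .
  qed
  define K where "K f = (SOME \<kappa>. good f \<kappa>)" for f
  have K: "good f (K f)" if "f \<in> ball" for f unfolding K_def using ex[OF that] by (rule someI_ex)
  have "real (length (enc (ycode (K f) J 0))) \<le> 19 + 48 * energy_const * real k" if "f \<in> ball" for f
  proof -
    have "0 \<le> cost (K f) J 0" by (rule cost_nonneg) simp
    then have "real (length (enc (ycode (K f) J 0))) \<le> 3 + 16 * cost (K f) J 0"
      using length_ycode[OF order_refl, of "K f" 0] by (auto split: if_splits)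
    also have "\<dots> \<le> 3 + 16 * (3 * energy_const * real k + 1)"
      using K[OF that] unfolding good_def by simp
    finally show ?thesis by (simp add: algebra_simps)
  qed
  moreover have "sup_norm r (V_op f - V_op g) \<le> 8 / ?s"
    if f: "f \<in> ball" and g: "g \<in> ball" and eq: "ycode (K f) J 0 = ycode (K g) J 0" for f g
  proof (rule sup_norm_le)
    fix t assume t: "t \<in> {0..r}"
    define i where "i = idx J t"
    have i: "i < 2^J" unfolding i_def by (rule idx_less)
    have near: "?s * \<bar>V_op h t - V_op h (grid J i)\<bar> \<le> 1" if "h \<in> ball" for h
    proof -
      have "(V_op h t - V_op h (grid J i))\<^sup>2 \<le> 1 / real k"
        using V_op_diff[OF that t grid_mem[OF i]] kt_shift_mesh[OF assms t] unfolding i_def J_def by linarith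
      then have "real k * (V_op h t - V_op h (grid J i))\<^sup>2 \<le> 1" using assms by (simp add: field_simps)
      then have "(?s * \<bar>V_op h t - V_op h (grid J i)\<bar>)\<^sup>2 \<le> 1\<^sup>2" by (simp add: power_mult_distrib)
      then show ?thesis by (rule power2_le_imp_le) simp
    qed
    have "\<bar>?s * V_op f (grid J i) - path (\<lambda>d m. real_of_int (K f d m)) 0 i\<bar> \<le> 3"
      "\<bar>?s * V_op g (grid J i) - path (\<lambda>d m. real_of_int (K g d m)) 0 i\<bar> \<le> 3"
      using K[OF f] K[OF g] i unfolding good_def by blast+
    then have "\<bar>?s * V_op f (grid J i) - ?s * V_op g (grid J i)\<bar> \<le> 6"
      using ycode_path[OF eq i] by linarith
    then have mid: "?s * \<bar>V_op f (grid J i) - V_op g (grid J i)\<bar> \<le> 6"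
      using s by (simp add: right_diff_distrib[symmetric] abs_mult)
    have "\<bar>V_op f t - V_op g t\<bar> \<le> \<bar>V_op f t - V_op f (grid J i)\<bar> + \<bar>V_op f (grid J i) - V_op g (grid J i)\<bar> + \<bar>V_op g t - V_op g (grid J i)\<bar>"
      by linarith
    then have "?s * \<bar>V_op f t - V_op g t\<bar> \<le> ?s * (\<bar>V_op f t - V_op f (grid J i)\<bar> + \<bar>V_op f (grid J i) - V_op g (grid J i)\<bar> + \<bar>V_op g t - V_op g (grid J i)\<bar>)"
      using s by (intro mult_left_mono) auto
    also have "\<dots> \<le> 8" unfolding distrib_left using near[OF f] near[OF g] mid by linarith
    finally show "\<bar>(V_op f - V_op g) t\<bar> \<le> 8 / ?s" using s by (simp add: pos_le_divide_eq mult.commute)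
  qed
  ultimately show ?thesis by (intro exI[of _ "\<lambda>f. ycode (K f) J 0"]) blast
qed

end

section \<open>The adjoint operator\<close>

text \<open>Cauchy-Schwarz in \<open>t\<close> against a total mass of at most 1 bounds the square
  of the average by the average of the squares; Tonelli then exchanges the integrals. Where that
  average is infinite, which happens only on a null set, the bound is trivial.\<close>

lemma L2_average:
  fixes G :: "real \<Rightarrow> real \<Rightarrow> real"
  assumes fin: "finite_measure M" and mass: "emeasure M (space M) \<le> 1" and "0 \<le> c"
    and G: "case_prod G \<in> borel_measurable (M \<Otimes>\<^sub>M lborel)"
    and bound: "\<And>t. t \<in> space M \<Longrightarrow> (\<integral>\<^sup>+s. ennreal ((G t s)\<^sup>2) \<partial>lborel) \<le> ennreal c"
  shows "(\<lambda>s. LINT t|M. G t s) \<in> borel_measurable lborel"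
    "AE s in lborel. integrable M (\<lambda>t. G t s)"
    "integrable lborel (\<lambda>s. (LINT t|M. G t s)\<^sup>2)"
    "(LINT s|lborel. (LINT t|M. G t s)\<^sup>2) \<le> c"
proof -
  interpret finite_measure M by fact
  interpret P: pair_sigma_finite M lborel
    by (intro pair_sigma_finite.intro sigma_finite_measure_axioms lborel.sigma_finite_measure_axioms)
  have G': "(\<lambda>(s, t). G t s) \<in> borel_measurable (lborel \<Otimes>\<^sub>M M)"
    using measurable_pair_swap[OF G] by simp
  show meas: "(\<lambda>s. LINT t|M. G t s) \<in> borel_measurable lborel"
    by (rule borel_measurable_lebesgue_integral) (use G' in simp)
  have sec: "(\<lambda>t. G t s) \<in> borel_measurable M" for s
    using measurable_compose[OF measurable_Pair2'[of s lborel M] G] by simp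
  define Q where "Q s = (\<integral>\<^sup>+t. ennreal ((G t s)\<^sup>2) \<partial>M)" for s
  have G2: "(\<lambda>(t, s). ennreal ((G t s)\<^sup>2)) \<in> borel_measurable (M \<Otimes>\<^sub>M lborel)"
  proof -
    have "(\<lambda>p. ennreal ((case_prod G p)\<^sup>2)) \<in> borel_measurable (M \<Otimes>\<^sub>M lborel)" using G by measurable
    then show ?thesis by (simp add: split_beta')
  qed
  have G2': "(\<lambda>(s, t). ennreal ((G t s)\<^sup>2)) \<in> borel_measurable (lborel \<Otimes>\<^sub>M M)"
    using measurable_pair_swap[OF G2] by simp
  have Qm: "Q \<in> borel_measurable lborel"
    unfolding Q_def by (rule borel_measurable_nn_integral) (use G2' in simp)
  have Qint: "(\<integral>\<^sup>+s. Q s \<partial>lborel) \<le> ennreal c"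
  proof -
    have "(\<integral>\<^sup>+s. Q s \<partial>lborel) = (\<integral>\<^sup>+t. (\<integral>\<^sup>+s. ennreal ((G t s)\<^sup>2) \<partial>lborel) \<partial>M)"
      unfolding Q_def by (rule P.Fubini'[OF G2])
    also have "\<dots> \<le> (\<integral>\<^sup>+t. ennreal c \<partial>M)" by (rule nn_integral_mono[OF bound])
    also have "\<dots> = ennreal c * emeasure M (space M)" by simp
    also have "\<dots> \<le> ennreal c * 1" using mass by (intro mult_left_mono) auto
    finally show ?thesis by simp
  qed
  have sq: "integrable M (\<lambda>t. (G t s)\<^sup>2)" if "Q s \<noteq> \<infinity>" for s
  proof (rule integrableI_bounded)
    show "(\<lambda>t. (G t s)\<^sup>2) \<in> borel_measurable M" using sec[of s] by measurable
    show "(\<integral>\<^sup>+t. ennreal (norm ((G t s)\<^sup>2)) \<partial>M) < \<infinity>"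
      using that by (simp add: Q_def less_top[symmetric])
  qed
  have int: "integrable M (\<lambda>t. G t s)" if "Q s \<noteq> \<infinity>" for s
    using integrable_mult_L2[OF sec[of s] _ sq[OF that], of "\<lambda>_. 1"] by simp
  have "(\<integral>\<^sup>+s. Q s \<partial>lborel) \<noteq> \<infinity>" using Qint by (auto simp: top_unique)
  then have "AE s in lborel. Q s \<noteq> \<infinity>" by (rule nn_integral_noteq_infinite[OF Qm])
  then show "AE s in lborel. integrable M (\<lambda>t. G t s)" using int by auto
  have pw: "ennreal ((LINT t|M. G t s)\<^sup>2) \<le> Q s" for s
  proof (cases "Q s = \<infinity>")
    case False
    have m: "measure M (space M) \<le> 1"
      using mass by (simp add: emeasure_eq_measure)
    have "(LINT t|M. G t s * 1)\<^sup>2 \<le> (LINT t|M. (G t s)\<^sup>2) * (LINT t|M. 1\<^sup>2)"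
      by (rule Cauchy_Schwarz_LINT[OF sec _ sq[OF False]]) auto
    also have "\<dots> \<le> (LINT t|M. (G t s)\<^sup>2) * 1"
      using m by (intro mult_left_mono) auto
    finally have "ennreal ((LINT t|M. G t s)\<^sup>2) \<le> ennreal (LINT t|M. (G t s)\<^sup>2)" by (intro ennreal_leI) simp
    also have "\<dots> = Q s" unfolding Q_def by (rule nn_integral_eq_integral[symmetric, OF sq[OF False]]) simp
    finally show ?thesis .
  qed simp
  have nn: "(\<integral>\<^sup>+s. ennreal ((LINT t|M. G t s)\<^sup>2) \<partial>lborel) \<le> ennreal c"
    using nn_integral_mono[of lborel "\<lambda>s. ennreal ((LINT t|M. G t s)\<^sup>2)" Q, OF pw] Qint by (rule order_trans)
  have m2: "(\<lambda>s. (LINT t|M. G t s)\<^sup>2) \<in> borel_measurable lborel" using meas by (rule borel_measurable_power)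
  show "integrable lborel (\<lambda>s. (LINT t|M. G t s)\<^sup>2)"
  proof (rule integrableI_bounded[OF m2])
    show "(\<integral>\<^sup>+s. ennreal (norm ((LINT t|M. G t s)\<^sup>2)) \<partial>lborel) < \<infinity>"
      using le_less_trans[OF nn] by simp
  qed
  show "(LINT s|lborel. (LINT t|M. G t s)\<^sup>2) \<le> c"
    by (rule integral_le_of_nn_integral[OF m2 _ \<open>0 \<le> c\<close> nn]) simp
qed

lemma five_squares: "(a + b + c + d + e)\<^sup>2 \<le> 5 * (a\<^sup>2 + b\<^sup>2 + c\<^sup>2 + d\<^sup>2 + e\<^sup>2)" for a b c d e :: real
proof -
  have "0 \<le> (a-b)\<^sup>2 + (a-c)\<^sup>2 + (a-d)\<^sup>2 + (a-e)\<^sup>2 + (b-c)\<^sup>2 + (b-d)\<^sup>2 + (b-e)\<^sup>2 + (c-d)\<^sup>2 + (c-e)\<^sup>2 + (d-e)\<^sup>2"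
    by simp
  also have "\<dots> = 5 * (a\<^sup>2 + b\<^sup>2 + c\<^sup>2 + d\<^sup>2 + e\<^sup>2) - (a + b + c + d + e)\<^sup>2"
    by (simp add: power2_eq_square algebra_simps)
  finally show ?thesis by simp
qed

context short
begin

section \<open>Potentials of positive measures and their discretisation\<close>

definition sub_prob :: "real measure \<Rightarrow> bool" where
  "sub_prob M \<longleftrightarrow> sets M = sets (borel_on r) \<and> emeasure M (space M) \<le> 1"

lemma sub_probD:
  assumes "sub_prob M"
  shows "finite_measure M" "emeasure M (space M) \<le> 1" "space M = {0..r}" "(\<lambda>t. t) \<in> borel_measurable M"
proof -
  show m: "emeasure M (space M) \<le> 1" using assms by (simp add: sub_prob_def)
  show "finite_measure M" by (rule finite_measureI) (use m in \<open>auto simp: top_unique\<close>)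
  have s: "sets M = sets (borel_on r)" using assms by (simp add: sub_prob_def)
  show "space M = {0..r}" using sets_eq_imp_space_eq[OF s] by (simp add: space_restrict_space)
  have "(\<lambda>t::real. t) \<in> borel_measurable (borel_on r)" by (rule measurable_restrict_space1) simp
  then show "(\<lambda>t. t) \<in> borel_measurable M" by (subst measurable_cong_sets[OF s refl])
qed

definition pot :: "real measure \<Rightarrow> real \<Rightarrow> real" where
  "pot M s = (LINT t|M. kt (t - s))"

definition mass :: "nat \<Rightarrow> real measure \<Rightarrow> nat \<Rightarrow> real" where
  "mass J M i = measure M {t \<in> space M. idx J t = i}"

lemma mass_nonneg: "0 \<le> mass J M i" by (simp add: mass_def)

lemma mass_0: "2^J \<le> i \<Longrightarrow> mass J M i = 0"
proof -
  assume "2^J \<le> i"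
  then have "{t \<in> space M. idx J t = i} = {}" using idx_less[of J] by (metis (mono_tags, lifting) Collect_empty_eq not_le)
  then show ?thesis by (simp only: mass_def measure_empty)
qed

lemma idx_measurable: "idx J \<in> measurable borel (count_space UNIV)"
  unfolding idx_def by measurable

lemma has_integral_idx:
  assumes "sub_prob M"
  shows "has_bochner_integral M (\<lambda>t. g (idx J t)) (\<Sum>i<2^J. g i * mass J M i)"
proof -
  interpret finite_measure M by (rule sub_probD[OF assms])
  have set: "{t \<in> space M. idx J t = i} \<in> sets M" for i
  proof -
    have "(\<lambda>t. idx J t) \<in> measurable M (count_space UNIV)"
      by (rule measurable_compose[OF sub_probD(4)[OF assms] idx_measurable])
    from measurable_sets[OF this, of "{i}"] show ?thesis
      by (simp add: vimage_def Int_def conj_commute)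
  qed
  have "has_bochner_integral M (\<lambda>t. \<Sum>i<2^J. g i * indicator {t \<in> space M. idx J t = i} t) (\<Sum>i<2^J. g i * mass J M i)"
    unfolding mass_def
    by (intro has_bochner_integral_sum has_bochner_integral_mult_right has_bochner_integral_real_indicator set)
      (simp add: emeasure_eq_measure)
  moreover have "(\<Sum>i<2^J. g i * indicator {t \<in> space M. idx J t = i} t) = g (idx J t)" if "t \<in> space M" for t
  proof -
    have "(\<Sum>i<2^J. g i * indicator {t \<in> space M. idx J t = i} t) = (\<Sum>i<2^J. if i = idx J t then g (idx J t) else 0)"
      using that by (intro sum.cong refl) auto
    then show ?thesis using idx_less[of J t] by simp
  qed
  ultimately show ?thesis by (subst has_bochner_integral_cong[OF refl _ refl]) auto
qed

lemma sum_mass_le: "sub_prob M \<Longrightarrow> (\<Sum>i<2^J. mass J M i) \<le> 1"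
proof -
  assume M: "sub_prob M"
  interpret finite_measure M by (rule sub_probD[OF M])
  have "(\<Sum>i<2^J. mass J M i) = measure M (space M)"
    using has_integral_idx[OF M, of "\<lambda>_. 1" J] by (simp add: has_bochner_integral_iff)
  then show ?thesis using sub_probD(2)[OF M] by (simp add: emeasure_eq_measure)
qed

lemma kt_pair_measurable:
  assumes "sub_prob M" "p \<in> borel_measurable borel"
  shows "(\<lambda>(t, s). kt (p t - s)) \<in> borel_measurable (M \<Otimes>\<^sub>M lborel)"
proof -
  have "(\<lambda>x. p (fst x)) \<in> borel_measurable (M \<Otimes>\<^sub>M lborel)"
    by (rule measurable_compose[OF measurable_compose[OF measurable_fst sub_probD(4)[OF assms(1)]] assms(2)])
  moreover have "(\<lambda>x. snd x) \<in> borel_measurable (M \<Otimes>\<^sub>M lborel)"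
    using measurable_snd[of M lborel] by simp
  ultimately have "(\<lambda>x. p (fst x) - snd x) \<in> borel_measurable (M \<Otimes>\<^sub>M lborel)"
    by (rule borel_measurable_diff)
  from measurable_compose[OF this kt_measurable] show ?thesis by (simp add: split_beta')
qed

lemma pot_L2:
  assumes "sub_prob M"
  shows "pot M \<in> borel_measurable lborel" "AE s in lborel. integrable M (\<lambda>t. kt (t - s))"
    "integrable lborel (\<lambda>s. (pot M s)\<^sup>2)" "(LINT s|lborel. (pot M s)\<^sup>2) \<le> 1"
proof -
  have m: "case_prod (\<lambda>t s. kt (t - s)) \<in> borel_measurable (M \<Otimes>\<^sub>M lborel)"
    using kt_pair_measurable[OF assms, of "\<lambda>t. t"] by simp
  have b: "(\<integral>\<^sup>+s. ennreal ((kt (t - s))\<^sup>2) \<partial>lborel) \<le> ennreal 1" for t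
  proof -
    have "(\<integral>\<^sup>+s. ennreal ((kt (t - s))\<^sup>2) \<partial>lborel) = ennreal (LINT s|lborel. (kt (t - s))\<^sup>2)"
      using kt_mult_integrable3[of t t] by (intro nn_integral_eq_integral) (auto simp: power2_eq_square)
    also have "(LINT s|lborel. (kt (t - s))\<^sup>2) = Gam 0" using int_kt_kt[of t t] by (simp add: power2_eq_square)
    finally show ?thesis using Gam_0_le by (simp add: ennreal_leI)
  qed
  note L = L2_average[OF sub_probD(1,2)[OF assms] zero_le_one m b]
  have eq: "pot M = (\<lambda>s. LINT t|M. kt (t - s))" by (rule ext) (simp add: pot_def)
  show "pot M \<in> borel_measurable lborel" "AE s in lborel. integrable M (\<lambda>t. kt (t - s))"
    "integrable lborel (\<lambda>s. (pot M s)\<^sup>2)" "(LINT s|lborel. (pot M s)\<^sup>2) \<le> 1"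
    unfolding eq using L by simp_all
qed

definition dpot :: "nat \<Rightarrow> real measure \<Rightarrow> real \<Rightarrow> real" where
  "dpot J M s = (\<Sum>i<2^J. mass J M i * kt (grid J i - s))"

text \<open>Moving the mass at t to its grid point changes K_t by at most 1 / sqrt k in L_2, and
  averaging over the measure preserves this.\<close>

lemma pot_approx:
  assumes M: "sub_prob M" and k: "1 \<le> k"
  shows "integrable lborel (\<lambda>s. (pot M s - dpot (3*k) M s)\<^sup>2)"
    "(LINT s|lborel. (pot M s - dpot (3*k) M s)\<^sup>2) \<le> 1 / real k"
proof -
  let ?p = "\<lambda>t. grid (3*k) (idx (3*k) t)"
  let ?G = "\<lambda>t s. kt (t - s) - kt (?p t - s)"
  have pm: "?p \<in> borel_measurable borel"
    by (rule measurable_compose[OF idx_measurable]) simp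
  have "case_prod ?G = (\<lambda>x. (case_prod (\<lambda>t s. kt (t - s)) x) - (case_prod (\<lambda>t s. kt (?p t - s)) x))"
    by (auto simp: fun_eq_iff)
  then have m: "case_prod ?G \<in> borel_measurable (M \<Otimes>\<^sub>M lborel)"
    using borel_measurable_diff[OF kt_pair_measurable[OF M, of "\<lambda>t. t"] kt_pair_measurable[OF M pm]] by simp
  have b: "(\<integral>\<^sup>+s. ennreal ((?G t s)\<^sup>2) \<partial>lborel) \<le> ennreal (1 / real k)" if "t \<in> space M" for t
  proof -
    have "(\<integral>\<^sup>+s. ennreal ((?G t s)\<^sup>2) \<partial>lborel) = ennreal (LINT s|lborel. (?G t s)\<^sup>2)"
      by (intro nn_integral_eq_integral kt_shift_integrable) auto
    also have "\<dots> \<le> ennreal (1 / real k)"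
      using kt_shift_mesh[OF k, of t] that sub_probD(3)[OF M] by (intro ennreal_leI) simp
    finally show ?thesis .
  qed
  have c: "0 \<le> 1 / real k" by simp
  note L = L2_average[OF sub_probD(1,2)[OF M] c m b]
  \<comment> \<open>Splitting the integral of the difference requires integrability in
    \<open>t\<close> of \<open>kt (t - s)\<close>, which is known for almost every \<open>s\<close>
    only.\<close>
  have ae: "AE s in lborel. (LINT t|M. ?G t s)\<^sup>2 = (pot M s - dpot (3*k) M s)\<^sup>2"
    using pot_L2(2)[OF M]
  proof (eventually_elim)
    case (elim s)
    have "has_bochner_integral M (\<lambda>t. kt (?p t - s)) (\<Sum>i<2^(3*k). kt (grid (3*k) i - s) * mass (3*k) M i)"
      by (rule has_integral_idx[OF M, of "\<lambda>i. kt (grid (3*k) i - s)"])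
    then have "(LINT t|M. ?G t s) = pot M s - dpot (3*k) M s"
      using elim by (simp add: has_bochner_integral_iff pot_def dpot_def mult.commute)
    then show ?case by simp
  qed
  have m2: "(\<lambda>s. (pot M s - dpot (3*k) M s)\<^sup>2) \<in> borel_measurable lborel"
    using pot_L2(1)[OF M] unfolding dpot_def by measurable
  show "integrable lborel (\<lambda>s. (pot M s - dpot (3*k) M s)\<^sup>2)"
    using L(3) integrable_cong_AE[OF borel_measurable_integrable[OF L(3)] m2 ae] by blast
  show "(LINT s|lborel. (pot M s - dpot (3*k) M s)\<^sup>2) \<le> 1 / real k"
    using L(4) integral_cong_AE[OF borel_measurable_integrable[OF L(3)] m2 ae] by simp
qed

lemma variation_ge:
  assumes "A \<in> sets M" "A \<noteq> {}" shows "ennreal \<bar>\<nu> A\<bar> \<le> variation M \<nu> A"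
  unfolding variation_def using assms
  by (intro SUP_upper2[of "{A}"]) (auto simp: partition_on_def disjnt_def)

lemma emeasure_measure_of_le:
  assumes "g (space M) \<le> c" shows "emeasure (measure_of (space M) (sets M) g) (space M) \<le> c"
  using assms by (simp add: emeasure_measure_of_conv)

text \<open>No countable additivity of the variation is needed here: if the set function defining
  a Jordan part were not a measure, \<open>measure_of\<close> would return the null measure.\<close>

lemma sub_prob_parts:
  assumes "\<nu> \<in> M_space r" "variation_norm r \<nu> \<le> 1"
  shows "sub_prob (positive_part (borel_on r) \<nu>)" "sub_prob (negative_part (borel_on r) \<nu>)"
proof -
  let ?v = "enn2real (variation (borel_on r) \<nu> {0..r})"
  have sp: "space (borel_on r) = {0..r}" by (simp add: space_restrict_space)
  have ne: "{0..r} \<noteq> {}" "{0..r} \<in> sets (borel_on r)" using r_pos sets.top[of "borel_on r"] unfolding sp by auto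
  have fin: "variation (borel_on r) \<nu> {0..r} < \<infinity>" using assms(1) by (simp add: M_space_def)
  have v: "?v \<le> 1" using assms(2) by (simp add: variation_norm_def)
  have "\<bar>\<nu> {0..r}\<bar> \<le> ?v"
    using enn2real_mono[OF variation_ge[OF ne(2,1)], of \<nu>] fin by simp
  with v have *: "?v + \<nu> {0..r} \<le> 2"
    "?v - \<nu> {0..r} \<le> 2" by (auto simp: abs_le_iff)
  have le: "(?v + \<nu> {0..r}) / 2 \<le> 1"
    "(?v - \<nu> {0..r}) / 2 \<le> 1" using * by simp_all
  have 1: "ennreal x \<le> 1" if "x \<le> 1" for x using ennreal_leI[OF that] by simp
  show "sub_prob (positive_part (borel_on r) \<nu>)" "sub_prob (negative_part (borel_on r) \<nu>)"
  proof -
    have "sub_prob (measure_of (space (borel_on r)) (sets (borel_on r)) g)" if "g {0..r} \<le> 1" for g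
    proof -
      have "g (space (borel_on r)) \<le> 1" unfolding sp by (rule that)
      from emeasure_measure_of_le[where g = g and M = "borel_on r" and c = 1, OF this] show ?thesis
        unfolding sub_prob_def sets.space_measure_of_eq sets.sets_measure_of_eq by blast
    qed
    then show "sub_prob (positive_part (borel_on r) \<nu>)" "sub_prob (negative_part (borel_on r) \<nu>)"
      unfolding positive_part_def negative_part_def using le by (auto intro!: 1)
  qed
qed

lemma V_adj_eq:
  assumes "\<nu> \<in> M_space r" "variation_norm r \<nu> \<le> 1" "s \<in> {0..r}"
  shows "V_adj r \<nu> s = pot (positive_part (borel_on r) \<nu>) s - pot (negative_part (borel_on r) \<nu>) s"
proof -
  have k: "kernel t s = kt (t - s)" if "t \<in> {0..r}" for t
    using that assms(3) r_pos by (auto simp: kernel_def kt_def ker_def min_def)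
  have "(LINT t|M. kernel t s) = pot M s" if "sub_prob M" for M
    unfolding pot_def using sub_probD(3)[OF that] by (intro Bochner_Integration.integral_cong refl k) simp
  then show ?thesis unfolding V_adj_def signed_integral_def using sub_prob_parts[OF assms(1,2)] by simp
qed

end

context short
begin

definition Mball :: "(real set \<Rightarrow> real) set" where
  "Mball = {\<nu> \<in> M_space r. variation_norm r \<nu> \<le> 1}"

abbreviation pos :: "(real set \<Rightarrow> real) \<Rightarrow> real measure" where "pos \<nu> \<equiv> positive_part (borel_on r) \<nu>"
abbreviation neg :: "(real set \<Rightarrow> real) \<Rightarrow> real measure" where "neg \<nu> \<equiv> negative_part (borel_on r) \<nu>"

lemma MballD:
  assumes "\<nu> \<in> Mball"
  shows "sub_prob (pos \<nu>)" "sub_prob (neg \<nu>)" "\<And>s. s \<in> {0..r} \<Longrightarrow> V_adj r \<nu> s = pot (pos \<nu>) s - pot (neg \<nu>) s"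
  using assms sub_prob_parts V_adj_eq by (auto simp: Mball_def)

lemma L2_norm_le:
  assumes eq: "\<And>s. s \<in> {0..r} \<Longrightarrow> g s = X s" and X: "X \<in> borel_measurable lborel"
    and S: "integrable lborel S" "(LINT s|lborel. S s) \<le> c" "\<And>s. (X s)\<^sup>2 \<le> S s"
  shows "g \<in> L2_space r" "L2_norm r g \<le> sqrt c"
proof -
  have sp: "space (lebesgue_on {0..r}) = {0..r}" by (simp add: space_restrict_space)
  have X': "X \<in> borel_measurable borel" using X by simp
  have "X \<in> borel_measurable (lebesgue_on {0..r})" by (rule borel_measurable_lebesgue_on[OF X'])
  then have gm: "g \<in> borel_measurable (lebesgue_on {0..r})"
    by (subst measurable_cong[of _ g X]) (auto simp: eq sp)
  have X2: "integrable lborel (\<lambda>s. (X s)\<^sup>2)"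
  proof (rule Bochner_Integration.integrable_bound[OF S(1)])
    show "(\<lambda>s. (X s)\<^sup>2) \<in> borel_measurable lborel" using X by measurable
    show "AE s in lborel. norm ((X s)\<^sup>2) \<le> norm (S s)"
    proof (rule AE_I2)
      fix s show "norm ((X s)\<^sup>2) \<le> norm (S s)"
        using S(3)[of s] zero_le_power2[of "X s"] by (simp add: abs_if)
    qed
  qed
  note L = lebesgue_on_integral_le[OF X2, of "{0..r}"]
  have i: "integrable (lebesgue_on {0..r}) (\<lambda>s. (X s)\<^sup>2)" by (rule L(1)) auto
  have "integrable (lebesgue_on {0..r}) (\<lambda>s. (g s)\<^sup>2)"
    by (subst Bochner_Integration.integrable_cong[OF refl, of _ _ "\<lambda>s. (X s)\<^sup>2"]) (auto simp: eq sp i)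
  then show "g \<in> L2_space r" using gm by (simp add: L2_space_def)
  have "(LINT s|lebesgue_on {0..r}. (g s)\<^sup>2) = (LINT s|lebesgue_on {0..r}. (X s)\<^sup>2)"
    by (rule Bochner_Integration.integral_cong[OF refl]) (auto simp: eq sp)
  also have "\<dots> \<le> (LINT s|lborel. (X s)\<^sup>2)" by (rule L(2)) auto
  also have "\<dots> \<le> (LINT s|lborel. S s)" by (rule integral_mono[OF X2 S(1) S(3)])
  also have "\<dots> \<le> c" by (rule S(2))
  finally show "L2_norm r g \<le> sqrt c" by (simp add: L2_norm_def)
qed

lemma V_adj_L2: "\<nu> \<in> Mball \<Longrightarrow> V_adj r \<nu> \<in> L2_space r"
proof -
  assume \<nu>: "\<nu> \<in> Mball"
  note P = pot_L2[OF MballD(1)[OF \<nu>]] and N = pot_L2[OF MballD(2)[OF \<nu>]]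
  show ?thesis
  proof (rule L2_norm_le(1)[OF MballD(3)[OF \<nu>] _ _ order_refl])
    show "(\<lambda>s. pot (pos \<nu>) s - pot (neg \<nu>) s) \<in> borel_measurable lborel"
      using P(1) N(1) by measurable
    show "integrable lborel (\<lambda>s. 5 * ((pot (pos \<nu>) s)\<^sup>2 + (pot (neg \<nu>) s)\<^sup>2))"
      using P(3) N(3) by simp
    show "(pot (pos \<nu>) s - pot (neg \<nu>) s)\<^sup>2 \<le> 5 * ((pot (pos \<nu>) s)\<^sup>2 + (pot (neg \<nu>) s)\<^sup>2)" for s
      using five_squares[of "pot (pos \<nu>) s" "- pot (neg \<nu>) s" 0 0 0] by simp
  qed
qed

text \<open>\<open>W\<close> replaces the potentials: by 0 for the bound on the diameter, by
  \<open>dpot\<close> for equal codes. Four replacement errors and one main term give 20 = 5 * 4 and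
  5 through \<open>five_squares\<close>.\<close>

lemma V_adj_diff_le:
  assumes m: "\<nu> \<in> Mball" "\<nu>' \<in> Mball"
    and e: "\<And>M. M \<in> {pos \<nu>, neg \<nu>, pos \<nu>', neg \<nu>'} \<Longrightarrow>
        integrable lborel (\<lambda>s. (pot M s - W M s)\<^sup>2) \<and> (LINT s|lborel. (pot M s - W M s)\<^sup>2) \<le> c"
    and w: "integrable lborel (\<lambda>s. (W (pos \<nu>) s - W (neg \<nu>) s - (W (pos \<nu>') s - W (neg \<nu>') s))\<^sup>2)"
      "(LINT s|lborel. (W (pos \<nu>) s - W (neg \<nu>) s - (W (pos \<nu>') s - W (neg \<nu>') s))\<^sup>2) \<le> c'"
  shows "L2_norm r (V_adj r \<nu> - V_adj r \<nu>') \<le> sqrt (20 * c + 5 * c')"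
proof -
  let ?e = "\<lambda>M s. pot M s - W M s"
  let ?w = "\<lambda>s. W (pos \<nu>) s - W (neg \<nu>) s - (W (pos \<nu>') s - W (neg \<nu>') s)"
  let ?X = "\<lambda>s. pot (pos \<nu>) s - pot (neg \<nu>) s - (pot (pos \<nu>') s - pot (neg \<nu>') s)"
  let ?S = "\<lambda>s. 5 * ((?e (pos \<nu>) s)\<^sup>2 + (?e (neg \<nu>) s)\<^sup>2 + (?e (pos \<nu>') s)\<^sup>2 + (?e (neg \<nu>') s)\<^sup>2 + (?w s)\<^sup>2)"
  have e1: "integrable lborel (\<lambda>s. (?e (pos \<nu>) s)\<^sup>2)" "(LINT s|lborel. (?e (pos \<nu>) s)\<^sup>2) \<le> c"
    and e2: "integrable lborel (\<lambda>s. (?e (neg \<nu>) s)\<^sup>2)" "(LINT s|lborel. (?e (neg \<nu>) s)\<^sup>2) \<le> c"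
    and e3: "integrable lborel (\<lambda>s. (?e (pos \<nu>') s)\<^sup>2)" "(LINT s|lborel. (?e (pos \<nu>') s)\<^sup>2) \<le> c"
    and e4: "integrable lborel (\<lambda>s. (?e (neg \<nu>') s)\<^sup>2)" "(LINT s|lborel. (?e (neg \<nu>') s)\<^sup>2) \<le> c"
    using e by blast+
  show ?thesis
  proof (rule L2_norm_le(2)[where X = ?X and S = ?S])
    show "(V_adj r \<nu> - V_adj r \<nu>') s = ?X s" if "s \<in> {0..r}" for s
      using MballD(3)[OF m(1) that] MballD(3)[OF m(2) that] by simp
    show "?X \<in> borel_measurable lborel"
      using pot_L2(1)[OF MballD(1)[OF m(1)]] pot_L2(1)[OF MballD(2)[OF m(1)]]
        pot_L2(1)[OF MballD(1)[OF m(2)]] pot_L2(1)[OF MballD(2)[OF m(2)]] by measurable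
    show "integrable lborel ?S"
      by (intro integrable_mult_right Bochner_Integration.integrable_add e1 e2 e3 e4 w)
    have "(LINT s|lborel. ?S s) = 5 * ((LINT s|lborel. (?e (pos \<nu>) s)\<^sup>2) + (LINT s|lborel. (?e (neg \<nu>) s)\<^sup>2)
       + (LINT s|lborel. (?e (pos \<nu>') s)\<^sup>2) + (LINT s|lborel. (?e (neg \<nu>') s)\<^sup>2) + (LINT s|lborel. (?w s)\<^sup>2))"
      using e1(1) e2(1) e3(1) e4(1) w(1) by (simp only: integral_mult_right_zero Bochner_Integration.integral_add Bochner_Integration.integrable_add)
    also have "\<dots> \<le> 5 * (c + c + c + c + c')"
      by (intro mult_left_mono add_mono e1(2) e2(2) e3(2) e4(2) w(2)) simp
    also have "\<dots> = 20 * c + 5 * c'" by simp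
    finally show "(LINT s|lborel. ?S s) \<le> 20 * c + 5 * c'" .
    show "(?X s)\<^sup>2 \<le> ?S s" for s
    proof -
      have "?X s = ?e (pos \<nu>) s + (- ?e (neg \<nu>) s) + (- ?e (pos \<nu>') s) + ?e (neg \<nu>') s + ?w s" by simp
      then show ?thesis
        using five_squares[of "?e (pos \<nu>) s" "- ?e (neg \<nu>) s" "- ?e (pos \<nu>') s" "?e (neg \<nu>') s" "?w s"]
        by (simp only: power2_minus)
    qed
  qed
qed

lemma V_adj_diam:
  assumes "\<nu> \<in> Mball" "\<nu>' \<in> Mball"
  shows "L2_norm r (V_adj r \<nu> - V_adj r \<nu>') \<le> sqrt 20"
proof -
  have "integrable lborel (\<lambda>s. (pot M s - 0)\<^sup>2) \<and> (LINT s|lborel. (pot M s - 0)\<^sup>2) \<le> 1"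
    if "M \<in> {pos \<nu>, neg \<nu>, pos \<nu>', neg \<nu>'}" for M
    using that pot_L2(3,4) MballD(1,2)[OF assms(1)] MballD(1,2)[OF assms(2)] by auto
  from V_adj_diff_le[OF assms, of "\<lambda>_ _. 0", OF this, of 0] show ?thesis by simp
qed

text \<open>Equal codes make the blocks of the positive and of the negative parts agree up to
  \<open>lev\<close> / k each, so the combined difference has M = 2 / k. Its l_1 norm is at most 4,
  the energy at most 3 * (2 / k) * 4 = 24 / k, and 5 * 24 = 120.\<close>

lemma V_adj_close:
  fixes k :: nat
  defines "J \<equiv> 3 * k"
  assumes k: "1 \<le> k" and m: "\<nu> \<in> Mball" "\<nu>' \<in> Mball"
    and eqp: "dyadic.mcode (- ln (r / 2^J)) k (mass J (pos \<nu>)) J 0 = dyadic.mcode (- ln (r / 2^J)) k (mass J (pos \<nu>')) J 0"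
    and eqn: "dyadic.mcode (- ln (r / 2^J)) k (mass J (neg \<nu>)) J 0 = dyadic.mcode (- ln (r / 2^J)) k (mass J (neg \<nu>')) J 0"
  shows "L2_norm r (V_adj r \<nu> - V_adj r \<nu>') \<le> sqrt (20 + 120 * energy_const) / sqrt (real k)"
proof -
  interpret dyadic J "- ln (r / 2^J)" by (rule dyadic_mesh)
  define d where "d i = mass J (pos \<nu>) i - mass J (neg \<nu>) i - (mass J (pos \<nu>') i - mass J (neg \<nu>') i)" for i
  have sp: "sub_prob (pos \<nu>)" "sub_prob (neg \<nu>)" "sub_prob (pos \<nu>')" "sub_prob (neg \<nu>')"
    using MballD(1,2) m by auto
  have d0: "d i = 0" if "2^J \<le> i" for i using mass_0[OF that] by (simp add: d_def)
  have w: "dpot J (pos \<nu>) s - dpot J (neg \<nu>) s - (dpot J (pos \<nu>') s - dpot J (neg \<nu>') s) = (\<Sum>i<2^J. d i * kt (grid J i - s))" for s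
    unfolding dpot_def d_def sum_subtractf[symmetric] left_diff_distrib ..
  have sumd: "(\<Sum>i<2^J. \<bar>d i\<bar>) \<le> 4"
  proof -
    have "(\<Sum>i<2^J. \<bar>d i\<bar>) \<le> (\<Sum>i<2^J. mass J (pos \<nu>) i + mass J (neg \<nu>) i + (mass J (pos \<nu>') i + mass J (neg \<nu>') i))"
    proof (rule sum_mono)
      fix i
      show "\<bar>d i\<bar> \<le> mass J (pos \<nu>) i + mass J (neg \<nu>) i + (mass J (pos \<nu>') i + mass J (neg \<nu>') i)"
        using mass_nonneg[of J "pos \<nu>" i] mass_nonneg[of J "neg \<nu>" i] mass_nonneg[of J "pos \<nu>'" i] mass_nonneg[of J "neg \<nu>'" i]
        unfolding d_def by linarith
    qed
    also have "\<dots> \<le> 4" unfolding sum.distrib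
      using sum_mass_le[OF sp(1), of J] sum_mass_le[OF sp(2), of J] sum_mass_le[OF sp(3), of J] sum_mass_le[OF sp(4), of J] by linarith
    finally show ?thesis .
  qed
  have kk: "0 < real k" using k by simp
  have "en d J 0 \<le> 3 * (2 / real k) * (\<Sum>i<2^J. \<bar>d i\<bar>)"
  proof (rule en_bound_scaled)
    fix e u assume eu: "e \<le> J" "u < (2::nat)^(J-e)"
    have u: "u div 2^(J-e) = 0" using eu by simp
    have 1: "\<bar>real k * blk (mass J (pos \<nu>)) e u - real k * blk (mass J (pos \<nu>')) e u\<bar> \<le> lev e"
      by (rule mcode_close[OF eqp mass_nonneg mass_nonneg order_refl eu(1) u])
    have 2: "\<bar>real k * blk (mass J (neg \<nu>)) e u - real k * blk (mass J (neg \<nu>')) e u\<bar> \<le> lev e"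
      by (rule mcode_close[OF eqn mass_nonneg mass_nonneg order_refl eu(1) u])
    have "blk d e u = blk (mass J (pos \<nu>)) e u - blk (mass J (neg \<nu>)) e u - (blk (mass J (pos \<nu>')) e u - blk (mass J (neg \<nu>')) e u)"
      unfolding d_def blk_diff ..
    then have "real k * blk d e u = (real k * blk (mass J (pos \<nu>)) e u - real k * blk (mass J (pos \<nu>')) e u)
        - (real k * blk (mass J (neg \<nu>)) e u - real k * blk (mass J (neg \<nu>')) e u)"
      by (simp only: right_diff_distrib)
    then have "\<bar>real k * blk d e u\<bar> \<le> 2 * lev e" using 1 2 by linarith
    then have "real k * \<bar>blk d e u\<bar> \<le> 2 * lev e" by (simp add: abs_mult)
    then show "\<bar>blk d e u\<bar> \<le> 2 / real k * lev e" using kk by (simp add: field_simps)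
  qed (use kk in simp)
  also have "\<dots> \<le> 3 * (2 / real k) * 4" using sumd by (intro mult_left_mono) auto
  finally have en: "en d J 0 \<le> 24 / real k" by simp
  have "(LINT s|lborel. (\<Sum>i<2^J. d i * kt (grid J i - s))\<^sup>2) \<le> energy_const * en d J 0"
    unfolding grid_def by (rule energy_bound[OF d0])
  also have "\<dots> \<le> energy_const * (24 / real k)"
    using en energy_const_pos by (intro mult_left_mono) auto
  finally have wb: "(LINT s|lborel. (\<Sum>i<2^J. d i * kt (grid J i - s))\<^sup>2) \<le> energy_const * (24 / real k)" .
  have "L2_norm r (V_adj r \<nu> - V_adj r \<nu>') \<le> sqrt (20 * (1 / real k) + 5 * (energy_const * (24 / real k)))"
  proof (rule V_adj_diff_le[OF m, of "dpot J"])
    show "integrable lborel (\<lambda>s. (pot M s - dpot J M s)\<^sup>2) \<and> (LINT s|lborel. (pot M s - dpot J M s)\<^sup>2) \<le> 1 / real k"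
      if "M \<in> {pos \<nu>, neg \<nu>, pos \<nu>', neg \<nu>'}" for M
      using that sp pot_approx[OF _ k] unfolding J_def by blast
  qed (unfold w, rule sum_kt_expand(1), rule wb)
  also have "20 * (1 / real k) + 5 * (energy_const * (24 / real k)) = (20 + 120 * energy_const) / real k"
    using kk by (simp add: field_simps)
  finally show ?thesis unfolding real_sqrt_divide .
qed

lemma zero_in_Mball: "(\<lambda>_. 0) \<in> Mball"
proof -
  have "variation (borel_on r) (\<lambda>_. 0) {0..r} = 0"
  proof -
    have "variation (borel_on r) (\<lambda>_. 0) {0..r} \<le> 0" unfolding variation_def by (rule SUP_least) simp
    then show ?thesis by simp
  qed
  then show ?thesis by (simp add: Mball_def M_space_def variation_norm_def signed_measure_def)
qed


section \<open>The two entropy estimates\<close>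

lemma entropy_V:
  assumes "0 < n"
  shows "operator_entropy_number (L2_space r) (L2_norm r) (C_space r) (sup_norm r) V_op n
    \<le> ereal (8 * sqrt (2 * real code_rate) * real n powr (-1/2))"
  unfolding operator_entropy_number_def ball_def[symmetric]
proof (rule entropy_rate[where 'c = ctree, OF _ V_op_continuous])
  have "(\<lambda>_. 0) \<in> ball" by (simp add: ball_def L2_space_def L2_norm_def)
  then show "ball \<noteq> {}" by blast
  show "\<exists>code :: (real \<Rightarrow> real) \<Rightarrow> ctree. finite (code ` ball) \<and> card (code ` ball) \<le> 2^(code_rate * k) \<and>
      (\<forall>f\<in>ball. \<forall>g\<in>ball. code f = code g \<longrightarrow> sup_norm r (V_op f - V_op g) \<le> 8 / sqrt (real k))"
    if k: "1 \<le> k" for k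
  proof -
    obtain code :: "(real \<Rightarrow> real) \<Rightarrow> ctree"
      where len: "\<forall>f\<in>ball. real (length (enc (code f))) \<le> 19 + 48 * energy_const * real k"
        and close: "\<forall>f\<in>ball. \<forall>g\<in>ball. code f = code g \<longrightarrow> sup_norm r (V_op f - V_op g) \<le> 8 / sqrt (real k)"
      using V_code[OF k] by blast
    define L where "L = (code_rate - 1) * k"
    have "length (enc (code f)) \<le> L" if "f \<in> ball" for f
    proof -
      have "real (length (enc (code f))) \<le> 19 + 48 * energy_const * real k" using len that by blast
      also have "\<dots> \<le> (19 + 48 * energy_const) * real k" using k by (simp add: distrib_right)
      also have "\<dots> \<le> real (nat \<lceil>19 + 48 * energy_const\<rceil>) * real k"
        by (intro mult_right_mono real_nat_ceiling_ge) simp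
      also have "\<dots> = real L" by (simp add: L_def code_rate_def)
      finally show ?thesis by (rule of_nat_le_iff[THEN iffD1])
    qed
    then have sub: "code ` ball \<subseteq> {t. length (enc t) \<le> L}" by auto
    have "card (code ` ball) \<le> card {t. length (enc t) \<le> L}"
      by (rule card_mono[OF card_ctree_le(1) sub])
    also have "\<dots> \<le> 2^(L+1)" by (rule card_ctree_le(2))
    also have "\<dots> \<le> 2^(code_rate * k)"
      using k by (intro power_increasing) (auto simp: L_def code_rate_def)
    finally show ?thesis using close finite_subset[OF sub card_ctree_le(1)] by blast
  qed
  show "sup_norm r (V_op f - V_op g) \<le> 8" if "f \<in> ball" "g \<in> ball" for f g
  proof (rule sup_norm_le)
    fix t assume "t \<in> {0..r}"
    then show "\<bar>(V_op f - V_op g) t\<bar> \<le> 8"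
      using V_op_le_1[OF that(1), of t] V_op_le_1[OF that(2), of t] unfolding fun_diff_def by linarith
  qed
qed (use assms in \<open>simp_all add: code_rate_def\<close>)

lemma entropy_V_adj:
  assumes "0 < n"
  shows "operator_entropy_number (M_space r) (variation_norm r) (L2_space r) (L2_norm r) (V_adj r) n
    \<le> ereal (sqrt (20 + 120 * energy_const) * sqrt (2 * real (28::nat)) * real n powr (-1/2))"
  unfolding operator_entropy_number_def Mball_def[symmetric]
proof (rule entropy_rate[where 'c = "ctree \<times> ctree", OF _ V_adj_L2])
  show "Mball \<noteq> {}" using zero_in_Mball by blast
  show "0 < sqrt (20 + 120 * energy_const)" using energy_const_pos by simp
  show "\<exists>code :: (real set \<Rightarrow> real) \<Rightarrow> ctree \<times> ctree. finite (code ` Mball) \<and> card (code ` Mball) \<le> 2^(28 * k) \<and>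
      (\<forall>\<nu>\<in>Mball. \<forall>\<nu>'\<in>Mball. code \<nu> = code \<nu>' \<longrightarrow>
        L2_norm r (V_adj r \<nu> - V_adj r \<nu>') \<le> sqrt (20 + 120 * energy_const) / sqrt (real k))"
    if k: "1 \<le> k" for k
  proof -
    define J where "J = 3 * k"
    interpret dyadic J "- ln (r / 2^J)" by (rule dyadic_mesh)
    define c where "c M = mcode k (mass J M) J 0" for M
    define code where "code \<nu> = (c (pos \<nu>), c (neg \<nu>))" for \<nu>
    define T where "T = {t. length (enc t) \<le> 3 + 10 * k}"
    have len: "c M \<in> T" if "sub_prob M" for M
      unfolding c_def T_def using length_mcode_root[OF mass_nonneg sum_mass_le[OF that]] by simp
    then have sub: "code ` Mball \<subseteq> T \<times> T" using MballD by (auto simp: code_def)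
    have fin: "finite (T \<times> T)" unfolding T_def by (intro finite_cartesian_product card_ctree_le)
    have "card (code ` Mball) \<le> card (T \<times> T)" by (rule card_mono[OF fin sub])
    also have "\<dots> = card T * card T" by (rule card_cartesian_product)
    also have "\<dots> \<le> 2^(3 + 10 * k + 1) * 2^(3 + 10 * k + 1)"
      unfolding T_def by (intro mult_mono card_ctree_le) auto
    also have "\<dots> = 2^((3 + 10 * k + 1) + (3 + 10 * k + 1))" by (rule power_add[symmetric])
    \<comment> \<open>Two trees of 3 + 10 k bits, each with one extra bit for counting: 8 + 20 k <=
      28 k, as k >= 1.\<close>
    also have "\<dots> \<le> 2^(28 * k)" using k by (intro power_increasing) auto
    finally have card: "card (code ` Mball) \<le> 2^(28 * k)" .
    have "L2_norm r (V_adj r \<nu> - V_adj r \<nu>') \<le> sqrt (20 + 120 * energy_const) / sqrt (real k)"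
      if "\<nu> \<in> Mball" "\<nu>' \<in> Mball" "code \<nu> = code \<nu>'" for \<nu> \<nu>'
      using V_adj_close[OF k that(1,2)] that(3) unfolding code_def c_def J_def prod.inject by blast
    then show ?thesis using card finite_subset[OF sub fin] by blast
  qed
  show "L2_norm r (V_adj r \<nu> - V_adj r \<nu>') \<le> sqrt (20 + 120 * energy_const)"
    if "\<nu> \<in> Mball" "\<nu>' \<in> Mball" for \<nu> \<nu>'
  proof -
    have "sqrt 20 \<le> sqrt (20 + 120 * energy_const)" using energy_const_pos by (intro real_sqrt_le_mono) simp
    then show ?thesis using V_adj_diam[OF that] by linarith
  qed
qed (use assms in simp_all)

end

theorem theorem6:
  "\<exists>C::real. \<forall>r::real. 0 < r \<longrightarrow> r < exp (-2) \<longrightarrow>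
     (\<forall>n::nat. 0 < n \<longrightarrow>
        max (operator_entropy_number (L2_space r) (L2_norm r) (C_space r) (sup_norm r) V_op n)
            (operator_entropy_number (M_space r) (variation_norm r) (L2_space r) (L2_norm r) (V_adj r) n)
          \<le> ereal (C * real n powr (-1/2)))"
proof (intro exI allI impI)
  let ?C1 = "8 * sqrt (2 * real code_rate)"
    and ?C2 = "sqrt (20 + 120 * energy_const) * sqrt (2 * real (28::nat))"
  fix r :: real and n :: nat
  assume r: "0 < r" "r < exp (-2)" and n: "0 < n"
  interpret short r using r by unfold_locales
  have p: "0 \<le> real n powr (-1/2)" by simp
  have "ereal (?C1 * real n powr (-1/2)) \<le> ereal (max ?C1 ?C2 * real n powr (-1/2))"
    "ereal (?C2 * real n powr (-1/2)) \<le> ereal (max ?C1 ?C2 * real n powr (-1/2))"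
    using p by (simp_all add: mult_right_mono del: of_nat_numeral)
  then show "max (operator_entropy_number (L2_space r) (L2_norm r) (C_space r) (sup_norm r) V_op n)
            (operator_entropy_number (M_space r) (variation_norm r) (L2_space r) (L2_norm r) (V_adj r) n)
          \<le> ereal (max ?C1 ?C2 * real n powr (-1/2))"
    using order_trans[OF entropy_V[OF n]] order_trans[OF entropy_V_adj[OF n]] by (intro max.boundedI) blast+
qed

end
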